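(* There is a deterministic data structure for a dynamic graph on $n$ vertices undergoing edge insertions and deletions that maintains an adaptive implicit $2^{O(\alpha)}$-coloring, with update time $O(\log^3 n)$ and query time $O(\alpha\log n)$, where $\alpha$ is the current arboricity of the graph.
   Context: A dynamic graph has a fixed vertex set $V$ with $|V|=n$, initially has no edges, and undergoes a sequence of updates, each inserting or deleting a single edge. The arboricity of a graph is the minimum number of forests into which its edge set can be partitioned. A $C$-coloring uses colors in $\{1,\dots,C\}$. A coloring is implicit if the data structure offers a query routine $\mathsf{query}(v)$ returning the color of vertex $v$, subject to the consistency requirement: for any sequence of consecutive queries $\mathsf{query}(v_1),\dots,\mathsf{query}(v_k)$ not interrupted by an update, if $v_i$ and $v_j$ ($i\neq j$) are adjacent in the current graph then $\mathsf{query}(v_i)\neq\mathsf{query}(v_j)$. The coloring is adaptive if the number of colors is bounded in terms of the arboricity $\alpha$ of the current graph (not the maximum arboricity over the whole update sequence). *)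

theory Defs
  imports Complex_Main "HOL-Library.Disjoint_Sets" "HOL-Library.Log_Nat"
begin

section \<open>Graphs and arboricity\<close>

text \<open>
  A simple graph on the vertex set \<open>{..<n}\<close> is given by its set of edges, each edge being a
  two-element set of vertices.
\<close>

definition is_cycle :: "'a set set \<Rightarrow> 'a list \<Rightarrow> bool" where
  "is_cycle E p \<longleftrightarrow> 3 \<le> length p \<and> distinct p \<and>
     (\<forall>i<length p. {p ! i, p ! (Suc i mod length p)} \<in> E)"

definition forest :: "'a set set \<Rightarrow> bool" where
  "forest E \<longleftrightarrow> (\<nexists>p. is_cycle E p)"

definition arboricity :: "'a set set \<Rightarrow> nat" where
  "arboricity E = (LEAST k. \<exists>P. partition_on E P \<and> finite P \<and> card P = k \<and> (\<forall>F\<in>P. forest F))"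

text \<open>For a finite edge set the minimum is over a nonempty set and is therefore attained.\<close>

lemma forest_singleton: "forest {e}"
  unfolding forest_def
proof
  assume "\<exists>p. is_cycle {e} p"
  then obtain p where len: "3 \<le> length p" and dist: "distinct p"
    and ed: "\<And>i. i < length p \<Longrightarrow> {p ! i, p ! (Suc i mod length p)} = e"
    by (auto simp: is_cycle_def)
  have "{p ! 0, p ! 1} = {p ! 1, p ! 2}"
  proof -
    have "0 < length p" "1 < length p" using len by linarith+
    moreover have "Suc 0 mod length p = 1" "Suc 1 mod length p = 2" using len by simp_all
    ultimately show ?thesis using ed[of 0] ed[of 1] by metis
  qed
  then have "p ! 0 = p ! 2" by (auto simp: doubleton_eq_iff)
  moreover have "0 < length p" "2 < length p" using len by linarith+
  ultimately show False using nth_eq_iff_index_eq[OF dist, of 0 2] by simp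
qed

lemma arboricity_attained:
  assumes "finite E"
  shows "\<exists>P. partition_on E P \<and> finite P \<and> card P = arboricity E \<and> (\<forall>F\<in>P. forest F)"
  unfolding arboricity_def
proof (rule LeastI_ex)
  let ?P = "(\<lambda>e. {e}) ` E"
  have "partition_on E ?P"
    by (auto intro!: partition_onI simp: disjnt_def)
  moreover have "finite ?P" "\<forall>F\<in>?P. forest F"
    using assms by (auto simp: forest_singleton)
  ultimately show "\<exists>k P. partition_on E P \<and> finite P \<and> card P = k \<and> (\<forall>F\<in>P. forest F)"
    by blast
qed

lemma arboricity_empty: "arboricity {} = 0"
proof -
  have "arboricity ({} :: 'a set set) \<le> 0"
    unfolding arboricity_def by (rule Least_le) (auto simp: partition_on_def)
  then show ?thesis by simp
qed


section \<open>A deterministic word RAM\<close>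

text \<open>
  Programs are structured programs over numbered registers and a memory addressed by words.
  The parameter \<open>w\<close> is the word length in bits: every evaluated expression, hence every address
  and every value that is ever written, is reduced modulo \<open>2 ^ w\<close>. Consequently a program can
  only use the cells with address below \<open>2 ^ w\<close>. A program is a fixed finite term that does not
  depend on the number of vertices.
\<close>

datatype binop = Add | Sub | Mul | Div | Mod | Less | Eq | And | Or | Xor | Shl | Shr

datatype exp = Num nat | Reg nat | Mem exp | Bin binop exp exp

datatype com =
    Skip
  | Assign nat exp
  | Store exp exp
  | Seq com com
  | Cond exp com com
  | While exp com

record ram =
  regs :: "nat \<Rightarrow> nat"
  mem :: "nat \<Rightarrow> nat"

text \<open>
  Subtraction wraps around, as in two's complement. Division by \<open>0\<close> yields \<open>0\<close>, and \<open>x mod 0 = x\<close>.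
\<close>

fun binop_val :: "nat \<Rightarrow> binop \<Rightarrow> nat \<Rightarrow> nat \<Rightarrow> nat" where
  "binop_val w Add x y = x + y"
| "binop_val w Sub x y = x + 2 ^ w - y"
| "binop_val w Mul x y = x * y"
| "binop_val w Div x y = x div y"
| "binop_val w Mod x y = x mod y"
| "binop_val w Less x y = of_bool (x < y)"
| "binop_val w Eq x y = of_bool (x = y)"
| "binop_val w And x y = and x y"
| "binop_val w Or x y = or x y"
| "binop_val w Xor x y = xor x y"
| "binop_val w Shl x y = x * 2 ^ y"
| "binop_val w Shr x y = x div 2 ^ y"

fun exp_val :: "nat \<Rightarrow> exp \<Rightarrow> ram \<Rightarrow> nat" where
  "exp_val w (Num k) s = k mod 2 ^ w"
| "exp_val w (Reg i) s = regs s i mod 2 ^ w"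
| "exp_val w (Mem e) s = mem s (exp_val w e s) mod 2 ^ w"
| "exp_val w (Bin f d e) s = binop_val w f (exp_val w d s) (exp_val w e s) mod 2 ^ w"

text \<open>Every node of an expression costs one time unit each time it is evaluated.\<close>

fun exp_cost :: "exp \<Rightarrow> nat" where
  "exp_cost (Num k) = 1"
| "exp_cost (Reg i) = 1"
| "exp_cost (Mem e) = 1 + exp_cost e"
| "exp_cost (Bin f d e) = 1 + exp_cost d + exp_cost e"

text \<open>
  \<open>exec w c s t s'\<close>: on words of \<open>w\<close> bits, program \<open>c\<close> started in state \<open>s\<close> halts in state \<open>s'\<close>
  after \<open>t\<close> time units.
\<close>

inductive exec :: "nat \<Rightarrow> com \<Rightarrow> ram \<Rightarrow> nat \<Rightarrow> ram \<Rightarrow> bool" for w where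
  Skip: "exec w Skip s 1 s"
| Assign: "exec w (Assign i e) s (1 + exp_cost e)
     (s\<lparr>regs := (regs s)(i := exp_val w e s)\<rparr>)"
| Store: "exec w (Store d e) s (1 + exp_cost d + exp_cost e)
     (s\<lparr>mem := (mem s)(exp_val w d s := exp_val w e s)\<rparr>)"
| Seq: "exec w c s t s' \<Longrightarrow> exec w c' s' t' s'' \<Longrightarrow> exec w (Seq c c') s (t + t') s''"
| CondTrue: "exp_val w e s \<noteq> 0 \<Longrightarrow> exec w c s t s' \<Longrightarrow>
     exec w (Cond e c c') s (1 + exp_cost e + t) s'"
| CondFalse: "exp_val w e s = 0 \<Longrightarrow> exec w c' s t s' \<Longrightarrow>
     exec w (Cond e c c') s (1 + exp_cost e + t) s'"
| WhileTrue: "exp_val w e s \<noteq> 0 \<Longrightarrow> exec w c s t s' \<Longrightarrow> exec w (While e c) s' t' s'' \<Longrightarrow>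
     exec w (While e c) s (1 + exp_cost e + t + t') s''"
| WhileFalse: "exp_val w e s = 0 \<Longrightarrow> exec w (While e c) s (1 + exp_cost e) s"

inductive_cases exec_elims:
  "exec w Skip s t s'"
  "exec w (Assign i e) s t s'"
  "exec w (Store d e) s t s'"
  "exec w (Seq c c') s t s'"
  "exec w (Cond e c c') s t s'"
  "exec w (While e c) s t s'"

lemma exec_deterministic:
  "exec w c s t s' \<Longrightarrow> exec w c s u s'' \<Longrightarrow> u = t \<and> s'' = s'"
proof (induction arbitrary: u s'' rule: exec.induct)
  case (Skip s)
  from Skip show ?case by (rule exec_elims) simp
next
  case (Assign i e s)
  from Assign show ?case by (rule exec_elims) simp
next
  case (Store d e s)
  from Store show ?case by (rule exec_elims) simp
next
  case (Seq c s t s' c' t' s\<^sub>2)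
  from Seq.prems obtain t1 s1 t2 where "exec w c s t1 s1" "exec w c' s1 t2 s''" "u = t1 + t2"
    by (rule exec_elims) blast
  then show ?case using Seq.IH(1)[of t1 s1] Seq.IH(2)[of t2 s''] by simp
next
  case (CondTrue e s c t s' c')
  obtain t1 where "exec w c s t1 s''" "u = 1 + exp_cost e + t1"
    by (rule exec_elims(5)[OF CondTrue.prems]) (use CondTrue.hyps(1) in simp_all)
  then show ?case using CondTrue.IH[of t1 s''] by simp
next
  case (CondFalse e s c' t s' c)
  obtain t1 where "exec w c' s t1 s''" "u = 1 + exp_cost e + t1"
    by (rule exec_elims(5)[OF CondFalse.prems]) (use CondFalse.hyps(1) in simp_all)
  then show ?case using CondFalse.IH[of t1 s''] by simp
next
  case (WhileTrue e s c t s' t' s\<^sub>2)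
  obtain t1 s1 t2 where "exec w c s t1 s1" "exec w (While e c) s1 t2 s''"
      "u = 1 + exp_cost e + t1 + t2"
    by (rule exec_elims(6)[OF WhileTrue.prems]) (use WhileTrue.hyps(1) in simp_all)
  then show ?case using WhileTrue.IH(1)[of t1 s1] WhileTrue.IH(2)[of t2 s''] by simp
next
  case (WhileFalse e s c)
  from WhileFalse.prems show ?case by (rule exec_elims) (use WhileFalse.hyps in simp_all)
qed

definition halts_within :: "nat \<Rightarrow> com \<Rightarrow> ram \<Rightarrow> real \<Rightarrow> bool" where
  "halts_within w c s T \<longleftrightarrow> (\<exists>t s'. exec w c s t s' \<and> real t \<le> T)"


section \<open>Dynamic graph data structures with color queries\<close>

text \<open>
  Arguments are passed in registers \<open>0\<close> and \<open>1\<close>, and the answer to a query is returned in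
  register \<open>0\<close>. Registers and memory are kept between operations; initially they are all zero,
  except that register \<open>0\<close> holds the number of vertices. A query may change the state.
\<close>

record data_structure =
  initialize :: com
  insert_edge :: com
  delete_edge :: com
  query :: com

definition start_state :: "nat \<Rightarrow> ram" where
  "start_state n = \<lparr>regs = (\<lambda>_. 0)(0 := n), mem = (\<lambda>_. 0)\<rparr>"

definition pass_vertex :: "nat \<Rightarrow> ram \<Rightarrow> ram" where
  "pass_vertex v s = s\<lparr>regs := (regs s)(0 := v)\<rparr>"

definition pass_edge :: "nat \<Rightarrow> nat \<Rightarrow> ram \<Rightarrow> ram" where
  "pass_edge u v s = s\<lparr>regs := (regs s)(0 := u, 1 := v)\<rparr>"

text \<open>
  \<open>reachable D w n E s qs\<close>: some sequence of updates and queries leads from the empty graph on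
  \<open>{..<n}\<close> to the graph with edge set \<open>E\<close> and the machine state \<open>s\<close>, and \<open>qs\<close> lists the queried
  vertices with the returned colors, in order, since the last update.
\<close>

inductive reachable ::
  "data_structure \<Rightarrow> nat \<Rightarrow> nat \<Rightarrow> nat set set \<Rightarrow> ram \<Rightarrow> (nat \<times> nat) list \<Rightarrow> bool"
  for D w n where
  init: "exec w (initialize D) (start_state n) t s \<Longrightarrow> reachable D w n {} s []"
| insert: "reachable D w n E s qs \<Longrightarrow> u < n \<Longrightarrow> v < n \<Longrightarrow> u \<noteq> v \<Longrightarrow> {u, v} \<notin> E \<Longrightarrow>
     exec w (insert_edge D) (pass_edge u v s) t s' \<Longrightarrow> reachable D w n (insert {u, v} E) s' []"
| delete: "reachable D w n E s qs \<Longrightarrow> {u, v} \<in> E \<Longrightarrow>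
     exec w (delete_edge D) (pass_edge u v s) t s' \<Longrightarrow> reachable D w n (E - {{u, v}}) s' []"
| query: "reachable D w n E s qs \<Longrightarrow> v < n \<Longrightarrow>
     exec w (query D) (pass_vertex v s) t s' \<Longrightarrow> reachable D w n E s' (qs @ [(v, regs s' 0)])"

definition consistent :: "nat set set \<Rightarrow> (nat \<times> nat) list \<Rightarrow> bool" where
  "consistent E qs \<longleftrightarrow> (\<forall>i<length qs. \<forall>j<length qs.
     i \<noteq> j \<longrightarrow> {fst (qs ! i), fst (qs ! j)} \<in> E \<longrightarrow> snd (qs ! i) \<noteq> snd (qs ! j))"

text \<open>
  The number of available colors depends on the current edge set only, through \<open>C\<close> applied to
  its arboricity.
\<close>

definition maintains_adaptive_implicit_coloring ::
  "data_structure \<Rightarrow> nat \<Rightarrow> nat \<Rightarrow> (nat \<Rightarrow> nat) \<Rightarrow> bool" where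
  "maintains_adaptive_implicit_coloring D w n C \<longleftrightarrow>
     (\<forall>E s qs. reachable D w n E s qs \<longrightarrow>
        consistent E qs \<and> snd ` set qs \<subseteq> {1..C (arboricity E)})"

text \<open>Worst-case bounds for each single operation; they include that the operation halts.\<close>

definition has_update_time :: "data_structure \<Rightarrow> nat \<Rightarrow> nat \<Rightarrow> real \<Rightarrow> bool" where
  "has_update_time D w n T \<longleftrightarrow>
     (\<forall>E s qs u v. reachable D w n E s qs \<longrightarrow> u < n \<longrightarrow> v < n \<longrightarrow> u \<noteq> v \<longrightarrow>
        (if {u, v} \<in> E then halts_within w (delete_edge D) (pass_edge u v s) T
         else halts_within w (insert_edge D) (pass_edge u v s) T))"

definition has_query_time :: "data_structure \<Rightarrow> nat \<Rightarrow> nat \<Rightarrow> (nat \<Rightarrow> real) \<Rightarrow> bool" where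
  "has_query_time D w n T \<longleftrightarrow>
     (\<forall>E s qs v. reachable D w n E s qs \<longrightarrow> v < n \<longrightarrow>
        halts_within w (query D) (pass_vertex v s) (T (arboricity E)))"

definition has_initialization_time :: "data_structure \<Rightarrow> nat \<Rightarrow> nat \<Rightarrow> real \<Rightarrow> bool" where
  "has_initialization_time D w n T \<longleftrightarrow> halts_within w (initialize D) (start_state n) T"

text \<open>For \<open>b \<ge> 1\<close> the number \<open>n\<close> itself fits into a word.\<close>

definition word_length :: "nat \<Rightarrow> nat \<Rightarrow> nat" where
  "word_length b n = b * ceillog2 (n + 1)"

end

(* For every scale k = 2^j <= L, where L is about log n, each edge is replaced by about 2L/k copies that
   are oriented individually such that l(u) <= l(v) + 1 whenever some copy points from u to v, where the
   label l is the outdegree truncated at the cap 7L. A new copy is passed on to out-neighbours of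
   smaller label until it can stay, and a removed copy is replaced along in-neighbours of larger label;
   both walks have O(L) steps, so one copy costs O(L^2) and one update O(L^3), because the numbers of
   copies sum up to O(L). If the arboricity is at most k, then the sets of vertices within distance i of
   a vertex at the cap would double L times; hence no vertex reaches the cap at scale k.

   A query uses the smallest scale at which no vertex is at the cap, so k = O(arboricity). Each vertex
   owns the edges with a majority of copies directed away from it, and these are fewer than 7k. Putting
   them into slots yields fewer than 7k functional graphs. In each of them, one Cole-Vishkin step
   reduces the vertex names to 2L colours. These are strictly monotone along a path until the path
   changes between ascent and descent, so this direction together with the parity of the O(L) steps
   until it changes is a proper colouring with 4 colours. *)
theory Submission
  imports Defs
begin

section \<open>Forests and balanced orientations\<close>

text \<open>Copying compensates for the slack of one in the orientation condition. Over the
  \<open>L\<close> steps of the doubling argument a label may fall by \<open>L\<close>, which has to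
  be small against the number of copies per vertex. With \<open>2 * (L div k) + 1\<close> copies per
  edge and arboricity at most \<open>k\<close>, a set of vertices spans at most \<open>3 * L\<close>
  copies per vertex; the cap is twice this density, \<open>6 * L\<close>, plus the possible fall
  \<open>L\<close>.

  Truncation is what makes the time bounds hold in the worst case. At a scale too small for the
  current graph outdegrees are unbounded, yet buckets, scans and walks keep length
  O(\<open>L\<close>), because a vertex at the cap accepts any further copy at once. Such a scale is
  useless for the moment, but it stays maintained and serves again once the arboricity has fallen.

  During a walk all labels are frozen: they belong to the old degrees, and a single vertex carries a
  surplus or a deficit of one.

  A query writes registers only, so its answer is a function of the memory and the vertex, and
  consistency reduces to properness of that function. A slot contributes one base-8 digit, hence
  three bits; \<open>42\<close> is three times \<open>14\<close>, where \<open>14\<close> stems from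
  \<open>7 * k\<close> slots with \<open>k < 2 * \<alpha>\<close>.\<close>

lemma exists_cycle_if_min_degree_2:
  assumes fin: "finite S" and ne: "S \<noteq> {}"
    and deg: "\<And>v e. v \<in> S \<Longrightarrow> \<exists>w\<in>S. w \<noteq> v \<and> {v, w} \<in> F \<and> {v, w} \<noteq> e"
  shows "\<not> forest F"
proof -
  define path where "path p \<longleftrightarrow> p \<noteq> [] \<and> distinct p \<and> set p \<subseteq> S \<and>
    (\<forall>i. Suc i < length p \<longrightarrow> {p ! i, p ! Suc i} \<in> F)" for p
  obtain v where "v \<in> S" using ne by blast
  then have p1: "path [v]" by (simp add: path_def)
  have bound: "length p \<le> card S" if "path p" for p
    using that fin unfolding path_def by (metis card_mono distinct_card)
  define N where "N = Max (length ` {p. path p})"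
  have fin': "finite (length ` {p. path p})"
    by (rule finite_subset[of _ "{..card S}"]) (use bound in auto)
  have "N \<in> length ` {p. path p}"
    unfolding N_def by (rule Max_in[OF fin']) (use p1 in auto)
  then obtain p where p: "path p" "length p = N" by auto
  have longest: "length q \<le> length p" if "path q" for q
    using Max_ge[OF fin', of "length q"] that p(2) N_def by simp
  obtain m where m: "length p = Suc m" using p(1) unfolding path_def by (cases p) auto
  have last: "p ! m \<in> S" using p(1) m unfolding path_def by (metis lessI nth_mem subsetD)
  \<comment> \<open>By maximality this neighbour must lie on the path, and since it is reached by an
    edge other than the last one, it lies at least two places back; the tail of the path from there
    closes to a cycle. If the path is a single vertex, the excluded set is a singleton and excludes
    nothing.\<close>
  obtain w where w: "w \<in> S" "w \<noteq> p ! m" "{p ! m, w} \<in> F" "{p ! m, w} \<noteq> {p ! (m - 1), p ! m}"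
    using deg[OF last] by blast
  have "w \<in> set p"
  proof (rule ccontr)
    assume "w \<notin> set p"
    then have "path (p @ [w])"
      using p(1) w m unfolding path_def by (auto simp: nth_append less_Suc_eq)
    then show False using longest by fastforce
  qed
  then obtain i where i: "i < length p" "p ! i = w" by (metis in_set_conv_nth)
  have im: "i < m" using i m w(2) by (metis less_antisym)
  have "i \<noteq> m - 1" using w(4) i by (auto simp: insert_commute)
  then have i2: "Suc (Suc i) \<le> m" using im by linarith
  let ?c = "drop i p"
  have len: "length ?c = Suc m - i" using m by simp
  have "is_cycle F ?c"
    unfolding is_cycle_def
  proof (intro conjI allI impI)
    show "3 \<le> length ?c" using len i2 by linarith
    show "distinct ?c" using p(1) by (simp add: path_def)
    fix t assume t: "t < length ?c"
    show "{?c ! t, ?c ! (Suc t mod length ?c)} \<in> F"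
    proof (cases "Suc t = length ?c")
      case True
      then have "i + t = m" using len im by linarith
      then have "?c ! t = p ! m" using i(1) by simp
      moreover have "?c ! (Suc t mod length ?c) = w" using True i by simp
      ultimately show ?thesis using w(3) by simp
    next
      case False
      then have "Suc t < length ?c" using t by simp
      then show ?thesis using p(1) i unfolding path_def by (simp add: nth_drop)
    qed
  qed
  then show ?thesis unfolding forest_def by blast
qed

lemma forest_mono: "forest F \<Longrightarrow> G \<subseteq> F \<Longrightarrow> forest G"
  unfolding forest_def is_cycle_def by blast

text \<open>A forest has a vertex of degree at most one. Removing it costs one vertex and at most
  one edge, so induction on the vertices applies.\<close>

lemma card_forest_le:
  assumes "finite S" "forest F" "\<And>e. e \<in> F \<Longrightarrow> \<exists>u\<in>S. \<exists>v\<in>S. u \<noteq> v \<and> e = {u, v}"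
  shows "finite F \<and> card F \<le> card S"
  using assms
proof (induction "card S" arbitrary: S F)
  case 0
  then have "F = {}" by fastforce
  then show ?case by simp
next
  case (Suc m)
  then have "S \<noteq> {}" by auto
  then obtain v e where v: "v \<in> S" "\<And>w. w \<in> S \<Longrightarrow> w \<noteq> v \<Longrightarrow> {v, w} \<in> F \<Longrightarrow> {v, w} = e"
    using exists_cycle_if_min_degree_2[of S F] Suc.prems by metis
  have "finite (F - {e}) \<and> card (F - {e}) \<le> card (S - {v})"
  proof (rule Suc.hyps(1))
    show "m = card (S - {v})" using Suc v by simp
    show "forest (F - {e})" using Suc.prems forest_mono by blast
    fix e' assume e': "e' \<in> F - {e}"
    then obtain a b where ab: "a \<in> S" "b \<in> S" "a \<noteq> b" "e' = {a, b}" using Suc.prems by blast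
    have "a \<noteq> v" "b \<noteq> v" using v(2)[of b] v(2)[of a] e' ab by (auto simp: insert_commute)
    then show "\<exists>a\<in>S - {v}. \<exists>b\<in>S - {v}. a \<noteq> b \<and> e' = {a, b}" using ab by blast
  qed (use Suc.prems in simp)
  moreover have "finite F" using calculation by simp
  moreover have "card F \<le> Suc (card (F - {e}))"
    using \<open>finite F\<close> using card.remove[of F e] by (cases "e \<in> F") (simp_all del: card_Diff_singleton card_Diff_insert)
  moreover have "card S = Suc (card (S - {v}))"
    by (rule card.remove) (use v Suc.prems in auto)
  ultimately show ?case by auto
qed

text \<open>The easy direction of the Nash-Williams theorem: each of the \<open>arboricity E\<close>
  forests contributes at most \<open>card S\<close> edges. This is the only way in which arboricity
  enters the analysis of orientations.\<close>

lemma card_induced_le_arboricity: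
  assumes "finite E" "finite S" and G: "G \<subseteq> E"
    "\<And>e. e \<in> G \<Longrightarrow> \<exists>u\<in>S. \<exists>v\<in>S. u \<noteq> v \<and> e = {u, v}"
  shows "card G \<le> arboricity E * card S"
proof -
  obtain P where P: "partition_on E P" "finite P" "card P = arboricity E" "\<forall>F\<in>P. forest F"
    using arboricity_attained[OF assms(1)] by blast
  have "G = (\<Union>F\<in>P. F \<inter> G)" using P(1) G unfolding partition_on_def by auto
  then have "card G \<le> (\<Sum>F\<in>P. card (F \<inter> G))" using card_UN_le[OF P(2)] by metis
  also have "\<dots> \<le> (\<Sum>F\<in>P. card S)"
  proof (rule sum_mono)
    fix F assume "F \<in> P"
    then have "forest (F \<inter> G)" using P(4) forest_mono by blast
    then show "card (F \<inter> G) \<le> card S"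
      using card_forest_le[OF assms(2), of "F \<inter> G"] G(2) by auto
  qed
  finally show ?thesis using P(3) by simp
qed

lemma arboricity_pos: "finite E \<Longrightarrow> E \<noteq> {} \<Longrightarrow> 0 < arboricity E"
proof (rule ccontr)
  assume "finite E" "E \<noteq> {}" "\<not> 0 < arboricity E"
  then obtain P where "partition_on E P" "finite P" "card P = 0"
    using arboricity_attained by fastforce
  then show False using \<open>E \<noteq> {}\<close> by (auto simp: partition_on_def)
qed

section \<open>Balanced orientations of edge copies and the bound on their outdegrees\<close>

definition balanced :: "nat \<Rightarrow> (nat \<Rightarrow> nat \<Rightarrow> nat) \<Rightarrow> (nat \<Rightarrow> nat) \<Rightarrow> (nat \<Rightarrow> nat \<Rightarrow> nat) \<Rightarrow> bool" where
  "balanced n x l wt \<longleftrightarrow> (\<forall>u v. 0 < x u v \<longrightarrow> u < n \<and> v < n \<and> l u \<le> Suc (l v)) \<and>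
     (\<forall>u v. x u v + x v u = wt u v)"

definition outdeg :: "nat \<Rightarrow> (nat \<Rightarrow> nat \<Rightarrow> nat) \<Rightarrow> nat \<Rightarrow> nat" where
  "outdeg n x u = (\<Sum>v<n. x u v)"

fun ball_around :: "(nat \<Rightarrow> nat \<Rightarrow> nat) \<Rightarrow> nat \<Rightarrow> nat \<Rightarrow> nat set" where
  "ball_around x u 0 = {u}"
| "ball_around x u (Suc i) = ball_around x u i \<union> {w. \<exists>v\<in>ball_around x u i. 0 < x v w}"

definition edge_weight :: "nat set set \<Rightarrow> nat \<Rightarrow> nat \<Rightarrow> nat \<Rightarrow> nat" where
  "edge_weight E B u v = (if {u, v} \<in> E then B else 0)"

definition graph_on :: "nat \<Rightarrow> nat set set \<Rightarrow> bool" where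
  "graph_on n E \<longleftrightarrow> (\<forall>e\<in>E. \<exists>u<n. \<exists>v<n. u \<noteq> v \<and> e = {u, v})"

lemma graph_onD: "graph_on n E \<Longrightarrow> e \<in> E \<Longrightarrow> \<exists>u v. u < n \<and> v < n \<and> u \<noteq> v \<and> e = {u, v}"
  unfolding graph_on_def by auto

lemma graph_on_finite: "graph_on n E \<Longrightarrow> finite E"
proof (rule finite_subset)
  show "graph_on n E \<Longrightarrow> E \<subseteq> Pow {..<n}" unfolding graph_on_def by fastforce
qed simp

text \<open>Ordered pairs meet every edge twice, once per direction; hence the factor
  \<open>2\<close>.\<close>

lemma sum_edge_weight:
  assumes "finite S" "graph_on n E"
  shows "(\<Sum>u\<in>S. \<Sum>v\<in>S. edge_weight E B u v) = 2 * B * card {e \<in> E. e \<subseteq> S}"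
proof -
  let ?D = "{(u, v). u \<in> S \<and> v \<in> S \<and> {u, v} \<in> E}"
  let ?G = "{e \<in> E. e \<subseteq> S}"
  have finD: "finite ?D" by (rule finite_subset[of _ "S \<times> S"]) (use assms in auto)
  have finG: "finite ?G" using graph_on_finite[OF assms(2)] by simp
  have "(\<Sum>u\<in>S. \<Sum>v\<in>S. edge_weight E B u v) = (\<Sum>p\<in>S \<times> S. edge_weight E B (fst p) (snd p))"
    by (simp add: sum.cartesian_product case_prod_beta)
  also have "\<dots> = (\<Sum>p\<in>S \<times> S. if p \<in> ?D then B else 0)"
    by (rule sum.cong) (auto simp: edge_weight_def)
  also have "\<dots> = (\<Sum>p\<in>?D. B)"
    by (rule sum.mono_neutral_cong_right) (use assms finD in auto)
  also have "\<dots> = B * card ?D" by simp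
  also have "card ?D = (\<Sum>e\<in>?G. card {p \<in> ?D. (\<lambda>(u, v). {u, v}) p = e})"
    unfolding card_eq_sum
    by (rule sum.group[symmetric]) (use finD finG in auto)
  also have "\<dots> = (\<Sum>e\<in>?G. 2)"
  proof (rule sum.cong)
    fix e assume e: "e \<in> ?G"
    then have "e \<in> E" by simp
    from graph_onD[OF assms(2) this] obtain u v where "u \<noteq> v" "e = {u, v}" by auto
    then have "{p \<in> ?D. (\<lambda>(u, v). {u, v}) p = e} = {(u, v), (v, u)}"
      using e by (auto simp: doubleton_eq_iff insert_commute[of v u])
    then show "card {p \<in> ?D. (\<lambda>(u, v). {u, v}) p = e} = 2" using \<open>u \<noteq> v\<close> by simp
  qed simp
  finally show ?thesis by simp
qed

text \<open>From a vertex at the cap, labels fall by at most one per out-step, so all vertices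
  within distance \<open>L\<close> still have outdegree at least
  \<open>2 * B * arboricity E\<close>. Their copies all end in the next larger ball, which can hold
  only \<open>B * arboricity E\<close> copies per vertex; so each ball is at least twice as large as
  the one before, until \<open>2 ^ L\<close> exceeds \<open>n\<close>.\<close>

lemma balanced_outdeg_lt:
  assumes bal: "balanced n x (\<lambda>u. min (outdeg n x u) cap) (edge_weight E B)"
    and g: "graph_on n E" and capb: "2 * B * arboricity E + L \<le> cap" and L: "n < 2 ^ L" and u: "u < n"
    and pos: "0 < cap"
  shows "outdeg n x u < cap"
proof (rule ccontr)
  assume "\<not> ?thesis"
  then have big: "cap \<le> outdeg n x u" by simp
  let ?R = "ball_around x u"
  have ends: "v < n" if "0 < x t v" for t v using bal that unfolding balanced_def by blast
  have wt: "x a b + x b a = edge_weight E B a b" for a b using bal unfolding balanced_def by blast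
  have sub: "?R i \<subseteq> {..<n}" for i
  proof (induction i)
    case (Suc i)
    then show ?case using ends by auto
  qed (use u in simp)
  then have fin: "finite (?R i)" for i using finite_subset by blast
  have far: "v \<in> ?R i \<Longrightarrow> cap \<le> min (outdeg n x v) cap + i" for v i
  proof (induction i arbitrary: v)
    case 0
    then show ?case using big by simp
  next
    case (Suc i)
    then consider "v \<in> ?R i" | t where "t \<in> ?R i" "0 < x t v" by auto
    then show ?case
    proof cases
      case 1
      then show ?thesis using Suc.IH[of v] by simp
    next
      case 2
      then have "min (outdeg n x t) cap \<le> Suc (min (outdeg n x v) cap)"
        using bal unfolding balanced_def by blast
      then show ?thesis using Suc.IH[OF 2(1)] by linarith
    qed
  qed
  \<comment> \<open>The sum of the outdegrees in the inner ball is compared with the number of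
    copies inside the outer ball. The summand \<open>L\<close> in the assumption on
    \<open>cap\<close> pays for the fall of the labels.\<close>
  have double: "2 * card (?R i) \<le> card (?R (Suc i))" if i: "i \<le> L" and q: "0 < 2 * B * arboricity E" for i
  proof -
    let ?S = "?R (Suc i)"
    have d: "2 * B * arboricity E \<le> outdeg n x v" if "v \<in> ?R i" for v
      using far[OF that] capb i by linarith
    have "2 * B * arboricity E * card (?R i) = (\<Sum>v\<in>?R i. 2 * B * arboricity E)" by simp
    also have "\<dots> \<le> (\<Sum>v\<in>?R i. outdeg n x v)" by (rule sum_mono) (rule d)
    also have "\<dots> = (\<Sum>v\<in>?R i. \<Sum>w\<in>?S. x v w)"
      unfolding outdeg_def
    proof (rule sum.cong)
      fix v assume "v \<in> ?R i"
      then show "(\<Sum>w<n. x v w) = (\<Sum>w\<in>?S. x v w)"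
        by (intro sum.mono_neutral_right) (use sub[of "Suc i"] in auto)
    qed simp
    also have "\<dots> \<le> (\<Sum>v\<in>?S. \<Sum>w\<in>?S. x v w)"
      by (rule sum_mono2) (use fin[of "Suc i"] in auto)
    finally have 1: "2 * B * arboricity E * card (?R i) \<le> (\<Sum>v\<in>?S. \<Sum>w\<in>?S. x v w)" .
    \<comment> \<open>Adding the sum with exchanged arguments turns directed counts into edge
      weights, because \<open>x v w + x w v\<close> is the weight of the pair.\<close>
    have "2 * (\<Sum>v\<in>?S. \<Sum>w\<in>?S. x v w) = (\<Sum>v\<in>?S. \<Sum>w\<in>?S. x v w) + (\<Sum>v\<in>?S. \<Sum>w\<in>?S. x w v)"
      using sum.swap[of x ?S ?S] by simp
    also have "\<dots> = (\<Sum>v\<in>?S. \<Sum>w\<in>?S. edge_weight E B v w)"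
      by (simp only: sum.distrib[symmetric] wt)
    also have "\<dots> = 2 * B * card {e \<in> E. e \<subseteq> ?S}" by (rule sum_edge_weight[OF fin g])
    also have "\<dots> \<le> 2 * B * (arboricity E * card ?S)"
    proof (rule mult_left_mono)
      show "card {e \<in> E. e \<subseteq> ?S} \<le> arboricity E * card ?S"
      proof (rule card_induced_le_arboricity[OF graph_on_finite[OF g] fin])
        fix e assume "e \<in> {e \<in> E. e \<subseteq> ?S}"
        then obtain a b where "a \<noteq> b" "e = {a, b}" "e \<subseteq> ?S" using graph_onD[OF g, of e] by blast
        then show "\<exists>a\<in>?S. \<exists>b\<in>?S. a \<noteq> b \<and> e = {a, b}" by auto
      qed auto
    qed simp
    finally have "(\<Sum>v\<in>?S. \<Sum>w\<in>?S. x v w) \<le> B * arboricity E * card ?S" by simp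
    with 1 have "2 * B * arboricity E * card (?R i) \<le> B * arboricity E * card ?S" by (rule order_trans)
    then have "(B * arboricity E) * (2 * card (?R i)) \<le> (B * arboricity E) * card ?S"
      by (simp only: mult.left_commute mult.commute mult.assoc)
    then show ?thesis using q by simp
  qed
  show False
  proof (cases "0 < 2 * B * arboricity E")
    case True
    have "2 ^ i \<le> card (?R i)" if "i \<le> L" for i
      using that
    proof (induction i)
      case (Suc i)
      then show ?case using double[of i] True by simp
    qed simp
    then have "2 ^ L \<le> card (?R L)" by simp
    also have "\<dots> \<le> n" using card_mono[OF _ sub[of L]] by simp
    finally show False using L by simp
  next
    \<comment> \<open>The doubling argument cannot divide by \<open>B * arboricity E\<close> here.
      But then no copies exist at all, and an outdegree of zero cannot reach a positive cap.\<close>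
    case False
    have "edge_weight E B a b = 0" for a b
    proof (cases "{a, b} \<in> E")
      case True
      then have "E \<noteq> {}" by auto
      then have "B = 0" using False arboricity_pos[OF graph_on_finite[OF g]] by simp
      then show ?thesis by (simp add: edge_weight_def)
    qed (simp add: edge_weight_def)
    then have "x a b = 0" for a b using wt by (metis add_is_0)
    then show False using big pos by (simp add: outdeg_def)
  qed
qed

section \<open>Weakest preconditions with running time\<close>

text \<open>As execution is deterministic, the existential form is total correctness: it includes
  termination, and the exact running time is handed to \<open>Q\<close> along with the final
  state.\<close>

definition wp :: "nat \<Rightarrow> com \<Rightarrow> ram \<Rightarrow> (nat \<Rightarrow> ram \<Rightarrow> bool) \<Rightarrow> bool" where
  "wp w c s Q \<longleftrightarrow> (\<exists>t s'. exec w c s t s' \<and> Q t s')"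

lemma wp_mono: "wp w c s Q \<Longrightarrow> (\<And>t s'. Q t s' \<Longrightarrow> Q' t s') \<Longrightarrow> wp w c s Q'"
  unfolding wp_def by blast

lemma wp_exec: "exec w c s t s' \<Longrightarrow> wp w c s Q = Q t s'"
  unfolding wp_def using exec_deterministic by blast

lemma wp_Skip: "wp w Skip s Q = Q 1 s"
  by (rule wp_exec[OF exec.Skip])

lemma wp_Assign: "wp w (Assign i e) s Q = Q (1 + exp_cost e) (s\<lparr>regs := (regs s)(i := exp_val w e s)\<rparr>)"
  by (rule wp_exec[OF exec.Assign])

lemma wp_Store: "wp w (Store d e) s Q =
    Q (1 + exp_cost d + exp_cost e) (s\<lparr>mem := (mem s)(exp_val w d s := exp_val w e s)\<rparr>)"
  by (rule wp_exec[OF exec.Store])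

lemma wp_Seq: "wp w (Seq c c') s Q = wp w c s (\<lambda>t s'. wp w c' s' (\<lambda>t' s''. Q (t + t') s''))"
  unfolding wp_def by (blast intro: exec.Seq elim!: exec_elims(4))

lemma wp_Cond: "wp w (Cond e c c') s Q =
    (if exp_val w e s \<noteq> 0 then wp w c s (\<lambda>t. Q (1 + exp_cost e + t))
     else wp w c' s (\<lambda>t. Q (1 + exp_cost e + t)))"
proof (cases "exp_val w e s = 0")
  case True
  have "exec w (Cond e c c') s t s' \<longleftrightarrow> (\<exists>t'. t = 1 + exp_cost e + t' \<and> exec w c' s t' s')" for t s'
  proof
    assume "exec w (Cond e c c') s t s'"
    then show "\<exists>t'. t = 1 + exp_cost e + t' \<and> exec w c' s t' s'"
      by (rule exec_elims(5)) (use True in auto)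
  qed (use True exec.CondFalse in blast)
  then show ?thesis unfolding wp_def using True by auto
next
  case False
  have "exec w (Cond e c c') s t s' \<longleftrightarrow> (\<exists>t'. t = 1 + exp_cost e + t' \<and> exec w c s t' s')" for t s'
  proof
    assume "exec w (Cond e c c') s t s'"
    then show "\<exists>t'. t = 1 + exp_cost e + t' \<and> exec w c s t' s'"
      by (rule exec_elims(5)) (use False in auto)
  qed (use False exec.CondTrue in blast)
  then show ?thesis unfolding wp_def using False by auto
qed

lemma wp_SeqI:
  assumes "wp w c s Q" "\<And>t s'. Q t s' \<Longrightarrow> wp w c' s' (\<lambda>t' s''. R (t + t') s'')"
  shows "wp w (Seq c c') s R"
  unfolding wp_Seq using assms by (rule wp_mono)

text \<open>The potential accounts for the time and makes the loop terminate.\<close>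

lemma wp_While:
  assumes step: "\<And>s. I s \<Longrightarrow> exp_val w e s \<noteq> 0 \<Longrightarrow>
      wp w c s (\<lambda>t s'. I s' \<and> 1 + exp_cost e + t + pot s' \<le> pot s)"
    and init: "I s"
  shows "wp w (While e c) s (\<lambda>t s'. I s' \<and> exp_val w e s' = 0 \<and> t + pot s' \<le> pot s + 1 + exp_cost e)"
  using init
proof (induction "pot s" arbitrary: s rule: less_induct)
  case less
  show ?case
  proof (cases "exp_val w e s = 0")
    case True
    then have "exec w (While e c) s (1 + exp_cost e) s" by (rule exec.WhileFalse)
    then show ?thesis unfolding wp_def using True less.prems by force
  next
    case False
    then obtain t s1 where 1: "exec w c s t s1" "I s1" "1 + exp_cost e + t + pot s1 \<le> pot s"
      using step[OF less.prems] unfolding wp_def by blast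
    then have "pot s1 < pot s" by linarith
    from less.hyps[OF this 1(2)] obtain t' s2 where
      2: "exec w (While e c) s1 t' s2" "I s2" "exp_val w e s2 = 0" "t' + pot s2 \<le> pot s1 + 1 + exp_cost e"
      unfolding wp_def by blast
    have "exec w (While e c) s (1 + exp_cost e + t + t') s2"
      by (rule exec.WhileTrue[OF False 1(1) 2(1)])
    then show ?thesis unfolding wp_def using 1 2 by force
  qed
qed

text \<open>The case of a uniform cost per round: the potential is \<open>K * \<mu>\<close>, where
  \<open>K\<close> covers both the test and the body.\<close>

lemma wp_For:
  assumes "\<And>s. I s \<Longrightarrow> exp_val w e s \<noteq> 0 \<Longrightarrow>
      wp w c s (\<lambda>t s'. I s' \<and> \<mu> s' < \<mu> s \<and> 1 + exp_cost e + t \<le> K)"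
    and "I s"
  shows "wp w (While e c) s (\<lambda>t s'. I s' \<and> exp_val w e s' = 0 \<and> t \<le> K * \<mu> s + 1 + exp_cost e)"
proof (rule wp_mono[OF wp_While[where pot = "\<lambda>s. K * \<mu> s" and I = I]])
  fix s assume "I s" "exp_val w e s \<noteq> 0"
  from assms(1)[OF this] show "wp w c s (\<lambda>t s'. I s' \<and> 1 + exp_cost e + t + K * \<mu> s' \<le> K * \<mu> s)"
  proof (rule wp_mono)
    fix t s' assume *: "I s' \<and> \<mu> s' < \<mu> s \<and> 1 + exp_cost e + t \<le> K"
    then have "K * Suc (\<mu> s') \<le> K * \<mu> s" by (intro mult_le_mono) auto
    then show "I s' \<and> 1 + exp_cost e + t + K * \<mu> s' \<le> K * \<mu> s" using * by simp
  qed
qed (use assms(2) in auto)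

text \<open>As long as all registers and cells satisfy this bound, the reduction modulo
  \<open>2 ^ w\<close> that every read performs is the identity.\<close>

definition bdd :: "nat \<Rightarrow> (nat \<Rightarrow> nat) \<Rightarrow> bool" where
  "bdd W f \<longleftrightarrow> (\<forall>i. f i < W)"

lemma bddD: "bdd W f \<Longrightarrow> f i < W"
  by (simp add: bdd_def)

lemma bdd_upd [simp]: "bdd W f \<Longrightarrow> v < W \<Longrightarrow> bdd W (f(i := v))"
  by (simp add: bdd_def)

lemma exp_val_less: "exp_val w e s < 2 ^ w"
  by (cases e) auto

lemma exp_val_Reg [simp]: "bdd (2 ^ w) (regs s) \<Longrightarrow> exp_val w (Reg i) s = regs s i"
  by (simp add: bddD)

lemma exp_val_Mem [simp]: "bdd (2 ^ w) (mem s) \<Longrightarrow> exp_val w (Mem e) s = mem s (exp_val w e s)"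
  by (simp add: bddD)

lemma exp_val_Sub: "exp_val w e s \<le> exp_val w d s \<Longrightarrow>
    exp_val w (Bin Sub d e) s = exp_val w d s - exp_val w e s"
proof -
  assume le: "exp_val w e s \<le> exp_val w d s"
  have "exp_val w d s - exp_val w e s < 2 ^ w" using exp_val_less[of w d s] by (rule less_imp_diff_less)
  moreover have "exp_val w d s + 2 ^ w - exp_val w e s = 2 ^ w + (exp_val w d s - exp_val w e s)"
    using le by simp
  ultimately show ?thesis by (simp only: exp_val.simps binop_val.simps mod_add_self1 mod_less)
qed

section \<open>Memory layout\<close>

definition adr :: "nat \<Rightarrow> nat \<Rightarrow> nat \<Rightarrow> nat \<Rightarrow> nat \<Rightarrow> nat \<Rightarrow> nat" where
  "adr M k j b c d = (((k * M + j) * M + b) * M + c) * M + d"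

lemma horner_eq_iff: "d < M \<Longrightarrow> d' < M \<Longrightarrow> a * M + d = a' * M + d' \<longleftrightarrow> a = a' \<and> d = (d'::nat)"
  by (metis add.commute div_mult_self3 div_less mod_mult_self3 mod_less add_right_cancel less_nat_zero_code add_0 mult.commute)

text \<open>An address is a number in base \<open>M\<close> whose leading digit selects the array
  and whose second digit selects the scale. Positional notation is unique when all digits but the
  leading one are below \<open>M\<close>.\<close>

lemma adr_eq_iff:
  assumes "j < M" "b < M" "c < M" "d < M" "j' < M" "b' < M" "c' < M" "d' < M"
  shows "adr M k j b c d = adr M k' j' b' c' d' \<longleftrightarrow> k = k' \<and> j = j' \<and> b = b' \<and> c = c' \<and> d = d'"
  using assms by (simp add: adr_def horner_eq_iff)

lemma horner_less: "a < A \<Longrightarrow> d < M \<Longrightarrow> a * M + d < A * (M::nat)"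
proof -
  assume "a < A" "d < M"
  then have "a * M + d < Suc a * M" by simp
  also have "\<dots> \<le> A * M" using \<open>a < A\<close> by (intro mult_le_mono) auto
  finally show ?thesis .
qed

text \<open>Indices outside the layout read as \<open>0\<close>. With this convention a store is
  exactly a function update of the view of its own scale and leaves the views of the other scales
  equal as functions.\<close>

definition view :: "nat \<Rightarrow> (nat \<Rightarrow> nat) \<Rightarrow> nat \<Rightarrow> nat \<times> nat \<times> nat \<times> nat \<Rightarrow> nat" where
  "view M m j = (\<lambda>(k, b, c, d). if b < M \<and> c < M \<and> d < M then m (adr M k j b c d) else 0)"

lemma view_upd:
  assumes "j < M" "b < M" "c < M" "d < M" "j' < M"
  shows "view M (m(adr M k j b c d := v)) j' =
    (if j' = j then (view M m j)((k, b, c, d) := v) else view M m j')"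
  using assms by (auto simp: view_def fun_eq_iff adr_eq_iff)

text \<open>
  Registers \<open>2\<close>, \<open>3\<close>, \<open>4\<close> permanently hold \<open>M\<close>, \<open>L\<close> and the cap; register \<open>5\<close> holds the index \<open>j\<close> of
  the current scale. The arrays, selected by \<open>k\<close>, are: for the set with index \<open>(b, c)\<close> its elements
  (\<open>0\<close>), their positions (\<open>1\<close>) and its size (\<open>2\<close>); the number of copies from \<open>b\<close> to \<open>c\<close> (\<open>3\<close>); the
  outdegree of \<open>b\<close> (\<open>4\<close>); the number of vertices at the cap (\<open>5\<close>).
\<close>

definition adrE :: "nat \<Rightarrow> exp \<Rightarrow> exp \<Rightarrow> exp \<Rightarrow> exp" where
  "adrE k b c d = Bin Add (Bin Mul (Bin Add (Bin Mul (Bin Add (Bin Mul (Bin Add (Bin Mul (Num k)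
    (Reg 2)) (Reg 5)) (Reg 2)) b) (Reg 2)) c) (Reg 2)) d"

definition cell :: "nat \<Rightarrow> exp \<Rightarrow> exp \<Rightarrow> exp \<Rightarrow> exp" where
  "cell k b c d = Mem (adrE k b c d)"

definition put :: "nat \<Rightarrow> exp \<Rightarrow> exp \<Rightarrow> exp \<Rightarrow> exp \<Rightarrow> com" where
  "put k b c d = Store (adrE k b c d)"

lemma cost_adrE [simp]: "exp_cost (adrE k b c d) = 14 + exp_cost b + exp_cost c + exp_cost d"
  by (simp add: adrE_def)

lemma cost_cell [simp]: "exp_cost (cell k b c d) = 15 + exp_cost b + exp_cost c + exp_cost d"
  by (simp add: cell_def)

text \<open>
  The base \<open>M\<close> of the memory layout exceeds every array index, and \<open>40 * L\<close> bits suffice for the addresses,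
  which are below \<open>8 * M ^ 5\<close>, and for the colours of a query, which are at most \<open>8 ^ (7 * L)\<close>.
\<close>

locale machine =
  fixes w n L M Cap :: nat
  assumes n: "2 \<le> n" and nL: "n < 2 ^ L" and Ln: "L \<le> n" and Lpos: "0 < L"
    and M_def: "M = 16 * n" and Cap_def: "Cap = 7 * L" and w_def: "w = 40 * L"
begin

abbreviation W :: nat where "W \<equiv> 2 ^ w"

lemma M_le: "M \<le> 2 ^ (5 * L)"
proof -
  have "(2::nat) ^ 4 \<le> 2 ^ (4 * L)" using Lpos by (intro power_increasing) auto
  then have "16 * n \<le> 2 ^ (4 * L) * 2 ^ L" using nL by (intro mult_le_mono) auto
  then show ?thesis by (simp add: M_def power_add[symmetric])
qed

text \<open>From \<open>16 \<le> 2 ^ (4 * L)\<close> and \<open>n < 2 ^ L\<close>, the base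
  \<open>M\<close> takes at most \<open>5 * L\<close> bits, so seven factors fit into
  \<open>35 * L\<close> of the \<open>40 * L\<close> bits. Addresses use up five factors; the rest
  gives the slack for sums and small multiples.\<close>

lemma M_pow: "M ^ 7 \<le> W"
proof -
  have "M ^ 7 \<le> (2 ^ (5 * L)) ^ 7" using M_le by (rule power_mono) simp
  also have "\<dots> = 2 ^ (35 * L)" by (simp add: power_mult[symmetric] mult.commute)
  also have "\<dots> \<le> W" unfolding w_def by (rule power_increasing) auto
  finally show ?thesis .
qed

lemma M32: "32 \<le> M" using n by (simp add: M_def)

lemma MCap: "Cap + 8 < M" using n Ln by (simp add: M_def Cap_def)

lemma nM: "n < M" using n by (simp add: M_def)

lemma LM: "2 * L + 2 < M" using n Ln by (simp add: M_def)

lemma M2_W: "32 * (M * M) \<le> W"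
proof -
  have "32 * (M * M) \<le> M ^ 5 * (M * M)"
    using M32 by (intro mult_le_mono) (auto simp: self_le_power intro: order_trans)
  then show ?thesis using M_pow by (simp add: power_add[symmetric] numeral_eq_Suc)
qed

lemma M_W: "1024 * M \<le> W"
proof -
  have "32 * (32 * M) \<le> 32 * (M * M)" using M32 by (intro mult_le_mono) auto
  then show ?thesis using M2_W by linarith
qed

definition wf_state :: "ram \<Rightarrow> bool" where
  "wf_state s \<longleftrightarrow> bdd W (regs s) \<and> bdd W (mem s) \<and> regs s 2 = M \<and> regs s 3 = L \<and> regs s 4 = Cap"

text \<open>All intermediate results of the Horner evaluation are listed, since the machine reduces
  modulo \<open>2 ^ w\<close> after every single operation.\<close>

lemma adr_small:
  assumes "k < 8" "j < M" "b < M" "c < M" "d < M"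
  shows "k * M + j < W" "(k * M + j) * M + b < W" "((k * M + j) * M + b) * M + c < W" "adr M k j b c d < W"
    "k * M < W" "(k * M + j) * M < W" "((k * M + j) * M + b) * M < W" "(((k * M + j) * M + b) * M + c) * M < W"
proof -
  have k: "k < M" using assms M32 by linarith
  have a: "k * M + j < M * M" by (rule horner_less[OF k assms(2)])
  have b: "(k * M + j) * M + b < M * M * M" by (rule horner_less[OF a assms(3)])
  have c: "((k * M + j) * M + b) * M + c < M * M * M * M" by (rule horner_less[OF b assms(4)])
  have d: "adr M k j b c d < M * M * M * M * M" unfolding adr_def by (rule horner_less[OF c assms(5)])
  have p: "M ^ i \<le> W" if "i \<le> 7" for i
    using power_increasing[of i 7 M] that M32 M_pow by linarith
  show "k * M + j < W" using a p[of 2] by (simp add: power2_eq_square)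
  then show "k * M < W" by linarith
  show "(k * M + j) * M + b < W" using b p[of 3] by (simp add: numeral_eq_Suc mult.assoc)
  then show "(k * M + j) * M < W" by linarith
  show "((k * M + j) * M + b) * M + c < W" using c p[of 4] by (simp add: numeral_eq_Suc mult.assoc)
  then show "((k * M + j) * M + b) * M < W" by linarith
  show *: "adr M k j b c d < W" using d p[of 5] by (simp add: numeral_eq_Suc mult.assoc)
  then show "(((k * M + j) * M + b) * M + c) * M < W" unfolding adr_def by linarith
qed

lemma val_adrE:
  assumes "bdd W (regs s)" "regs s 2 = M" "regs s 5 < M" "k < 8"
    "exp_val w b s < M" "exp_val w c s < M" "exp_val w d s < M"
  shows "exp_val w (adrE k b c d) s = adr M k (regs s 5) (exp_val w b s) (exp_val w c s) (exp_val w d s)"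
proof -
  note a = adr_small[OF assms(4,3,5-7)]
  have "k < W" using assms(4) M32 M_W by linarith
  then show ?thesis using assms(1,2) a
    by (simp del: exp_val.simps(2) add: adrE_def adr_def bddD)
qed

lemma val_cell:
  assumes "bdd W (regs s)" "bdd W (mem s)" "regs s 2 = M" "regs s 5 < M" "k < 8"
    "exp_val w b s < M" "exp_val w c s < M" "exp_val w d s < M"
  shows "exp_val w (cell k b c d) s =
    view M (mem s) (regs s 5) (k, exp_val w b s, exp_val w c s, exp_val w d s)"
  unfolding cell_def using val_adrE[OF assms(1,3-)] assms(2,6-)
  by (simp add: view_def del: exp_val.simps)

lemma wp_put:
  assumes "bdd W (regs s)" "regs s 2 = M" "regs s 5 < M" "k < 8"
    "exp_val w b s < M" "exp_val w c s < M" "exp_val w d s < M"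
  shows "wp w (put k b c d e) s Q =
    Q (15 + exp_cost b + exp_cost c + exp_cost d + exp_cost e) (s\<lparr>mem := (mem s)
      (adr M k (regs s 5) (exp_val w b s) (exp_val w c s) (exp_val w d s) := exp_val w e s)\<rparr>)"
  unfolding put_def wp_Store using val_adrE[OF assms] by (simp add: add.assoc del: exp_val.simps)

end

section \<open>Indexed sets\<close>

text \<open>A dense array of elements together with its inverse. This gives constant time for
  insertion, deletion and access by index, and an enumeration in time proportional to the size.
  Position entries of non-members are left free, so stale values can stay in memory.\<close>

definition setrep :: "(nat \<times> nat \<times> nat \<times> nat \<Rightarrow> nat) \<Rightarrow> nat \<Rightarrow> nat \<Rightarrow> nat set \<Rightarrow> bool" where
  "setrep H u t S \<longleftrightarrow>
     (\<forall>y\<in>S. H (1, u, t, y) < H (2, u, t, 0) \<and> H (0, u, t, H (1, u, t, y)) = y) \<and>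
     (\<forall>i<H (2, u, t, 0). H (0, u, t, i) \<in> S \<and> H (1, u, t, H (0, u, t, i)) = i)"

definition addH where
  "addH u t y H = H((0, u, t, H (2, u, t, 0)) := y, (1, u, t, y) := H (2, u, t, 0),
     (2, u, t, 0) := Suc (H (2, u, t, 0)))" for u t y :: nat and H :: "nat \<times> nat \<times> nat \<times> nat \<Rightarrow> nat"

text \<open>Deletion by moving the last element into the vacated place. If \<open>y\<close> is
  itself the last element, both array writes restore what was there, and only the size
  changes.\<close>

definition remH where
  "remH u t y H = H((0, u, t, H (1, u, t, y)) := H (0, u, t, H (2, u, t, 0) - 1),
     (1, u, t, H (0, u, t, H (2, u, t, 0) - 1)) := H (1, u, t, y),
     (2, u, t, 0) := H (2, u, t, 0) - 1)" for u t y :: nat and H :: "nat \<times> nat \<times> nat \<times> nat \<Rightarrow> nat"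

lemma setrep_bij: "setrep H u t S \<Longrightarrow> bij_betw (\<lambda>i. H (0, u, t, i)) {..<H (2, u, t, 0)} S"
  by (rule bij_betw_byWitness[where f' = "\<lambda>y. H (1, u, t, y)"]) (auto simp: setrep_def)

lemma setrep_card: "setrep H u t S \<Longrightarrow> H (2, u, t, 0) = card S"
  using bij_betw_same_card[OF setrep_bij] by fastforce

lemma setrep_nth: "setrep H u t S \<Longrightarrow> i < card S \<Longrightarrow> H (0, u, t, i) \<in> S"
  by (frule setrep_card) (simp add: setrep_def)

lemma setrep_image: "setrep H u t S \<Longrightarrow> (\<lambda>i. H (0, u, t, i)) ` {..<card S} = S"
  using bij_betw_imp_surj_on[OF setrep_bij] by (simp add: setrep_card)

lemma setrep_inj: "setrep H u t S \<Longrightarrow> i < card S \<Longrightarrow> i' < card S \<Longrightarrow>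
    H (0, u, t, i) = H (0, u, t, i') \<Longrightarrow> i = i'"
  using bij_betw_imp_inj_on[OF setrep_bij] by (auto simp: setrep_card inj_on_def)

lemma setrep_pos: "setrep H u t S \<Longrightarrow> y \<in> S \<Longrightarrow> H (1, u, t, y) < card S"
  by (frule setrep_card) (simp add: setrep_def)

lemma setrep_addH:
  assumes "setrep H u t S" "y \<notin> S"
  shows "setrep (addH u t y H) u t (insert y S)"
  using assms unfolding setrep_def addH_def by (auto simp: less_Suc_eq)

lemma setrep_remH:
  assumes "setrep H u t S" "y \<in> S"
  shows "setrep (remH u t y H) u t (S - {y})"
proof -
  define m where "m = H (2, u, t, 0) - 1"
  have cnt: "H (2, u, t, 0) = Suc m" using assms unfolding setrep_def m_def by auto
  define z where "z = H (0, u, t, m)"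
  define p where "p = H (1, u, t, y)"
  have R: "remH u t y H = H((0, u, t, p) := z, (1, u, t, z) := p, (2, u, t, 0) := m)"
    by (simp add: remH_def p_def z_def m_def)
  have 1: "\<And>x. x \<in> S \<Longrightarrow> H (1, u, t, x) < Suc m \<and> H (0, u, t, H (1, u, t, x)) = x"
    and 2: "\<And>i. i < Suc m \<Longrightarrow> H (0, u, t, i) \<in> S \<and> H (1, u, t, H (0, u, t, i)) = i"
    using assms(1) cnt unfolding setrep_def by auto
  have p: "p \<le> m" "H (0, u, t, p) = y" using 1[OF assms(2)] by (auto simp: p_def)
  have z: "z \<in> S" "H (1, u, t, z) = m" using 2[of m] by (auto simp: z_def)
  show ?thesis
    unfolding setrep_def R
  proof (intro conjI ballI allI impI)
    fix x assume x: "x \<in> S - {y}"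
    then have "H (1, u, t, x) \<noteq> p" using 1 p by auto
    moreover have "H (1, u, t, x) < m" if "x \<noteq> z" using 1[of x] that x z_def by (auto simp: less_Suc_eq)
    moreover have "p < m" if "x = z" using x that p z_def by (cases "p = m") auto
    ultimately show "(H((0, u, t, p) := z, (1, u, t, z) := p, (2, u, t, 0) := m)) (1, u, t, x)
        < (H((0, u, t, p) := z, (1, u, t, z) := p, (2, u, t, 0) := m)) (2, u, t, 0)"
      "(H((0, u, t, p) := z, (1, u, t, z) := p, (2, u, t, 0) := m))
        (0, u, t, (H((0, u, t, p) := z, (1, u, t, z) := p, (2, u, t, 0) := m)) (1, u, t, x)) = x"
      using 1[of x] x by auto
  next
    fix i assume "i < (H((0, u, t, p) := z, (1, u, t, z) := p, (2, u, t, 0) := m)) (2, u, t, 0)"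
    then have i: "i < m" by simp
    have a: "H (0, u, t, i) \<noteq> z" using 2[of i] i z by auto
    have b: "i \<noteq> p \<Longrightarrow> H (0, u, t, i) \<noteq> y" using 2[of i] i p_def by auto
    have c: "i = p \<Longrightarrow> z \<noteq> y" using z i p_def by auto
    show "(H((0, u, t, p) := z, (1, u, t, z) := p, (2, u, t, 0) := m)) (0, u, t, i) \<in> S - {y}"
      "(H((0, u, t, p) := z, (1, u, t, z) := p, (2, u, t, 0) := m)) (1, u, t,
        (H((0, u, t, p) := z, (1, u, t, z) := p, (2, u, t, 0) := m)) (0, u, t, i)) = i"
      using 2[of i] i a b c z by auto
  qed
qed

lemma setrep_cong:
  assumes "\<And>k i. k < 3 \<Longrightarrow> H' (k, u, t, i) = H (k, u, t, i)"
  shows "setrep H' u t S = setrep H u t S"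
  unfolding setrep_def using assms by simp

lemma addH_other: "(u', t') \<noteq> (u, t) \<or> 2 < k \<Longrightarrow> addH u t y H (k, u', t', i) = H (k, u', t', i)"
  by (auto simp: addH_def)

lemma remH_other: "(u', t') \<noteq> (u, t) \<or> 2 < k \<Longrightarrow> remH u t y H (k, u', t', i) = H (k, u', t', i)"
  by (auto simp: remH_def)

definition add_set :: "nat \<Rightarrow> nat \<Rightarrow> nat \<Rightarrow> com" where
  "add_set a b c =
    Seq (put 0 (Reg a) (Reg b) (cell 2 (Reg a) (Reg b) (Num 0)) (Reg c))
   (Seq (put 1 (Reg a) (Reg b) (Reg c) (cell 2 (Reg a) (Reg b) (Num 0)))
        (put 2 (Reg a) (Reg b) (Num 0) (Bin Add (cell 2 (Reg a) (Reg b) (Num 0)) (Num 1))))"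

definition remove_set :: "nat \<Rightarrow> nat \<Rightarrow> nat \<Rightarrow> com" where
  "remove_set a b c =
    Seq (Assign 20 (cell 1 (Reg a) (Reg b) (Reg c)))
   (Seq (Assign 21 (cell 0 (Reg a) (Reg b) (Bin Sub (cell 2 (Reg a) (Reg b) (Num 0)) (Num 1))))
   (Seq (put 0 (Reg a) (Reg b) (Reg 20) (Reg 21))
   (Seq (put 1 (Reg a) (Reg b) (Reg 21) (Reg 20))
        (put 2 (Reg a) (Reg b) (Num 0) (Bin Sub (cell 2 (Reg a) (Reg b) (Num 0)) (Num 1))))))"

context machine
begin

definition upd :: "ram \<Rightarrow> ram \<Rightarrow> nat \<Rightarrow> (nat \<times> nat \<times> nat \<times> nat \<Rightarrow> nat) \<Rightarrow> bool" where
  "upd s s' j H \<longleftrightarrow> (\<forall>j'<M. view M (mem s') j' = (if j' = j then H else view M (mem s) j'))"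

lemma Num_val [simp]: "k < 32 \<Longrightarrow> exp_val w (Num k) s = k"
  using M32 M_W by simp

lemma M_pos [simp]: "0 < M" "Suc 0 < M" "2 < M" using M32 by simp_all

lemma view_less: "bdd W m \<Longrightarrow> view M m j p < W"
  by (cases p) (simp add: view_def bddD)

lemmas ev = wp_Seq wp_put wp_Assign wp_Cond wp_Skip val_cell view_upd view_less bddD

lemma ev_Add [simp]: "exp_val w d s + exp_val w e s < W \<Longrightarrow> exp_val w (Bin Add d e) s = exp_val w d s + exp_val w e s"
  by simp

declare exp_val.simps [simp del]

lemma wp_add_set:
  assumes "wf_state s" "regs s 5 = j" "regs s a = u" "regs s b = t" "regs s c = y"
    "j < M" "u < M" "t < M" "y < M" "view M (mem s) j (2, u, t, 0) < M"
  shows "wp w (add_set a b c) s (\<lambda>T s'. T \<le> 200 \<and> regs s' = regs s \<and> wf_state s' \<and>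
    upd s s' j (addH u t y (view M (mem s) j)))"
  using assms M_W M32 unfolding add_set_def wf_state_def upd_def addH_def
  by (simp add: ev)

lemma wp_remove_set:
  assumes "wf_state s" "regs s 5 = j" "regs s a = u" "regs s b = t" "regs s c = y"
    "j < M" "u < M" "t < M" "y < M" "view M (mem s) j (2, u, t, 0) < M" "0 < view M (mem s) j (2, u, t, 0)"
    "view M (mem s) j (1, u, t, y) < M"
    "view M (mem s) j (0, u, t, view M (mem s) j (2, u, t, 0) - 1) < M" and d: "a < 19" "b < 19" "c < 19"
  shows "wp w (remove_set a b c) s (\<lambda>T s'. T \<le> 300 \<and> (\<forall>i<20. regs s' i = regs s i) \<and> wf_state s' \<and>
    upd s s' j (remH u t y (view M (mem s) j)))"
  using assms M_W M32 unfolding remove_set_def wf_state_def upd_def remH_def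
  by (simp add: ev exp_val_Sub)

end

section \<open>The data of one scale\<close>

definition ins :: "(nat \<Rightarrow> nat \<Rightarrow> nat set) \<Rightarrow> nat \<Rightarrow> nat \<Rightarrow> nat \<Rightarrow> nat \<Rightarrow> nat \<Rightarrow> nat set" where
  "ins S u t y = S(u := (S u)(t := insert y (S u t)))"

definition del :: "(nat \<Rightarrow> nat \<Rightarrow> nat set) \<Rightarrow> nat \<Rightarrow> nat \<Rightarrow> nat \<Rightarrow> nat \<Rightarrow> nat \<Rightarrow> nat set" where
  "del S u t y = S(u := (S u)(t := S u t - {y}))"

text \<open>
  The sets kept for a vertex \<open>u\<close>: out-neighbours (\<open>t = 0\<close>), out-neighbours that receive a majority of
  the copies (\<open>t = 1\<close>), in-neighbours with label \<open>t - 2\<close> (\<open>t \<ge> 2\<close>).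
\<close>

definition sets :: "nat \<Rightarrow> (nat \<Rightarrow> nat \<Rightarrow> nat) \<Rightarrow> (nat \<Rightarrow> nat) \<Rightarrow> nat \<Rightarrow> nat \<Rightarrow> nat set" where
  "sets half x l u t = (if t = 0 then {v. 0 < x u v} else if t = 1 then {v. half < x u v}
     else {v. 0 < x v u \<and> l v + 2 = t})"

definition bump :: "(nat \<Rightarrow> nat \<Rightarrow> nat) \<Rightarrow> nat \<Rightarrow> nat \<Rightarrow> nat \<Rightarrow> nat \<Rightarrow> nat \<Rightarrow> nat" where
  "bump x a b k = x(a := (x a)(b := k))"

text \<open>Membership depends on a copy count only through the thresholds \<open>0\<close> and
  \<open>half\<close>. Hence one more copy causes at most three set operations, however many copies
  the edge has.\<close>

lemma sets_inc:
  assumes "x a b = m"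
  shows "sets half (bump x a b (Suc m)) l =
    (let S = (if m = 0 then ins (ins (sets half x l) a 0 b) b (l a + 2) a else sets half x l)
     in if m = half then ins S a 1 b else S)"
  using assms by (auto simp: fun_eq_iff sets_def ins_def bump_def Let_def)

lemma sets_dec:
  assumes "x a b = Suc m"
  shows "sets half (bump x a b m) l =
    (let S = (if m = 0 then del (del (sets half x l) a 0 b) b (l a + 2) a else sets half x l)
     in if m = half then del S a 1 b else S)"
  using assms by (auto simp: fun_eq_iff sets_def del_def bump_def Let_def)

text \<open>The label \<open>min d cap\<close> without a branch: \<open>cap - (cap - d) * [d < cap]\<close>.\<close>

definition labE :: "nat \<Rightarrow> exp" where
  "labE a = Bin Sub (Reg 4) (Bin Mul (Bin Sub (Reg 4) (cell 4 (Reg a) (Num 0) (Num 0)))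
     (Bin Less (cell 4 (Reg a) (Num 0) (Num 0)) (Reg 4)))"

definition inc_copies :: "nat \<Rightarrow> nat \<Rightarrow> com" where
  "inc_copies a b =
    Seq (put 3 (Reg a) (Reg b) (Num 0) (Bin Add (cell 3 (Reg a) (Reg b) (Num 0)) (Num 1)))
   (Seq (Cond (Bin Eq (cell 3 (Reg a) (Reg b) (Num 0)) (Num 1))
          (Seq (Assign 11 (Num 0)) (Seq (add_set a 11 b)
            (Seq (Assign 11 (Bin Add (labE a) (Num 2))) (add_set b 11 a)))) Skip)
        (Cond (Bin Eq (cell 3 (Reg a) (Reg b) (Num 0)) (Bin Add (Reg 7) (Num 1)))
          (Seq (Assign 11 (Num 1)) (add_set a 11 b)) Skip))"

definition dec_copies :: "nat \<Rightarrow> nat \<Rightarrow> com" where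
  "dec_copies a b =
    Seq (put 3 (Reg a) (Reg b) (Num 0) (Bin Sub (cell 3 (Reg a) (Reg b) (Num 0)) (Num 1)))
   (Seq (Cond (Bin Eq (cell 3 (Reg a) (Reg b) (Num 0)) (Num 0))
          (Seq (Assign 11 (Num 0)) (Seq (remove_set a 11 b)
            (Seq (Assign 11 (Bin Add (labE a) (Num 2))) (remove_set b 11 a)))) Skip)
        (Cond (Bin Eq (cell 3 (Reg a) (Reg b) (Num 0)) (Reg 7))
          (Seq (Assign 11 (Num 1)) (remove_set a 11 b)) Skip))"

context machine
begin

text \<open>The sets, copy counts, degrees and the counter are separate parameters, because inside
  an update they temporarily disagree with each other. Their mutual consistency is added in
  \<open>chain\<close>.\<close>

definition scale :: "ram \<Rightarrow> nat \<Rightarrow> (nat \<Rightarrow> nat \<Rightarrow> nat set) \<Rightarrow> (nat \<Rightarrow> nat \<Rightarrow> nat) \<Rightarrow> (nat \<Rightarrow> nat) \<Rightarrow> nat \<Rightarrow> bool" where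
  "scale s j S x dg bad \<longleftrightarrow> wf_state s \<and> regs s 5 = j \<and> j < M \<and>
     (\<forall>u<n. \<forall>t<M. S u t \<subseteq> {..<n} \<and> setrep (view M (mem s) j) u t (S u t)) \<and>
     (\<forall>u<n. \<forall>v<n. view M (mem s) j (3, u, v, 0) = x u v) \<and>
     (\<forall>u<n. view M (mem s) j (4, u, 0, 0) = dg u) \<and> view M (mem s) j (5, 0, 0, 0) = bad"

text \<open>\<open>R\<close> are the registers that may change and \<open>X\<close> the sets of
  scale \<open>j\<close> that may change. Registers from \<open>20\<close> on are excluded since
  \<open>remove_set\<close> uses \<open>20\<close> and \<open>21\<close> as scratch. Arrays
  \<open>3\<close> to \<open>5\<close> of scale \<open>j\<close> are left out because
  \<open>scale\<close> describes them completely on the vertices.\<close>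

definition frame :: "nat set \<Rightarrow> (nat \<times> nat) set \<Rightarrow> ram \<Rightarrow> ram \<Rightarrow> nat \<Rightarrow> bool" where
  "frame R X s s' j \<longleftrightarrow> (\<forall>i<20. i \<notin> R \<longrightarrow> regs s' i = regs s i) \<and>
     (\<forall>j'<M. j' \<noteq> j \<longrightarrow> view M (mem s') j' = view M (mem s) j') \<and>
     (\<forall>k u t i. k < 3 \<longrightarrow> (u, t) \<notin> X \<longrightarrow> view M (mem s') j (k, u, t, i) = view M (mem s) j (k, u, t, i))"

lemma frame_refl: "frame R X s s j"
  by (simp add: frame_def)

lemma frame_trans: "frame R X s s1 j \<Longrightarrow> frame R' X' s1 s2 j \<Longrightarrow> R \<subseteq> R'' \<Longrightarrow> R' \<subseteq> R'' \<Longrightarrow> X \<subseteq> X'' \<Longrightarrow> X' \<subseteq> X'' \<Longrightarrow>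
    frame R'' X'' s s2 j"
  unfolding frame_def by (intro conjI allI impI) (metis subsetD)+

lemma frame_reg: "frame R X s s' j \<Longrightarrow> i < 20 \<Longrightarrow> i \<notin> R \<Longrightarrow> regs s' i = regs s i"
  by (simp add: frame_def)

lemma scale_regs:
  assumes "scale s j S x dg bad"
  shows "bdd W (regs s)" "bdd W (mem s)" "regs s 2 = M" "regs s 3 = L" "regs s 4 = Cap" "regs s 5 = j" "j < M"
  using assms by (auto simp: scale_def wf_state_def)

lemma val_x:
  assumes "scale s j S x dg bad" "exp_val w b s < n" "exp_val w c s < n"
  shows "exp_val w (cell 3 b c (Num 0)) s = x (exp_val w b s) (exp_val w c s)"
  using assms nM by (simp add: scale_def wf_state_def val_cell)

lemma val_dg:
  assumes "scale s j S x dg bad" "exp_val w b s < n"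
  shows "exp_val w (cell 4 b (Num 0) (Num 0)) s = dg (exp_val w b s)"
  using assms nM by (simp add: scale_def wf_state_def val_cell)

lemma val_bad:
  assumes "scale s j S x dg bad"
  shows "exp_val w (cell 5 (Num 0) (Num 0) (Num 0)) s = bad"
  using assms nM by (simp add: scale_def wf_state_def val_cell)

lemma val_card:
  assumes "scale s j S x dg bad" "exp_val w b s < n" "exp_val w c s < M"
  shows "exp_val w (cell 2 b c (Num 0)) s = card (S (exp_val w b s) (exp_val w c s))"
  using assms nM by (simp add: scale_def wf_state_def val_cell setrep_card)

lemma scale_sets:
  assumes "scale s j S x dg bad" "u < n" "t < M"
  shows "S u t \<subseteq> {..<n}" "finite (S u t)" "card (S u t) \<le> n" "setrep (view M (mem s) j) u t (S u t)"
proof -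
  show 1: "S u t \<subseteq> {..<n}" "setrep (view M (mem s) j) u t (S u t)" using assms by (auto simp: scale_def)
  show "finite (S u t)" using 1(1) finite_subset by blast
  show "card (S u t) \<le> n" using card_mono[OF _ 1(1)] by simp
qed

lemma val_elem:
  assumes "scale s j S x dg bad" "exp_val w b s = u" "exp_val w c s = t" "exp_val w e s = i"
    "u < n" "t < M" "i < card (S u t)"
  shows "exp_val w (cell 0 b c e) s = view M (mem s) j (0, u, t, i)" "view M (mem s) j (0, u, t, i) \<in> S u t"
proof -
  note ss = scale_sets[OF assms(1,5,6)]
  have "i < M" using assms(7) ss(3) nM by linarith
  then show "exp_val w (cell 0 b c e) s = view M (mem s) j (0, u, t, i)"
    using assms nM by (simp add: scale_def wf_state_def val_cell)
  show "view M (mem s) j (0, u, t, i) \<in> S u t" using setrep_nth[OF ss(4) assms(7)] .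
qed

lemma val_lab:
  assumes "scale s j S x dg bad" "regs s a < n"
  shows "exp_val w (labE a) s = min (dg (regs s a)) Cap"
proof -
  have r: "exp_val w (Reg a) s = regs s a" "exp_val w (Reg 4) s = Cap" using assms(1) by (auto simp: scale_def wf_state_def)
  have d: "exp_val w (cell 4 (Reg a) (Num 0) (Num 0)) s = dg (regs s a)"
    using val_dg[OF assms(1), of "Reg a"] assms(2) r by simp
  have cW: "Cap < W" using MCap M_W by linarith
  have lt: "exp_val w (Bin Less (cell 4 (Reg a) (Num 0) (Num 0)) (Reg 4)) s = of_bool (dg (regs s a) < Cap)"
    unfolding exp_val.simps(4) binop_val.simps d r using w_def Lpos by simp
  have m: "exp_val w (Bin Mul (Bin Sub (Reg 4) (cell 4 (Reg a) (Num 0) (Num 0)))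
     (Bin Less (cell 4 (Reg a) (Num 0) (Num 0)) (Reg 4))) s = Cap - dg (regs s a)"
  proof (cases "dg (regs s a) < Cap")
    case True
    then have "exp_val w (Bin Sub (Reg 4) (cell 4 (Reg a) (Num 0) (Num 0))) s = Cap - dg (regs s a)"
      using d r exp_val_Sub[of w "cell 4 (Reg a) (Num 0) (Num 0)" s "Reg 4"] by simp
    then show ?thesis using True lt cW by (simp add: exp_val.simps(4)[of _ Mul])
  next
    \<comment> \<open>Above the cap the inner subtraction wraps around to a meaningless word, but it
      is multiplied by the comparison bit \<open>0\<close>.\<close>
    case False
    then show ?thesis using lt by (simp add: exp_val.simps(4)[of _ Mul])
  qed
  show ?thesis unfolding labE_def
    using m r by (subst exp_val_Sub) auto
qed

lemma cost_lab [simp]: "exp_cost (labE a) = 43"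
  by (simp add: labE_def)

lemma scale_assign:
  assumes "scale s j S x dg bad" "v < W" "i \<notin> {2, 3, 4, 5}"
  shows "scale (s\<lparr>regs := (regs s)(i := v)\<rparr>) j S x dg bad"
    "frame {i} {} s (s\<lparr>regs := (regs s)(i := v)\<rparr>) j"
  using assms by (auto simp: scale_def wf_state_def frame_def)

lemma wp_assign:
  assumes "scale s j S x dg bad" "exp_val w e s = v" "i \<notin> {2, 3, 4, 5}"
  shows "wp w (Assign i e) s (\<lambda>T s'. T = 1 + exp_cost e \<and> scale s' j S x dg bad \<and> frame {i} {} s s' j \<and>
    regs s' i = v \<and> mem s' = mem s)"
  unfolding wp_Assign using scale_assign[OF assms(1) _ assms(3)] exp_val_less[of w e s] assms(2) by simp

lemma wp_put_x:
  assumes "scale s j S x dg bad" "exp_val w b s = u" "exp_val w c s = v" "exp_val w e s = k" "u < n" "v < n"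
  shows "wp w (put 3 b c (Num 0) e) s (\<lambda>T s'. T = 16 + exp_cost b + exp_cost c + exp_cost e \<and>
    scale s' j S (bump x u v k) dg bad \<and> frame {} {} s s' j)"
  using assms nM exp_val_less[of w e s]
  by (simp add: wp_put scale_def wf_state_def frame_def view_upd setrep_def bump_def)

lemma wp_put_dg:
  assumes "scale s j S x dg bad" "exp_val w b s = u" "exp_val w e s = k" "u < n"
  shows "wp w (put 4 b (Num 0) (Num 0) e) s (\<lambda>T s'. T = 17 + exp_cost b + exp_cost e \<and>
    scale s' j S x (dg(u := k)) bad \<and> frame {} {} s s' j)"
  using assms nM exp_val_less[of w e s]
  by (simp add: wp_put scale_def wf_state_def frame_def view_upd setrep_def)

lemma wp_put_bad:
  assumes "scale s j S x dg bad" "exp_val w e s = k"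
  shows "wp w (put 5 (Num 0) (Num 0) (Num 0) e) s (\<lambda>T s'. T = 18 + exp_cost e \<and>
    scale s' j S x dg k \<and> frame {} {} s s' j)"
  using assms nM exp_val_less[of w e s]
  by (simp add: wp_put scale_def wf_state_def frame_def view_upd setrep_def)

lemma wp_add:
  assumes "scale s j S x dg bad" "regs s a = u" "regs s b = t" "regs s c = y" "u < n" "t < M" "y < n" "y \<notin> S u t"
  shows "wp w (add_set a b c) s (\<lambda>T s'. T \<le> 200 \<and> scale s' j (ins S u t y) x dg bad \<and> frame {} {(u, t)} s s' j)"
proof (rule wp_mono[OF wp_add_set[of s j a u b t c y]])
  note ss = scale_sets[OF assms(1,5,6)]
  let ?H = "view M (mem s) j"
  show "view M (mem s) j (2, u, t, 0) < M" using ss(3) setrep_card[OF ss(4)] nM by linarith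
  fix T s'
  assume *: "T \<le> 200 \<and> regs s' = regs s \<and> wf_state s' \<and> upd s s' j (addH u t y (view M (mem s) j))"
  have H': "view M (mem s') j = addH u t y ?H" using * assms(1) by (simp add: upd_def scale_def)
  have "setrep (addH u t y ?H) u' t' (ins S u t y u' t')" if "u' < n" "t' < M" for u' t'
  proof (cases "(u', t') = (u, t)")
    case True
    then show ?thesis using setrep_addH[OF ss(4) assms(8)] by (simp add: ins_def)
  next
    case False
    then have "setrep (addH u t y ?H) u' t' (S u' t') = setrep ?H u' t' (S u' t')"
      by (intro setrep_cong addH_other) simp
    then show ?thesis using scale_sets(4)[OF assms(1) that] False by (auto simp: ins_def)
  qed
  moreover have "ins S u t y u' t' \<subseteq> {..<n}" if "u' < n" "t' < M" for u' t'
    using scale_sets(1)[OF assms(1) that] assms(7) by (auto simp: ins_def)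
  ultimately show "T \<le> 200 \<and> scale s' j (ins S u t y) x dg bad \<and> frame {} {(u, t)} s s' j"
    using * assms(1) H' by (auto simp: scale_def frame_def addH_other upd_def)
qed (use assms nM in \<open>auto simp: scale_def\<close>)

lemma wp_remove:
  assumes "scale s j S x dg bad" "regs s a = u" "regs s b = t" "regs s c = y" "u < n" "t < M" "y \<in> S u t"
    "a < 19" "b < 19" "c < 19"
  shows "wp w (remove_set a b c) s (\<lambda>T s'. T \<le> 300 \<and> scale s' j (del S u t y) x dg bad \<and> frame {} {(u, t)} s s' j)"
proof -
  note ss = scale_sets[OF assms(1,5,6)]
  let ?H = "view M (mem s) j"
  have y: "y < n" using ss(1) assms(7) by auto
  have c0: "0 < card (S u t)" using ss(2) assms(7) card_gt_0_iff by blast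
  have c: "?H (2, u, t, 0) = card (S u t)" using setrep_card[OF ss(4)] .
  have p: "?H (1, u, t, y) < M" using setrep_pos[OF ss(4) assms(7)] ss(3) nM by linarith
  have z: "?H (0, u, t, card (S u t) - 1) < M" using setrep_nth[OF ss(4), of "card (S u t) - 1"] c0 ss(1) nM by force
  show ?thesis
  proof (rule wp_mono[OF wp_remove_set[of s j a u b t c y]])
    fix T s'
    assume *: "T \<le> 300 \<and> (\<forall>i<20. regs s' i = regs s i) \<and> wf_state s' \<and> upd s s' j (remH u t y (view M (mem s) j))"
    have H': "view M (mem s') j = remH u t y ?H" using * assms(1) by (simp add: upd_def scale_def)
    have "setrep (remH u t y ?H) u' t' (del S u t y u' t')" if "u' < n" "t' < M" for u' t'
    proof (cases "(u', t') = (u, t)")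
      case True
      then show ?thesis using setrep_remH[OF ss(4) assms(7)] by (simp add: del_def)
    next
      case False
      then have "setrep (remH u t y ?H) u' t' (S u' t') = setrep ?H u' t' (S u' t')"
        by (intro setrep_cong remH_other) simp
      then show ?thesis using scale_sets(4)[OF assms(1) that] False by (auto simp: del_def)
    qed
    moreover have "del S u t y u' t' \<subseteq> {..<n}" if "u' < n" "t' < M" for u' t'
      using scale_sets(1)[OF assms(1) that] by (auto simp: del_def)
    ultimately show "T \<le> 300 \<and> scale s' j (del S u t y) x dg bad \<and> frame {} {(u, t)} s s' j"
      using * assms(1) H' by (auto simp: scale_def frame_def remH_other upd_def)
  qed (use assms nM y c0 c p z ss(3) in \<open>auto simp: scale_def\<close>)
qed

lemma w_pos [simp]: "0 < w" using w_def Lpos by simp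

lemma val_Eq [simp]: "exp_val w (Bin Eq d e) s = of_bool (exp_val w d s = exp_val w e s)"
  by (simp add: exp_val.simps(4))

lemma val_Less [simp]: "exp_val w (Bin Less d e) s = of_bool (exp_val w d s < exp_val w e s)"
  by (simp add: exp_val.simps(4))

section \<open>Total correctness with a time bound and a frame\<close>

definition run :: "nat \<Rightarrow> nat set \<Rightarrow> (nat \<times> nat) set \<Rightarrow> nat \<Rightarrow> com \<Rightarrow> ram \<Rightarrow> (ram \<Rightarrow> bool) \<Rightarrow> bool" where
  "run j R X K c s P \<longleftrightarrow> wp w c s (\<lambda>T s'. T \<le> K \<and> frame R X s s' j \<and> P s')"

lemma run_weaken:
  assumes "run j R X K c s P" "R \<subseteq> R'" "X \<subseteq> X'" "K \<le> K'"
    "\<And>s'. P s' \<Longrightarrow> frame R X s s' j \<Longrightarrow> P' s'"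
  shows "run j R' X' K' c s P'"
  using assms(1) unfolding run_def
proof (rule wp_mono)
  fix T s' assume *: "T \<le> K \<and> frame R X s s' j \<and> P s'"
  then have "frame R' X' s s' j" using frame_trans[OF frame_refl, of R X s s' j] assms(2,3)
    by (meson empty_subsetI frame_refl frame_trans order_refl)
  then show "T \<le> K' \<and> frame R' X' s s' j \<and> P' s'" using * assms(4,5) by auto
qed

lemma run_Seq:
  assumes "run j R X K c s P" "\<And>s1. P s1 \<Longrightarrow> frame R X s s1 j \<Longrightarrow> run j R X K' c' s1 Q" "K + K' \<le> K''"
  shows "run j R X K'' (Seq c c') s Q"
  unfolding run_def
proof (rule wp_SeqI[OF assms(1)[unfolded run_def]])
  fix T s1 assume *: "T \<le> K \<and> frame R X s s1 j \<and> P s1"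
  then have "run j R X K' c' s1 Q" using assms(2) by blast
  then show "wp w c' s1 (\<lambda>T' s'. T + T' \<le> K'' \<and> frame R X s s' j \<and> Q s')"
    unfolding run_def
  proof (rule wp_mono)
    fix T' s' assume **: "T' \<le> K' \<and> frame R X s1 s' j \<and> Q s'"
    have "frame R X s s' j" by (rule frame_trans[of R X s s1 j R X s']) (use * ** in auto)
    then show "T + T' \<le> K'' \<and> frame R X s s' j \<and> Q s'" using * ** assms(3) by auto
  qed
qed

lemma run_Skip: "P s \<Longrightarrow> 1 \<le> K \<Longrightarrow> run j R X K Skip s P"
  by (simp add: run_def wp_Skip frame_refl)

lemma run_Cond:
  assumes "exp_val w e s \<noteq> 0 \<Longrightarrow> run j R X K c s P" "exp_val w e s = 0 \<Longrightarrow> run j R X K c' s P"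
    "1 + exp_cost e + K \<le> K'"
  shows "run j R X K' (Cond e c c') s P"
proof (cases "exp_val w e s = 0")
  case True
  then show ?thesis using assms(2,3) unfolding run_def wp_Cond by (auto elim!: wp_mono)
next
  case False
  then show ?thesis using assms(1,3) unfolding run_def wp_Cond by (auto elim!: wp_mono)
qed

text \<open>The frame relative to the initial state is kept as part of the invariant; therefore
  \<open>step\<close> and \<open>post\<close> may assume it, and \<open>I\<close> need not mention
  the unchanged registers.\<close>

lemma run_While:
  assumes init: "I s" and step: "\<And>s1. I s1 \<Longrightarrow> frame R X s s1 j \<Longrightarrow> exp_val w e s1 \<noteq> 0 \<Longrightarrow>
      \<exists>K. run j R X K c s1 (\<lambda>s'. I s' \<and> 1 + exp_cost e + K + pot s' \<le> pot s1)"
    and post: "\<And>s1. I s1 \<Longrightarrow> frame R X s s1 j \<Longrightarrow> exp_val w e s1 = 0 \<Longrightarrow> P s1"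
    and K: "pot s + 1 + exp_cost e \<le> K"
  shows "run j R X K (While e c) s P"
  unfolding run_def
proof (rule wp_mono[OF wp_While[where I = "\<lambda>s1. I s1 \<and> frame R X s s1 j" and pot = pot]])
  fix s1 assume *: "I s1 \<and> frame R X s s1 j" "exp_val w e s1 \<noteq> 0"
  then obtain K where "run j R X K c s1 (\<lambda>s'. I s' \<and> 1 + exp_cost e + K + pot s' \<le> pot s1)" using step by blast
  then show "wp w c s1 (\<lambda>t s'. (I s' \<and> frame R X s s' j) \<and> 1 + exp_cost e + t + pot s' \<le> pot s1)"
    unfolding run_def
  proof (rule wp_mono)
    fix T s' assume **: "T \<le> K \<and> frame R X s1 s' j \<and> I s' \<and> 1 + exp_cost e + K + pot s' \<le> pot s1"
    have "frame R X s s' j" by (rule frame_trans[of R X s s1 j R X s']) (use * ** in auto)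
    then show "(I s' \<and> frame R X s s' j) \<and> 1 + exp_cost e + T + pot s' \<le> pot s1" using ** by auto
  qed
next
  fix T s' assume *: "(I s' \<and> frame R X s s' j) \<and> exp_val w e s' = 0 \<and> T + pot s' \<le> pot s + 1 + exp_cost e"
  then show "T \<le> K \<and> frame R X s s' j \<and> P s'" using post K by auto
qed (use init frame_refl in blast)

lemma run_For:
  assumes init: "I s" and step: "\<And>s1. I s1 \<Longrightarrow> frame R X s s1 j \<Longrightarrow> exp_val w e s1 \<noteq> 0 \<Longrightarrow>
      run j R X B c s1 (\<lambda>s'. I s' \<and> \<mu> s' < \<mu> s1)"
    and post: "\<And>s1. I s1 \<Longrightarrow> frame R X s s1 j \<Longrightarrow> exp_val w e s1 = 0 \<Longrightarrow> P s1"
    and K: "(1 + exp_cost e + B) * \<mu> s + 1 + exp_cost e \<le> K"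
  shows "run j R X K (While e c) s P"
proof (rule run_While[where I = I and pot = "\<lambda>s. (1 + exp_cost e + B) * \<mu> s"])
  fix s1 assume *: "I s1" "frame R X s s1 j" "exp_val w e s1 \<noteq> 0"
  have "run j R X B c s1 (\<lambda>s'. I s' \<and> 1 + exp_cost e + B + (1 + exp_cost e + B) * \<mu> s' \<le> (1 + exp_cost e + B) * \<mu> s1)"
  proof (rule run_weaken[OF step[OF *]])
    fix s' assume "I s' \<and> \<mu> s' < \<mu> s1"
    then have "Suc (\<mu> s') \<le> \<mu> s1" "I s'" by auto
    from mult_le_mono2[OF this(1), of "1 + exp_cost e + B"] this(2)
    show "I s' \<and> 1 + exp_cost e + B + (1 + exp_cost e + B) * \<mu> s' \<le> (1 + exp_cost e + B) * \<mu> s1" by simp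
  qed auto
  then show "\<exists>K. run j R X K c s1 (\<lambda>s'. I s' \<and> 1 + exp_cost e + K + (1 + exp_cost e + B) * \<mu> s' \<le> (1 + exp_cost e + B) * \<mu> s1)"
    by blast
qed (use assms in auto)

lemma run_assign:
  assumes "scale s j S x dg bad" "exp_val w e s = v" "i \<notin> {2, 3, 4, 5}" "i \<in> R" "1 + exp_cost e \<le> K"
  shows "run j R X K (Assign i e) s (\<lambda>s'. scale s' j S x dg bad \<and> regs s' i = v \<and> frame {i} {} s s' j)"
  using wp_assign[OF assms(1-3)] unfolding run_def
proof (rule wp_mono)
  fix T s'
  assume *: "T = 1 + exp_cost e \<and> scale s' j S x dg bad \<and> frame {i} {} s s' j \<and> regs s' i = v \<and> mem s' = mem s"
  have "frame R X s s' j" by (rule frame_trans[OF frame_refl[of "{}" "{}" s j]]) (use * assms(4) in auto)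
  then show "T \<le> K \<and> frame R X s s' j \<and> scale s' j S x dg bad \<and> regs s' i = v \<and> frame {i} {} s s' j"
    using * assms(5) by auto
qed

lemma run_put_x:
  assumes "scale s j S x dg bad" "exp_val w b s = u" "exp_val w c s = v" "exp_val w e s = k" "u < n" "v < n"
    "16 + exp_cost b + exp_cost c + exp_cost e \<le> K"
  shows "run j R X K (put 3 b c (Num 0) e) s (\<lambda>s'. scale s' j S (bump x u v k) dg bad \<and> frame {} {} s s' j)"
  using wp_put_x[OF assms(1-6)] unfolding run_def
  by (rule wp_mono) (use assms(7) in \<open>auto elim: frame_trans[OF frame_refl[of "{}" "{}" s j]]\<close>)

lemma run_put_dg:
  assumes "scale s j S x dg bad" "exp_val w b s = u" "exp_val w e s = k" "u < n" "17 + exp_cost b + exp_cost e \<le> K"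
  shows "run j R X K (put 4 b (Num 0) (Num 0) e) s (\<lambda>s'. scale s' j S x (dg(u := k)) bad \<and> frame {} {} s s' j)"
  using wp_put_dg[OF assms(1-4)] unfolding run_def
  by (rule wp_mono) (use assms(5) in \<open>auto elim: frame_trans[OF frame_refl[of "{}" "{}" s j]]\<close>)

lemma run_put_bad:
  assumes "scale s j S x dg bad" "exp_val w e s = k" "18 + exp_cost e \<le> K"
  shows "run j R X K (put 5 (Num 0) (Num 0) (Num 0) e) s (\<lambda>s'. scale s' j S x dg k \<and> frame {} {} s s' j)"
  using wp_put_bad[OF assms(1-2)] unfolding run_def
  by (rule wp_mono) (use assms(3) in \<open>auto elim: frame_trans[OF frame_refl[of "{}" "{}" s j]]\<close>)

lemma run_add:
  assumes "scale s j S x dg bad" "regs s a = u" "regs s b = t" "regs s c = y" "u < n" "t < M" "y < n" "y \<notin> S u t"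
    "(u, t) \<in> X" "200 \<le> K"
  shows "run j R X K (add_set a b c) s (\<lambda>s'. scale s' j (ins S u t y) x dg bad \<and> frame {} X s s' j)"
  using wp_add[OF assms(1-8)] unfolding run_def
  by (rule wp_mono) (use assms(9,10) in \<open>auto elim: frame_trans[OF frame_refl[of "{}" "{}" s j]]\<close>)

lemma run_remove:
  assumes "scale s j S x dg bad" "regs s a = u" "regs s b = t" "regs s c = y" "u < n" "t < M" "y \<in> S u t"
    "a < 19" "b < 19" "c < 19" "(u, t) \<in> X" "300 \<le> K"
  shows "run j R X K (remove_set a b c) s (\<lambda>s'. scale s' j (del S u t y) x dg bad \<and> frame {} X s s' j)"
  using wp_remove[OF assms(1-10)] unfolding run_def
  by (rule wp_mono) (use assms(11,12) in \<open>auto elim: frame_trans[OF frame_refl[of "{}" "{}" s j]]\<close>)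

lemma run_inc_copies:
  assumes sc: "scale s j (sets half x l) x dg bad" and half: "regs s 7 = half" "half < M"
    and u: "regs s a = u" "u < n" and v: "regs s b = v" "v < n" and l: "l u = min (dg u) Cap"
    and m: "x u v = m" "m < M" and ab: "a \<noteq> 11" "b \<noteq> 11" "a < 19" "b < 19"
  shows "run j {11} UNIV 1000 (inc_copies a b) s
    (\<lambda>s'. scale s' j (sets half (bump x u v (Suc m)) l) (bump x u v (Suc m)) dg bad)"
proof -
  let ?x = "bump x u v (Suc m)" and ?S = "sets half x l"
  \<comment> \<open>The family of sets between the two conditionals: the first reacts to the
    threshold \<open>0\<close>, the second to the threshold \<open>half\<close>. The two may
    coincide.\<close>
  define S2 where "S2 = (if m = 0 then ins (ins ?S u 0 v) v (l u + 2) u else ?S)"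
  have S3: "sets half ?x l = (if m = half then ins S2 u 1 v else S2)"
    using sets_inc[of x u v m, OF m(1)] by (simp add: S2_def Let_def)
  have lM: "l u + 2 < M" using l MCap by linarith
  have e0: "exp_val w (Bin Add (cell 3 (Reg a) (Reg b) (Num 0)) (Num 1)) s = Suc m"
    using val_x[OF sc, of "Reg a" "Reg b"] u v m M_W M32 scale_regs[OF sc] by simp
  note fr = frame_reg[where R = "{11}" and X = UNIV and j = j]
  show ?thesis
    unfolding inc_copies_def
  proof (rule run_Seq[OF run_put_x[OF sc _ _ e0 _ _ order_refl]])
    fix s1 assume sc1: "scale s1 j ?S ?x dg bad \<and> frame {} {} s s1 j" and f1: "frame {11} UNIV s s1 j"
    then have sc1: "scale s1 j ?S ?x dg bad" by blast
    have r1: "regs s1 a = u" "regs s1 b = v" "regs s1 7 = half" using fr[OF f1] ab u v half by simp_all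
    have x1: "exp_val w (cell 3 (Reg a) (Reg b) (Num 0)) s1 = Suc m"
      using val_x[OF sc1, of "Reg a" "Reg b"] r1 u v scale_regs[OF sc1] by (simp add: bump_def)
    show "run j {11} UNIV 950 (Seq (Cond (Bin Eq (cell 3 (Reg a) (Reg b) (Num 0)) (Num 1))
          (Seq (Assign 11 (Num 0)) (Seq (add_set a 11 b)
            (Seq (Assign 11 (Bin Add (labE a) (Num 2))) (add_set b 11 a)))) Skip)
        (Cond (Bin Eq (cell 3 (Reg a) (Reg b) (Num 0)) (Bin Add (Reg 7) (Num 1)))
          (Seq (Assign 11 (Num 1)) (add_set a 11 b)) Skip)) s1
       (\<lambda>s'. scale s' j (sets half ?x l) ?x dg bad)"
    proof (rule run_Seq[where P = "\<lambda>s2. scale s2 j S2 ?x dg bad" and K = 600 and K' = 300], rule run_Cond[where K = 500])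
      assume "exp_val w (Bin Eq (cell 3 (Reg a) (Reg b) (Num 0)) (Num 1)) s1 \<noteq> 0"
      then have m0: "m = 0" using x1 by simp
      show "run j {11} UNIV 500 (Seq (Assign 11 (Num 0)) (Seq (add_set a 11 b)
            (Seq (Assign 11 (Bin Add (labE a) (Num 2))) (add_set b 11 a)))) s1 (\<lambda>s2. scale s2 j S2 ?x dg bad)"
      proof (rule run_Seq[OF run_assign[OF sc1 _ _ _ order_refl]])
        fix s2
        assume "scale s2 j ?S ?x dg bad \<and> regs s2 11 = 0 \<and> frame {11} {} s1 s2 j" and f2: "frame {11} UNIV s1 s2 j"
        then have sc2: "scale s2 j ?S ?x dg bad" and t2: "regs s2 11 = 0" by auto
        have r2: "regs s2 a = u" "regs s2 b = v" using fr[OF f2] ab r1 by simp_all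
        have nin: "v \<notin> ?S u 0" using m0 m by (simp add: sets_def)
        show "run j {11} UNIV 470 (Seq (add_set a 11 b) (Seq (Assign 11 (Bin Add (labE a) (Num 2))) (add_set b 11 a))) s2
            (\<lambda>s'. scale s' j S2 ?x dg bad)"
        proof (rule run_Seq[OF run_add[OF sc2 r2(1) t2 r2(2) u(2) _ v(2) nin _ order_refl]])
          fix s3 assume "scale s3 j (ins ?S u 0 v) ?x dg bad \<and> frame {} UNIV s2 s3 j" and f3: "frame {11} UNIV s2 s3 j"
          then have sc3: "scale s3 j (ins ?S u 0 v) ?x dg bad" by blast
          have r3: "regs s3 a = u" "regs s3 b = v" using fr[OF f3] ab r2 by simp_all
          have lab: "exp_val w (Bin Add (labE a) (Num 2)) s3 = l u + 2"
            using val_lab[OF sc3, of a] r3 u l lM M_W by simp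
          show "run j {11} UNIV 250 (Seq (Assign 11 (Bin Add (labE a) (Num 2))) (add_set b 11 a)) s3
              (\<lambda>s'. scale s' j S2 ?x dg bad)"
          proof (rule run_Seq[OF run_assign[OF sc3 lab _ _ order_refl]])
            fix s4
            assume "scale s4 j (ins ?S u 0 v) ?x dg bad \<and> regs s4 11 = l u + 2 \<and> frame {11} {} s3 s4 j"
              and f4: "frame {11} UNIV s3 s4 j"
            then have sc4: "scale s4 j (ins ?S u 0 v) ?x dg bad" and t4: "regs s4 11 = l u + 2" by auto
            have r4: "regs s4 a = u" "regs s4 b = v" using fr[OF f4] ab r3 by simp_all
            have nin: "u \<notin> ins ?S u 0 v v (l u + 2)" using m0 m by (auto simp: sets_def ins_def)
            show "run j {11} UNIV 200 (add_set b 11 a) s4 (\<lambda>s'. scale s' j S2 ?x dg bad)"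
              by (rule run_weaken[OF run_add[OF sc4 r4(2) t4 r4(1) v(2) lM u(2) nin UNIV_I order_refl]])
                (use m0 in \<open>auto simp: S2_def\<close>)
          qed simp_all
        qed simp_all
      qed simp_all
    next
      assume "exp_val w (Bin Eq (cell 3 (Reg a) (Reg b) (Num 0)) (Num 1)) s1 = 0"
      then show "run j {11} UNIV 500 Skip s1 (\<lambda>s2. scale s2 j S2 ?x dg bad)"
        using x1 sc1 by (intro run_Skip) (auto simp: S2_def)
    next
      fix s2 assume sc2: "scale s2 j S2 ?x dg bad" and f2: "frame {11} UNIV s1 s2 j"
      have r2: "regs s2 a = u" "regs s2 b = v" "regs s2 7 = half" using fr[OF f2] ab r1 by simp_all
      have "exp_val w (cell 3 (Reg a) (Reg b) (Num 0)) s2 = Suc m"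
        using val_x[OF sc2, of "Reg a" "Reg b"] r2 u v scale_regs[OF sc2] by (simp add: bump_def)
      then have e2: "exp_val w (Bin Eq (cell 3 (Reg a) (Reg b) (Num 0)) (Bin Add (Reg 7) (Num 1))) s2 = of_bool (m = half)"
        using scale_regs[OF sc2] r2 half M_W M32 by simp
      show "run j {11} UNIV 300 (Cond (Bin Eq (cell 3 (Reg a) (Reg b) (Num 0)) (Bin Add (Reg 7) (Num 1)))
          (Seq (Assign 11 (Num 1)) (add_set a 11 b)) Skip) s2 (\<lambda>s'. scale s' j (sets half ?x l) ?x dg bad)"
      proof (rule run_Cond[where K = 250])
        assume "exp_val w (Bin Eq (cell 3 (Reg a) (Reg b) (Num 0)) (Bin Add (Reg 7) (Num 1))) s2 \<noteq> 0"
        then have mh: "m = half" by (simp only: e2 of_bool_eq_0_iff not_not)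
        show "run j {11} UNIV 250 (Seq (Assign 11 (Num 1)) (add_set a 11 b)) s2 (\<lambda>s'. scale s' j (sets half ?x l) ?x dg bad)"
        proof (rule run_Seq[OF run_assign[OF sc2 _ _ _ order_refl]])
          fix s3
          assume "scale s3 j S2 ?x dg bad \<and> regs s3 11 = 1 \<and> frame {11} {} s2 s3 j" and f3: "frame {11} UNIV s2 s3 j"
          then have sc3: "scale s3 j S2 ?x dg bad" and t3: "regs s3 11 = 1" by auto
          have r3: "regs s3 a = u" "regs s3 b = v" using fr[OF f3] ab r2 by simp_all
          have nin: "v \<notin> S2 u 1" using mh m by (auto simp: S2_def sets_def ins_def)
          show "run j {11} UNIV 200 (add_set a 11 b) s3 (\<lambda>s'. scale s' j (sets half ?x l) ?x dg bad)"
            by (rule run_weaken[OF run_add[OF sc3 r3(1) t3 r3(2) u(2) _ v(2) nin UNIV_I order_refl]])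
              (use S3 mh in auto)
        qed simp_all
      next
        assume "exp_val w (Bin Eq (cell 3 (Reg a) (Reg b) (Num 0)) (Bin Add (Reg 7) (Num 1))) s2 = 0"
        then have "m \<noteq> half" by (simp only: e2 of_bool_eq_0_iff not_False_eq_True)
        then show "run j {11} UNIV 250 Skip s2 (\<lambda>s'. scale s' j (sets half ?x l) ?x dg bad)"
          using sc2 S3 by (intro run_Skip) auto
      qed simp
    qed simp_all
  qed (use u v scale_regs[OF sc] in simp_all)
qed

lemma run_dec_copies:
  assumes sc: "scale s j (sets half x l) x dg bad" and half: "regs s 7 = half" "half < M"
    and u: "regs s a = u" "u < n" and v: "regs s b = v" "v < n" and l: "l u = min (dg u) Cap"
    and m: "x u v = Suc m" "m < M" and ab: "a \<noteq> 11" "b \<noteq> 11" "a < 19" "b < 19"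
  shows "run j {11} UNIV 1500 (dec_copies a b) s
    (\<lambda>s'. scale s' j (sets half (bump x u v m) l) (bump x u v m) dg bad)"
proof -
  let ?x = "bump x u v m" and ?S = "sets half x l"
  define S2 where "S2 = (if m = 0 then del (del ?S u 0 v) v (l u + 2) u else ?S)"
  have S3: "sets half ?x l = (if m = half then del S2 u 1 v else S2)"
    using sets_dec[of x u v m, OF m(1)] by (simp add: S2_def Let_def)
  have lM: "l u + 2 < M" using l MCap by linarith
  have e0: "exp_val w (Bin Sub (cell 3 (Reg a) (Reg b) (Num 0)) (Num 1)) s = m"
    using val_x[OF sc, of "Reg a" "Reg b"] u v m scale_regs[OF sc] by (subst exp_val_Sub) simp_all
  note fr = frame_reg[where R = "{11}" and X = UNIV and j = j]
  show ?thesis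
    unfolding dec_copies_def
  proof (rule run_Seq[OF run_put_x[OF sc _ _ e0 _ _ order_refl]])
    fix s1 assume sc1: "scale s1 j ?S ?x dg bad \<and> frame {} {} s s1 j" and f1: "frame {11} UNIV s s1 j"
    then have sc1: "scale s1 j ?S ?x dg bad" by blast
    have r1: "regs s1 a = u" "regs s1 b = v" "regs s1 7 = half" using fr[OF f1] ab u v half by simp_all
    have x1: "exp_val w (cell 3 (Reg a) (Reg b) (Num 0)) s1 = m"
      using val_x[OF sc1, of "Reg a" "Reg b"] r1 u v scale_regs[OF sc1] by (simp add: bump_def)
    show "run j {11} UNIV 1450 (Seq (Cond (Bin Eq (cell 3 (Reg a) (Reg b) (Num 0)) (Num 0))
          (Seq (Assign 11 (Num 0)) (Seq (remove_set a 11 b)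
            (Seq (Assign 11 (Bin Add (labE a) (Num 2))) (remove_set b 11 a)))) Skip)
        (Cond (Bin Eq (cell 3 (Reg a) (Reg b) (Num 0)) (Reg 7))
          (Seq (Assign 11 (Num 1)) (remove_set a 11 b)) Skip)) s1
       (\<lambda>s'. scale s' j (sets half ?x l) ?x dg bad)"
    proof (rule run_Seq[where P = "\<lambda>s2. scale s2 j S2 ?x dg bad" and K = 800 and K' = 450], rule run_Cond[where K = 750])
      assume "exp_val w (Bin Eq (cell 3 (Reg a) (Reg b) (Num 0)) (Num 0)) s1 \<noteq> 0"
      then have m0: "m = 0" using x1 by simp
      show "run j {11} UNIV 750 (Seq (Assign 11 (Num 0)) (Seq (remove_set a 11 b)
            (Seq (Assign 11 (Bin Add (labE a) (Num 2))) (remove_set b 11 a)))) s1 (\<lambda>s2. scale s2 j S2 ?x dg bad)"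
      proof (rule run_Seq[OF run_assign[OF sc1 _ _ _ order_refl]])
        fix s2
        assume "scale s2 j ?S ?x dg bad \<and> regs s2 11 = 0 \<and> frame {11} {} s1 s2 j" and f2: "frame {11} UNIV s1 s2 j"
        then have sc2: "scale s2 j ?S ?x dg bad" and t2: "regs s2 11 = 0" by auto
        have r2: "regs s2 a = u" "regs s2 b = v" using fr[OF f2] ab r1 by simp_all
        have nin: "v \<in> ?S u 0" using m by (simp add: sets_def)
        show "run j {11} UNIV 740 (Seq (remove_set a 11 b) (Seq (Assign 11 (Bin Add (labE a) (Num 2))) (remove_set b 11 a))) s2
            (\<lambda>s'. scale s' j S2 ?x dg bad)"
        proof (rule run_Seq[OF run_remove[OF sc2 r2(1) t2 r2(2) u(2) _ nin _ _ _ _ order_refl]])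
          fix s3 assume "scale s3 j (del ?S u 0 v) ?x dg bad \<and> frame {} UNIV s2 s3 j" and f3: "frame {11} UNIV s2 s3 j"
          then have sc3: "scale s3 j (del ?S u 0 v) ?x dg bad" by blast
          have r3: "regs s3 a = u" "regs s3 b = v" using fr[OF f3] ab r2 by simp_all
          have lab: "exp_val w (Bin Add (labE a) (Num 2)) s3 = l u + 2"
            using val_lab[OF sc3, of a] r3 u l lM M_W by simp
          show "run j {11} UNIV 350 (Seq (Assign 11 (Bin Add (labE a) (Num 2))) (remove_set b 11 a)) s3
              (\<lambda>s'. scale s' j S2 ?x dg bad)"
          proof (rule run_Seq[OF run_assign[OF sc3 lab _ _ order_refl]])
            fix s4
            assume "scale s4 j (del ?S u 0 v) ?x dg bad \<and> regs s4 11 = l u + 2 \<and> frame {11} {} s3 s4 j"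
              and f4: "frame {11} UNIV s3 s4 j"
            then have sc4: "scale s4 j (del ?S u 0 v) ?x dg bad" and t4: "regs s4 11 = l u + 2" by auto
            have r4: "regs s4 a = u" "regs s4 b = v" using fr[OF f4] ab r3 by simp_all
            have nin: "u \<in> del ?S u 0 v v (l u + 2)" using m by (auto simp: sets_def del_def)
            show "run j {11} UNIV 300 (remove_set b 11 a) s4 (\<lambda>s'. scale s' j S2 ?x dg bad)"
              by (rule run_weaken[OF run_remove[OF sc4 r4(2) t4 r4(1) v(2) lM nin _ _ _ UNIV_I order_refl]])
                (use m0 ab in \<open>auto simp: S2_def\<close>)
          qed (use ab in simp_all)
        qed (use ab in simp_all)
      qed (use ab in simp_all)
    next
      assume "exp_val w (Bin Eq (cell 3 (Reg a) (Reg b) (Num 0)) (Num 0)) s1 = 0"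
      then show "run j {11} UNIV 750 Skip s1 (\<lambda>s2. scale s2 j S2 ?x dg bad)"
        using x1 sc1 by (intro run_Skip) (auto simp: S2_def)
    next
      fix s2 assume sc2: "scale s2 j S2 ?x dg bad" and f2: "frame {11} UNIV s1 s2 j"
      have r2: "regs s2 a = u" "regs s2 b = v" "regs s2 7 = half" using fr[OF f2] ab r1 by simp_all
      have "exp_val w (cell 3 (Reg a) (Reg b) (Num 0)) s2 = m"
        using val_x[OF sc2, of "Reg a" "Reg b"] r2 u v scale_regs[OF sc2] by (simp add: bump_def)
      then have e2: "exp_val w (Bin Eq (cell 3 (Reg a) (Reg b) (Num 0)) (Reg 7)) s2 = of_bool (m = half)"
        using scale_regs[OF sc2] r2 half M_W M32 by simp
      show "run j {11} UNIV 450 (Cond (Bin Eq (cell 3 (Reg a) (Reg b) (Num 0)) (Reg 7))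
          (Seq (Assign 11 (Num 1)) (remove_set a 11 b)) Skip) s2 (\<lambda>s'. scale s' j (sets half ?x l) ?x dg bad)"
      proof (rule run_Cond[where K = 400])
        assume "exp_val w (Bin Eq (cell 3 (Reg a) (Reg b) (Num 0)) (Reg 7)) s2 \<noteq> 0"
        then have mh: "m = half" by (simp only: e2 of_bool_eq_0_iff not_not)
        show "run j {11} UNIV 400 (Seq (Assign 11 (Num 1)) (remove_set a 11 b)) s2 (\<lambda>s'. scale s' j (sets half ?x l) ?x dg bad)"
        proof (rule run_Seq[OF run_assign[OF sc2 _ _ _ order_refl]])
          fix s3
          assume "scale s3 j S2 ?x dg bad \<and> regs s3 11 = 1 \<and> frame {11} {} s2 s3 j" and f3: "frame {11} UNIV s2 s3 j"
          then have sc3: "scale s3 j S2 ?x dg bad" and t3: "regs s3 11 = 1" by auto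
          have r3: "regs s3 a = u" "regs s3 b = v" using fr[OF f3] ab r2 by simp_all
          have nin: "v \<in> S2 u 1" using mh m by (auto simp: S2_def sets_def del_def)
          show "run j {11} UNIV 300 (remove_set a 11 b) s3 (\<lambda>s'. scale s' j (sets half ?x l) ?x dg bad)"
            by (rule run_weaken[OF run_remove[OF sc3 r3(1) t3 r3(2) u(2) _ nin _ _ _ UNIV_I order_refl]])
              (use S3 mh ab in auto)
        qed (use ab in simp_all)
      next
        assume "exp_val w (Bin Eq (cell 3 (Reg a) (Reg b) (Num 0)) (Reg 7)) s2 = 0"
        then have "m \<noteq> half" by (simp only: e2 of_bool_eq_0_iff not_False_eq_True)
        then show "run j {11} UNIV 400 Skip s2 (\<lambda>s'. scale s' j (sets half ?x l) ?x dg bad)"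
          using sc2 S3 by (intro run_Skip) auto
      qed simp
    qed (use ab in simp_all)
  qed (use u v scale_regs[OF sc] in simp_all)
qed

end

section \<open>Insertion and deletion of one copy of an edge\<close>

text \<open>The removed and the added amount stand on opposite sides, which avoids truncated
  subtraction and lets two such equations be combined linearly.\<close>

lemma outdeg_bump:
  assumes "v < n"
  shows "outdeg n (bump x u v k) y + (if y = u then x u v else 0) = outdeg n x y + (if y = u then k else 0)"
proof (cases "y = u")
  case True
  have "outdeg n (bump x u v k) u = k + (\<Sum>z\<in>{..<n} - {v}. x u z)" "outdeg n x u = x u v + (\<Sum>z\<in>{..<n} - {v}. x u z)"
    using assms by (auto simp: outdeg_def bump_def sum.remove[of "{..<n}" v])
  then show ?thesis using True by simp
qed (simp add: outdeg_def bump_def)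

definition flip :: "(nat \<Rightarrow> nat \<Rightarrow> nat) \<Rightarrow> nat \<Rightarrow> nat \<Rightarrow> nat \<Rightarrow> nat \<Rightarrow> nat" where
  "flip x a b = bump (bump x a b (x a b - 1)) b a (Suc (x b a))"

lemma balanced_bound: "balanced n x l wt \<Longrightarrow> x u v \<le> wt u v"
  unfolding balanced_def by (metis le_add1)

lemma balancedD:
  assumes "balanced n x l wt" "0 < x u v"
  shows "u < n" "v < n" "l u \<le> Suc (l v)"
  using assms unfolding balanced_def by auto

lemma balanced_sum: "balanced n x l wt \<Longrightarrow> x u v + x v u = wt u v"
  unfolding balanced_def by blast

lemma balancedI:
  assumes "\<And>u v. 0 < x u v \<Longrightarrow> u < n \<and> v < n \<and> l u \<le> Suc (l v)" "\<And>u v. x u v + x v u = wt u v"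
  shows "balanced n x l wt"
  using assms unfolding balanced_def by blast

text \<open>With labels held fixed, the only new requirement comes from the copy that now points
  from \<open>b\<close> to \<open>a\<close>. Walks can therefore reverse copies freely between
  vertices whose labels are close.\<close>

lemma balanced_flip:
  assumes bal: "balanced n x l wt" and pos: "0 < x a b" and ab: "a \<noteq> b" and l: "l b \<le> Suc (l a)"
  shows "balanced n (flip x a b) l wt"
proof (rule balancedI)
  fix u v
  show "0 < flip x a b u v \<Longrightarrow> u < n \<and> v < n \<and> l u \<le> Suc (l v)"
    using balancedD[OF bal, of u v] balancedD[OF bal pos] l ab by (auto simp: flip_def bump_def split: if_splits)
  show "flip x a b u v + flip x a b v u = wt u v"
    using balanced_sum[OF bal, of u v] pos ab by (auto simp: flip_def bump_def)
qed

lemma outdeg_flip: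
  assumes "a < n" "b < n" "0 < x a b" "a \<noteq> b"
  shows "outdeg n (flip x a b) y + of_bool (y = a) = outdeg n x y + of_bool (y = b)"
  using outdeg_bump[OF assms(1), of "bump x a b (x a b - 1)" b "Suc (x b a)" y]
    outdeg_bump[OF assms(2), of x a "x a b - 1" y] assms(3,4)
  by (auto simp: flip_def bump_def split: if_splits)

text \<open>The weight of the pair is set to \<open>k\<close> in both orders; nothing is added. This
  makes successive changes of the same pair collapse to the last one.\<close>

definition shift_wt :: "(nat \<Rightarrow> nat \<Rightarrow> nat) \<Rightarrow> nat \<Rightarrow> nat \<Rightarrow> nat \<Rightarrow> nat \<Rightarrow> nat \<Rightarrow> nat" where
  "shift_wt wt a b k = bump (bump wt a b k) b a k"

lemma shift_wt_commute: "shift_wt wt b a k = shift_wt wt a b k"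
  by (auto simp: shift_wt_def bump_def fun_eq_iff)

lemma balanced_inc:
  assumes bal: "balanced n x l wt" and "a < n" "b < n" "a \<noteq> b" "l a \<le> l b"
  shows "balanced n (bump x a b (Suc (x a b))) l (shift_wt wt a b (Suc (wt a b)))"
proof (rule balancedI)
  fix u v
  show "0 < bump x a b (Suc (x a b)) u v \<Longrightarrow> u < n \<and> v < n \<and> l u \<le> Suc (l v)"
    using balancedD[OF bal, of u v] assms(2-5) by (auto simp: bump_def split: if_splits)
  show "bump x a b (Suc (x a b)) u v + bump x a b (Suc (x a b)) v u = shift_wt wt a b (Suc (wt a b)) u v"
    using balanced_sum[OF bal, of u v] balanced_sum[OF bal, of a b] assms(4) by (auto simp: shift_wt_def bump_def)
qed

lemma balanced_dec:
  assumes bal: "balanced n x l wt" and pos: "x a b = Suc m" "a \<noteq> b"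
  shows "balanced n (bump x a b m) l (shift_wt wt a b (wt a b - 1))"
proof (rule balancedI)
  fix u v
  show "0 < bump x a b m u v \<Longrightarrow> u < n \<and> v < n \<and> l u \<le> Suc (l v)"
    using balancedD[OF bal, of u v] balancedD[OF bal, of a b] pos by (auto simp: bump_def split: if_splits)
  show "bump x a b m u v + bump x a b m v u = shift_wt wt a b (wt a b - 1) u v"
    using balanced_sum[OF bal, of u v] balanced_sum[OF bal, of a b] pos by (auto simp: shift_wt_def bump_def)
qed

definition labels :: "nat \<Rightarrow> (nat \<Rightarrow> nat) \<Rightarrow> nat \<Rightarrow> nat" where
  "labels cap dg u = min (dg u) cap"

text \<open>Raising the label of \<open>a\<close> can only violate the condition on copies leaving
  \<open>a\<close>, and these are safe if no out-neighbour has a smaller label. At the cap the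
  truncated label does not move at all.\<close>

lemma balanced_absorb:
  assumes bal: "balanced n x (labels cap dg) wt"
    and stuck: "cap \<le> dg a \<or> (\<forall>v. 0 < x a v \<longrightarrow> labels cap dg a \<le> labels cap dg v)"
  shows "balanced n x (labels cap (dg(a := Suc (dg a)))) wt"
proof (rule balancedI)
  fix u v
  assume pos: "0 < x u v"
  then have "u = a \<Longrightarrow> cap \<le> dg a \<or> labels cap dg a \<le> labels cap dg v" using stuck by blast
  then show "u < n \<and> v < n \<and> labels cap (dg(a := Suc (dg a))) u \<le> Suc (labels cap (dg(a := Suc (dg a))) v)"
    using balancedD[OF bal pos] by (auto simp: labels_def min_def split: if_splits)
next
  fix u v show "x u v + x v u = wt u v" by (rule balanced_sum[OF bal])
qed

text \<open>The dual of \<open>balanced_absorb\<close>: lowering a label endangers only the copies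
  that enter \<open>a\<close>, and these are safe if no in-neighbour has a larger label.\<close>

lemma balanced_release:
  assumes bal: "balanced n x (labels cap dg) wt"
    and stuck: "\<And>v. 0 < x v a \<Longrightarrow> labels cap dg v \<le> labels cap dg a"
  shows "balanced n x (labels cap (dg(a := dg a - 1))) wt"
proof (rule balancedI)
  fix u v
  show "0 < x u v \<Longrightarrow> u < n \<and> v < n \<and> labels cap (dg(a := dg a - 1)) u \<le> Suc (labels cap (dg(a := dg a - 1)) v)"
    using balancedD[OF bal, of u v] stuck[of u] by (auto simp: labels_def)
qed (rule balanced_sum[OF bal])

definition count_full :: "nat \<Rightarrow> nat \<Rightarrow> (nat \<Rightarrow> nat) \<Rightarrow> nat" where
  "count_full n cap dg = card {u. u < n \<and> cap \<le> dg u}"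

lemma count_full_upd:
  assumes "a < n"
  shows "count_full n cap (dg(a := d)) + of_bool (cap \<le> dg a) = count_full n cap dg + of_bool (cap \<le> d)"
proof -
  have fin: "finite {u. u < n \<and> P u}" for P by simp
  have "count_full n cap f = card {u. u < n \<and> u \<noteq> a \<and> cap \<le> f u} + of_bool (cap \<le> f a)" for f
  proof (cases "cap \<le> f a")
    case True
    then have "{u. u < n \<and> cap \<le> f u} = insert a {u. u < n \<and> u \<noteq> a \<and> cap \<le> f u}" using assms by auto
    then show ?thesis using True fin by (simp add: count_full_def)
  next
    case False
    then have "{u. u < n \<and> cap \<le> f u} = {u. u < n \<and> u \<noteq> a \<and> cap \<le> f u}" by auto
    then show ?thesis using False by (simp add: count_full_def)
  qed
  note this[of dg] this[of "dg(a := d)"]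
  moreover have "{u. u < n \<and> u \<noteq> a \<and> cap \<le> (dg(a := d)) u} = {u. u < n \<and> u \<noteq> a \<and> cap \<le> dg u}" by auto
  ultimately show ?thesis by simp
qed

section \<open>Label changes and the two ways in which a walk ends\<close>

definition relabel :: com where
  "relabel = Seq (Assign 14 (Num 0)) (While (Bin Less (Reg 14) (cell 2 (Reg 9) (Num 0) (Num 0)))
     (Seq (Assign 15 (cell 0 (Reg 9) (Num 0) (Reg 14)))
     (Seq (remove_set 15 12 9) (Seq (add_set 15 13 9) (Assign 14 (Bin Add (Reg 14) (Num 1)))))))"

context machine
begin

text \<open>In-neighbours are stored in buckets by label, so a vertex whose label changes must move
  to another bucket at each of its out-neighbours. The cost is linear in their number, which the
  callers bound by the cap.\<close>

lemma run_relabel: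
  assumes sc: "scale s j (sets half x l) x dg bad" and a: "regs s 9 = a" "a < n"
    and t: "regs s 12 = l a + 2" "l a + 2 < M" "regs s 13 = k + 2" "k + 2 < M" "k \<noteq> l a"
    and x: "\<And>u v. 0 < x u v \<Longrightarrow> u < n \<and> v < n"
  shows "run j {14, 15} {(u, t). 2 \<le> t} (700 * card {v. 0 < x a v} + 100) relabel s
    (\<lambda>s'. scale s' j (sets half x (l(a := k))) x dg bad)"
proof -
  define e where "e i = view M (mem s) j (0, a, 0, i)" for i
  let ?l = "l(a := k)" and ?X = "{(u, t). 2 \<le> t} :: (nat \<times> nat) set"
  \<comment> \<open>The family after the first \<open>i\<close> out-neighbours have been handled, in
    the order \<open>e\<close> of the initial memory. This order stays valid during the loop, since
    only buckets, with index at least \<open>2\<close>, are written.\<close>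
  define S where "S i u t = (if 2 \<le> t \<and> u \<in> e ` {..<i} then sets half x ?l u t else sets half x l u t)" for i u t
  have out: "sets half x l a 0 = {v. 0 < x a v}" by (simp add: sets_def)
  have rep: "setrep (view M (mem s) j) a 0 {v. 0 < x a v}" using scale_sets(4)[OF sc a(2), of 0] out by simp
  have fin: "finite {v. 0 < x a v}" using scale_sets(2)[OF sc a(2), of 0] out by simp
  have cardn: "card {v. 0 < x a v} \<le> n" using scale_sets(3)[OF sc a(2), of 0] out by simp
  define N where "N = card {v. 0 < x a v}"
  have eN: "e ` {..<N} = {v. 0 < x a v}" using setrep_image[OF rep] by (simp add: e_def N_def)
  have einj: "e i \<notin> e ` {..<i}" if "i < N" for i
    using setrep_inj[OF rep] that by (auto simp: e_def N_def) (metis less_trans less_irrefl)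
  have S0: "S 0 = sets half x l" by (simp add: S_def fun_eq_iff)
  have SN: "S N = sets half x ?l"
    unfolding S_def fun_eq_iff eN by (auto simp: sets_def)
  have Sout: "S i a 0 = {v. 0 < x a v}" for i using out by (simp add: S_def)
  have Sstep: "ins (del (S i) (e i) (l a + 2) a) (e i) (k + 2) a = S (Suc i)" if "i < N" for i
  proof (intro ext)
    fix u t
    have p: "0 < x a (e i)" using eN that by blast
    show "ins (del (S i) (e i) (l a + 2) a) (e i) (k + 2) a u t = S (Suc i) u t"
      using einj[OF that] p t(5)
      by (cases "u = e i") (auto simp: S_def ins_def del_def sets_def lessThan_Suc)
  qed
  define I where "I s1 \<longleftrightarrow> regs s1 14 \<le> N \<and> scale s1 j (S (regs s1 14)) x dg bad" for s1
  note fr = frame_reg[where R = "{14, 15}" and X = "?X" and j = j]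
  show ?thesis unfolding relabel_def
  proof (rule run_Seq[OF run_assign[OF sc _ _ _ order_refl]])
    fix s0 assume "scale s0 j (sets half x l) x dg bad \<and> regs s0 14 = 0 \<and> frame {14} {} s s0 j"
      and f0: "frame {14, 15} ?X s s0 j"
    then have sc0: "scale s0 j (sets half x l) x dg bad" "regs s0 14 = 0" by auto
    show "run j {14, 15} ?X (700 * N + 90) (While (Bin Less (Reg 14) (cell 2 (Reg 9) (Num 0) (Num 0)))
     (Seq (Assign 15 (cell 0 (Reg 9) (Num 0) (Reg 14)))
     (Seq (remove_set 15 12 9) (Seq (add_set 15 13 9) (Assign 14 (Bin Add (Reg 14) (Num 1))))))) s0
     (\<lambda>s'. scale s' j (sets half x ?l) x dg bad)"
    proof (rule run_For[where I = I and \<mu> = "\<lambda>s. N - regs s 14" and B = 600])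
      show "I s0" using sc0 S0 by (simp add: I_def)
      fix s1 assume I1: "I s1" and "frame {14, 15} ?X s0 s1 j"
      then have f1: "frame {14, 15} ?X s s1 j" using frame_trans[OF f0] by blast
      from I1 have sc1: "scale s1 j (S (regs s1 14)) x dg bad" and le: "regs s1 14 \<le> N" by (auto simp: I_def)
      have r1: "regs s1 9 = a" "regs s1 12 = l a + 2" "regs s1 13 = k + 2" using fr[OF f1] a t by simp_all
      have c1: "exp_val w (cell 2 (Reg 9) (Num 0) (Num 0)) s1 = N"
        using val_card[OF sc1, of "Reg 9" "Num 0"] r1 a scale_regs[OF sc1] Sout by (simp add: N_def)
      let ?i = "regs s1 14"
      have cond: "exp_val w (Bin Less (Reg 14) (cell 2 (Reg 9) (Num 0) (Num 0))) s1 = of_bool (?i < N)"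
        using c1 scale_regs[OF sc1] by simp
      {
        assume "exp_val w (Bin Less (Reg 14) (cell 2 (Reg 9) (Num 0) (Num 0))) s1 = 0"
        then have "?i = N" using le by (simp only: cond) simp
        then show "scale s1 j (sets half x ?l) x dg bad" using sc1 SN by simp
      }
      assume "exp_val w (Bin Less (Reg 14) (cell 2 (Reg 9) (Num 0) (Num 0))) s1 \<noteq> 0"
      then have i: "?i < N" by (simp only: cond) simp
      have view1: "view M (mem s1) j (0, a, 0, ?i) = e ?i" using f1 by (simp add: frame_def e_def)
      have el: "exp_val w (cell 0 (Reg 9) (Num 0) (Reg 14)) s1 = e ?i"
        using val_elem(1)[OF sc1, of "Reg 9" a "Num 0" 0 "Reg 14" ?i] r1 a i scale_regs[OF sc1] Sout view1
        by (simp add: N_def)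
      have p: "0 < x a (e ?i)" "e ?i < n" using eN i x by blast+
      show "run j {14, 15} ?X 600 (Seq (Assign 15 (cell 0 (Reg 9) (Num 0) (Reg 14)))
         (Seq (remove_set 15 12 9) (Seq (add_set 15 13 9) (Assign 14 (Bin Add (Reg 14) (Num 1)))))) s1
         (\<lambda>s'. I s' \<and> N - regs s' 14 < N - regs s1 14)"
      proof (rule run_Seq[OF run_assign[OF sc1 el _ _ order_refl]])
        fix s2 assume "scale s2 j (S ?i) x dg bad \<and> regs s2 15 = e ?i \<and> frame {15} {} s1 s2 j"
        then have sc2: "scale s2 j (S ?i) x dg bad" and e2: "regs s2 15 = e ?i" and f2: "frame {15} {} s1 s2 j" by auto
        have r2: "regs s2 9 = a" "regs s2 12 = l a + 2" "regs s2 13 = k + 2" "regs s2 14 = ?i"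
          using frame_reg[OF f2] r1 by simp_all
        have mem: "a \<in> S ?i (e ?i) (l a + 2)" using einj[OF i] p by (simp add: S_def sets_def)
        show "run j {14, 15} ?X 560 (Seq (remove_set 15 12 9) (Seq (add_set 15 13 9) (Assign 14 (Bin Add (Reg 14) (Num 1))))) s2
          (\<lambda>s'. I s' \<and> N - regs s' 14 < N - regs s1 14)"
        proof (rule run_Seq[OF run_remove[OF sc2 e2 r2(2) r2(1) p(2) t(2) mem _ _ _ _ order_refl]])
          fix s3 assume "scale s3 j (del (S ?i) (e ?i) (l a + 2) a) x dg bad \<and> frame {} ?X s2 s3 j"
          then have sc3: "scale s3 j (del (S ?i) (e ?i) (l a + 2) a) x dg bad" and f3: "frame {} ?X s2 s3 j" by auto
          have r3: "regs s3 9 = a" "regs s3 15 = e ?i" "regs s3 13 = k + 2" "regs s3 14 = ?i"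
            using frame_reg[OF f3] r2 e2 by simp_all
          have nin: "a \<notin> del (S ?i) (e ?i) (l a + 2) a (e ?i) (k + 2)"
            using einj[OF i] t(5) by (auto simp: S_def sets_def del_def)
          show "run j {14, 15} ?X 250 (Seq (add_set 15 13 9) (Assign 14 (Bin Add (Reg 14) (Num 1)))) s3
            (\<lambda>s'. I s' \<and> N - regs s' 14 < N - regs s1 14)"
          proof (rule run_Seq[OF run_add[OF sc3 r3(2) r3(3) r3(1) p(2) t(4) a(2) nin _ order_refl]])
            fix s4 assume "scale s4 j (ins (del (S ?i) (e ?i) (l a + 2) a) (e ?i) (k + 2) a) x dg bad \<and> frame {} ?X s3 s4 j"
            then have sc4: "scale s4 j (S (Suc ?i)) x dg bad" and f4: "frame {} ?X s3 s4 j"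
              unfolding Sstep[OF i] by auto
            have r4: "regs s4 14 = ?i" using frame_reg[OF f4] r3 by simp
            have v4: "exp_val w (Bin Add (Reg 14) (Num 1)) s4 = Suc ?i"
              using r4 scale_regs[OF sc4] i cardn nM M_W N_def by simp
            show "run j {14, 15} ?X 10 (Assign 14 (Bin Add (Reg 14) (Num 1))) s4
              (\<lambda>s'. I s' \<and> N - regs s' 14 < N - regs s1 14)"
              by (rule run_weaken[OF run_assign[OF sc4 v4 _ _ order_refl]]) (use i in \<open>auto simp: I_def\<close>)
          qed simp_all
        qed simp_all
      qed simp_all
    qed (use sc0 in simp)
  qed (simp_all add: N_def)
qed

end

abbreviation dgE :: exp where "dgE \<equiv> cell 4 (Reg 9) (Num 0) (Num 0)"
abbreviation badE :: exp where "badE \<equiv> cell 5 (Num 0) (Num 0) (Num 0)"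

definition scan_out :: com where
  "scan_out = Seq (Assign 14 (Num 0)) (While (Bin Less (Reg 14) (cell 2 (Reg 9) (Num 0) (Num 0)))
     (Seq (Assign 15 (cell 0 (Reg 9) (Num 0) (Reg 14)))
     (Seq (Cond (Bin Less (labE 15) (labE 9)) (Seq (Assign 10 (Reg 15)) (Assign 16 (Num 1))) Skip)
       (Assign 14 (Bin Add (Reg 14) (Num 1))))))"

definition absorb :: com where
  "absorb = Seq (put 4 (Reg 9) (Num 0) (Num 0) (Bin Add dgE (Num 1)))
    (Cond (Bin Less (Reg 4) dgE) Skip
      (Seq (Assign 12 (Bin Add dgE (Num 1))) (Seq (Assign 13 (Bin Add dgE (Num 2))) (Seq relabel
        (Cond (Bin Eq dgE (Reg 4)) (put 5 (Num 0) (Num 0) (Num 0) (Bin Add badE (Num 1))) Skip)))))"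

definition release :: com where
  "release = Seq (put 4 (Reg 9) (Num 0) (Num 0) (Bin Sub dgE (Num 1)))
    (Cond (Bin Less dgE (Reg 4))
      (Seq (Assign 12 (Bin Add dgE (Num 3))) (Seq (Assign 13 (Bin Add dgE (Num 2))) (Seq relabel
        (Cond (Bin Eq (Bin Add dgE (Num 1)) (Reg 4)) (put 5 (Num 0) (Num 0) (Num 0) (Bin Sub badE (Num 1))) Skip))))
      Skip)"

definition flip_copy :: "nat \<Rightarrow> nat \<Rightarrow> com" where
  "flip_copy a b = Seq (dec_copies a b) (inc_copies b a)"

lemma card_out_le:
  assumes "balanced n x l wt"
  shows "card {v. 0 < x u v} \<le> outdeg n x u"
proof -
  have "card {v. 0 < x u v} = (\<Sum>v\<in>{v. 0 < x u v}. 1)" by simp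
  also have "\<dots> \<le> (\<Sum>v\<in>{v. 0 < x u v}. x u v)" by (rule sum_mono) auto
  also have "\<dots> \<le> outdeg n x u"
    unfolding outdeg_def by (rule sum_mono2) (use balancedD[OF assms] in auto)
  finally show ?thesis .
qed

lemma outdeg_le:
  assumes "balanced n x l wt" "\<And>u v. wt u v < M"
  shows "outdeg n x u \<le> n * M"
proof -
  have "x u v \<le> M" for v using balanced_bound[OF assms(1), of u v] assms(2)[of u v] by linarith
  then have "(\<Sum>v<n. x u v) \<le> (\<Sum>v<n. M)" by (intro sum_mono) auto
  then show ?thesis by (simp add: outdeg_def)
qed

lemma count_full_le: "count_full n cap dg \<le> n"
  unfolding count_full_def using card_mono[of "{..<n}" "{u. u < n \<and> cap \<le> dg u}"] by auto

context machine
begin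

text \<open>Here \<open>dg\<close> may differ from the outdegree by one at the end of a walk that is still in progress.\<close>

definition chain where
  "chain s j half x dg wt \<longleftrightarrow> scale s j (sets half x (labels Cap dg)) x dg (count_full n Cap dg) \<and>
     balanced n x (labels Cap dg) wt \<and> regs s 7 = half \<and> half < M \<and> (\<forall>u v. wt u v < M)"

text \<open>The state at rest: recorded degrees are the true outdegrees. The orientation is
  existentially quantified, as it depends on the history and not only on the graph.\<close>

definition good where
  "good s j half wt \<longleftrightarrow> (\<exists>x. chain s j half x (outdeg n x) wt)"

lemma run_flip:
  assumes c: "chain s j half x dg wt" and r: "regs s ra = a" "regs s rb = b"
    and rr: "ra \<noteq> 11" "rb \<noteq> 11" "ra < 19" "rb < 19"
    and pos: "0 < x a b" and ab: "a \<noteq> b" and l: "labels Cap dg b \<le> Suc (labels Cap dg a)"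
  shows "run j {11} UNIV 2500 (flip_copy ra rb) s (\<lambda>s'. chain s' j half (flip x a b) dg wt)"
proof -
  from c have sc: "scale s j (sets half x (labels Cap dg)) x dg (count_full n Cap dg)"
    and bal: "balanced n x (labels Cap dg) wt" and h: "regs s 7 = half" "half < M" and wt: "\<And>u v. wt u v < M"
    by (auto simp: chain_def)
  have n: "a < n" "b < n" using balancedD[OF bal pos] by auto
  have x: "x a b + x b a < M" using balanced_sum[OF bal, of a b] wt by simp
  have ll: "labels Cap dg a = min (dg a) Cap" "labels Cap dg b = min (dg b) Cap" by (simp_all add: labels_def)
  have m: "x a b = Suc (x a b - 1)" using pos by simp
  show ?thesis
    unfolding flip_copy_def
  proof (rule run_Seq[OF run_dec_copies[OF sc h r(1) n(1) r(2) n(2) ll(1) m _ rr]])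
    let ?x = "bump x a b (x a b - 1)"
    fix s1 assume sc1: "scale s1 j (sets half ?x (labels Cap dg)) ?x dg (count_full n Cap dg)"
      and f: "frame {11} UNIV s s1 j"
    have r1: "regs s1 7 = half" "regs s1 rb = b" "regs s1 ra = a" using frame_reg[OF f] rr r h by simp_all
    have xb: "?x b a = x b a" using ab by (simp add: bump_def)
    have ba: "balanced n (flip x a b) (labels Cap dg) wt" by (rule balanced_flip[OF bal pos ab l])
    show "run j {11} UNIV 1000 (inc_copies rb ra) s1 (\<lambda>s'. chain s' j half (flip x a b) dg wt)"
    proof (rule run_weaken[OF run_inc_copies[OF sc1 r1(1) h(2) r1(2) n(2) r1(3) n(1) ll(2) xb _ rr(2,1,4,3)]])
      fix s2
      assume "scale s2 j (sets half (bump ?x b a (Suc (x b a))) (labels Cap dg)) (bump ?x b a (Suc (x b a))) dg (count_full n Cap dg)"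
        "frame {11} UNIV s1 s2 j"
      then show "chain s2 j half (flip x a b) dg wt"
        using ba h wt frame_reg[of "{11}" UNIV s1 s2 j 7] r1 by (simp add: chain_def flip_def)
    qed (use x in auto)
  qed (use x in auto)
qed

lemma run_scan_out:
  assumes sc: "scale s j S x dg bad" and a: "regs s 9 = a" "a < n" and S: "S a 0 = {v. 0 < x a v}"
    and x: "\<And>u v. 0 < x u v \<Longrightarrow> u < n \<and> v < n" and N: "card {v. 0 < x a v} \<le> N" and z: "regs s 16 = 0"
  shows "run j {10, 14, 15, 16} {} (300 * N + 100) scan_out s (\<lambda>s'. scale s' j S x dg bad \<and>
    (regs s' 16 = 0 \<and> (\<forall>v. 0 < x a v \<longrightarrow> labels Cap dg a \<le> labels Cap dg v) \<or>
     regs s' 16 = 1 \<and> 0 < x a (regs s' 10) \<and> labels Cap dg (regs s' 10) < labels Cap dg a))"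
proof -
  define e where "e i = view M (mem s) j (0, a, 0, i)" for i
  let ?l = "labels Cap dg" and ?C = "card {v. 0 < x a v}" and ?R = "{10, 14, 15, 16} :: nat set"
  have rep: "setrep (view M (mem s) j) a 0 {v. 0 < x a v}" using scale_sets(4)[OF sc a(2), of 0] S by simp
  have eN: "e ` {..<?C} = {v. 0 < x a v}" using setrep_image[OF rep] by (simp add: e_def)
  have cardn: "?C \<le> n" using scale_sets(3)[OF sc a(2), of 0] S by simp
  \<comment> \<open>Register \<open>16\<close> tells whether a smaller label has been met. Before
    that, all scanned out-neighbours are known to be no smaller; afterwards register
    \<open>10\<close> holds a witness, which later finds may replace.\<close>
  define I where "I s1 \<longleftrightarrow> regs s1 14 \<le> ?C \<and> scale s1 j S x dg bad \<and>
    (regs s1 16 = 0 \<and> (\<forall>i<regs s1 14. ?l a \<le> ?l (e i)) \<or>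
     regs s1 16 = 1 \<and> 0 < x a (regs s1 10) \<and> ?l (regs s1 10) < ?l a)" for s1
  note fr = frame_reg[where R = ?R and X = "{}" and j = j]
  show ?thesis unfolding scan_out_def
  proof (rule run_Seq[OF run_assign[OF sc _ _ _ order_refl]])
    fix s0 assume "scale s0 j S x dg bad \<and> regs s0 14 = 0 \<and> frame {14} {} s s0 j"
      and f0: "frame ?R {} s s0 j"
    then have sc0: "scale s0 j S x dg bad" "regs s0 14 = 0" and z0: "regs s0 16 = 0"
      using z by (auto simp: frame_def)
    show "run j ?R {} (300 * N + 50) (While (Bin Less (Reg 14) (cell 2 (Reg 9) (Num 0) (Num 0)))
     (Seq (Assign 15 (cell 0 (Reg 9) (Num 0) (Reg 14)))
     (Seq (Cond (Bin Less (labE 15) (labE 9)) (Seq (Assign 10 (Reg 15)) (Assign 16 (Num 1))) Skip)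
       (Assign 14 (Bin Add (Reg 14) (Num 1)))))) s0 (\<lambda>s'. scale s' j S x dg bad \<and>
    (regs s' 16 = 0 \<and> (\<forall>v. 0 < x a v \<longrightarrow> ?l a \<le> ?l v) \<or>
     regs s' 16 = 1 \<and> 0 < x a (regs s' 10) \<and> ?l (regs s' 10) < ?l a))"
    proof (rule run_For[where I = I and \<mu> = "\<lambda>s. ?C - regs s 14" and B = 200])
      show "I s0" using sc0 z0 by (simp add: I_def)
      fix s1 assume I1: "I s1" and "frame ?R {} s0 s1 j"
      then have f1: "frame ?R {} s s1 j" using frame_trans[OF f0] by blast
      let ?i = "regs s1 14"
      from I1 have sc1: "scale s1 j S x dg bad" and le: "?i \<le> ?C" by (auto simp: I_def)
      have r1: "regs s1 9 = a" using fr[OF f1] a by simp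
      have c1: "exp_val w (cell 2 (Reg 9) (Num 0) (Num 0)) s1 = ?C"
        using val_card[OF sc1, of "Reg 9" "Num 0"] r1 a scale_regs[OF sc1] S by simp
      have cond: "exp_val w (Bin Less (Reg 14) (cell 2 (Reg 9) (Num 0) (Num 0))) s1 = of_bool (?i < ?C)"
        using c1 scale_regs[OF sc1] by simp
      {
        assume "exp_val w (Bin Less (Reg 14) (cell 2 (Reg 9) (Num 0) (Num 0))) s1 = 0"
        then have i: "?i = ?C" using le by (simp only: cond) simp
        have "?l a \<le> ?l v" if "\<forall>i<?C. ?l a \<le> ?l (e i)" "0 < x a v" for v
        proof -
          from that(2) have "v \<in> e ` {..<?C}" using eN by blast
          then show ?thesis using that(1) by auto
        qed
        then show "scale s1 j S x dg bad \<and> (regs s1 16 = 0 \<and> (\<forall>v. 0 < x a v \<longrightarrow> ?l a \<le> ?l v) \<or>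
           regs s1 16 = 1 \<and> 0 < x a (regs s1 10) \<and> ?l (regs s1 10) < ?l a)"
          using I1 i by (auto simp: I_def)
      }
      assume "exp_val w (Bin Less (Reg 14) (cell 2 (Reg 9) (Num 0) (Num 0))) s1 \<noteq> 0"
      then have i: "?i < ?C" by (simp only: cond) simp
      have view1: "view M (mem s1) j (0, a, 0, ?i) = e ?i" using f1 by (simp add: frame_def e_def)
      have el: "exp_val w (cell 0 (Reg 9) (Num 0) (Reg 14)) s1 = e ?i"
        using val_elem(1)[OF sc1, of "Reg 9" a "Num 0" 0 "Reg 14" ?i] r1 a i scale_regs[OF sc1] S view1 by simp
      have p: "0 < x a (e ?i)" "e ?i < n" using eN i x by blast+
      show "run j ?R {} 200 (Seq (Assign 15 (cell 0 (Reg 9) (Num 0) (Reg 14)))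
         (Seq (Cond (Bin Less (labE 15) (labE 9)) (Seq (Assign 10 (Reg 15)) (Assign 16 (Num 1))) Skip)
           (Assign 14 (Bin Add (Reg 14) (Num 1))))) s1 (\<lambda>s'. I s' \<and> ?C - regs s' 14 < ?C - regs s1 14)"
      proof (rule run_Seq[OF run_assign[OF sc1 el _ _ order_refl]])
        fix s2 assume "scale s2 j S x dg bad \<and> regs s2 15 = e ?i \<and> frame {15} {} s1 s2 j"
        then have sc2: "scale s2 j S x dg bad" and e2: "regs s2 15 = e ?i" and f2: "frame {15} {} s1 s2 j" by auto
        have r2: "regs s2 9 = a" "regs s2 14 = ?i" "regs s2 10 = regs s1 10" "regs s2 16 = regs s1 16"
          using frame_reg[OF f2] r1 by simp_all
        have lab: "exp_val w (Bin Less (labE 15) (labE 9)) s2 = of_bool (?l (e ?i) < ?l a)"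
          using val_lab[OF sc2, of 15] val_lab[OF sc2, of 9] e2 p r2 a by (simp add: labels_def)
        show "run j ?R {} 150 (Seq (Cond (Bin Less (labE 15) (labE 9)) (Seq (Assign 10 (Reg 15)) (Assign 16 (Num 1))) Skip)
           (Assign 14 (Bin Add (Reg 14) (Num 1)))) s2 (\<lambda>s'. I s' \<and> ?C - regs s' 14 < ?C - regs s1 14)"
        proof (rule run_Seq[where K = 110 and P = "\<lambda>s'. scale s' j S x dg bad \<and> regs s' 14 = ?i \<and>
            (regs s' 16 = 0 \<and> (\<forall>i<Suc ?i. ?l a \<le> ?l (e i)) \<or>
             regs s' 16 = 1 \<and> 0 < x a (regs s' 10) \<and> ?l (regs s' 10) < ?l a)"], rule run_Cond[where K = 15])
          assume "exp_val w (Bin Less (labE 15) (labE 9)) s2 \<noteq> 0"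
          then have lt: "?l (e ?i) < ?l a" by (simp only: lab) simp
          have ev: "exp_val w (Reg 15) s2 = e ?i" using e2 scale_regs[OF sc2] by simp
          show "run j ?R {} 15 (Seq (Assign 10 (Reg 15)) (Assign 16 (Num 1))) s2 (\<lambda>s'. scale s' j S x dg bad \<and> regs s' 14 = ?i \<and>
            (regs s' 16 = 0 \<and> (\<forall>i<Suc ?i. ?l a \<le> ?l (e i)) \<or>
             regs s' 16 = 1 \<and> 0 < x a (regs s' 10) \<and> ?l (regs s' 10) < ?l a))"
          proof (rule run_Seq[OF run_assign[OF sc2 ev _ _ order_refl]])
            fix s3 assume "scale s3 j S x dg bad \<and> regs s3 10 = e ?i \<and> frame {10} {} s2 s3 j"
            then have sc3: "scale s3 j S x dg bad" and e3: "regs s3 10 = e ?i" and f3: "frame {10} {} s2 s3 j" by auto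
            show "run j ?R {} 5 (Assign 16 (Num 1)) s3 (\<lambda>s'. scale s' j S x dg bad \<and> regs s' 14 = ?i \<and>
              (regs s' 16 = 0 \<and> (\<forall>i<Suc ?i. ?l a \<le> ?l (e i)) \<or>
               regs s' 16 = 1 \<and> 0 < x a (regs s' 10) \<and> ?l (regs s' 10) < ?l a))"
            proof (rule run_weaken[OF run_assign[OF sc3 _ _ _ order_refl, of "Num 1" 1 16 ?R]])
              fix s4 assume *: "scale s4 j S x dg bad \<and> regs s4 16 = 1 \<and> frame {16} {} s3 s4 j"
              then have "regs s4 14 = ?i" "regs s4 10 = e ?i"
                using frame_reg[of "{16}" "{}" s3 s4 j] frame_reg[OF f3] e3 r2 by simp_all
              then show "scale s4 j S x dg bad \<and> regs s4 14 = ?i \<and>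
              (regs s4 16 = 0 \<and> (\<forall>i<Suc ?i. ?l a \<le> ?l (e i)) \<or>
               regs s4 16 = 1 \<and> 0 < x a (regs s4 10) \<and> ?l (regs s4 10) < ?l a)"
                using * p lt by simp
            qed simp_all
          qed simp_all
        next
          assume "exp_val w (Bin Less (labE 15) (labE 9)) s2 = 0"
          then have lt: "?l a \<le> ?l (e ?i)" by (simp only: lab) simp
          show "run j ?R {} 15 Skip s2 (\<lambda>s'. scale s' j S x dg bad \<and> regs s' 14 = ?i \<and>
            (regs s' 16 = 0 \<and> (\<forall>i<Suc ?i. ?l a \<le> ?l (e i)) \<or>
             regs s' 16 = 1 \<and> 0 < x a (regs s' 10) \<and> ?l (regs s' 10) < ?l a))"
            using I1 sc2 r2 lt by (intro run_Skip) (auto simp: I_def less_Suc_eq)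
        next
          fix s3 assume *: "scale s3 j S x dg bad \<and> regs s3 14 = ?i \<and>
            (regs s3 16 = 0 \<and> (\<forall>i<Suc ?i. ?l a \<le> ?l (e i)) \<or>
             regs s3 16 = 1 \<and> 0 < x a (regs s3 10) \<and> ?l (regs s3 10) < ?l a)"
          then have sc3: "scale s3 j S x dg bad" by blast
          have v3: "exp_val w (Bin Add (Reg 14) (Num 1)) s3 = Suc ?i"
            using * scale_regs[OF sc3] i cardn nM M_W by simp
          show "run j ?R {} 10 (Assign 14 (Bin Add (Reg 14) (Num 1))) s3 (\<lambda>s'. I s' \<and> ?C - regs s' 14 < ?C - regs s1 14)"
          proof (rule run_weaken[OF run_assign[OF sc3 v3 _ _ order_refl, of 14 ?R]])
            fix s4 assume **: "scale s4 j S x dg bad \<and> regs s4 14 = Suc ?i \<and> frame {14} {} s3 s4 j"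
            then have "regs s4 16 = regs s3 16" "regs s4 10 = regs s3 10"
              using frame_reg[of "{14}" "{}" s3 s4 j] by simp_all
            then show "I s4 \<and> ?C - regs s4 14 < ?C - regs s1 14" using * ** i by (auto simp: I_def)
          qed simp_all
        qed simp_all
      qed simp_all
    next
      show "(1 + exp_cost (Bin Less (Reg 14) (cell 2 (Reg 9) (Num 0) (Num 0))) + 200) * (?C - regs s0 14) + 1 +
          exp_cost (Bin Less (Reg 14) (cell 2 (Reg 9) (Num 0) (Num 0))) \<le> 300 * N + 50"
        using N sc0 by simp
    qed
  qed (simp_all)
qed

lemma small_sums: "Cap + 8 < W" "n * M + 8 < W" "n + 8 < W"
  using MCap M_W M2_W nM M32 mult_le_mono1[of n M M] by linarith+

lemma val_dgE:
  assumes "scale s j S x dg bad" "regs s 9 = a" "a < n"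
  shows "exp_val w dgE s = dg a"
  using val_dg[OF assms(1), of "Reg 9"] assms(2,3) scale_regs[OF assms(1)] by simp

text \<open>The surplus that the walk has carried to \<open>a\<close> becomes part of the recorded
  degree. If \<open>a\<close> was already at the cap, its label and the counter of full vertices
  stay as they are, and writing the degree suffices.\<close>

lemma run_absorb:
  assumes c: "chain s j half x dg wt" and a: "regs s 9 = a" "a < n"
    and dg: "outdeg n x = dg(a := Suc (dg a))"
    and stuck: "Cap \<le> dg a \<or> (\<forall>v. 0 < x a v \<longrightarrow> labels Cap dg a \<le> labels Cap dg v)"
  shows "run j {12, 13, 14, 15} UNIV (700 * Cap + 1000) absorb s (\<lambda>s'. good s' j half wt)"
proof -
  from c have sc: "scale s j (sets half x (labels Cap dg)) x dg (count_full n Cap dg)"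
    and bal: "balanced n x (labels Cap dg) wt" and h: "regs s 7 = half" "half < M" and wt: "\<And>u v. wt u v < M"
    by (auto simp: chain_def)
  let ?R = "{12, 13, 14, 15} :: nat set"
  let ?dg = "dg(a := Suc (dg a))"
  note fr = frame_reg[where R = ?R and X = UNIV and j = j]
  have bal': "balanced n x (labels Cap ?dg) wt" by (rule balanced_absorb[OF bal stuck])
  have goodI: "good s' j half wt"
    if "scale s' j (sets half x (labels Cap ?dg)) x ?dg (count_full n Cap ?dg)" "regs s' 7 = half" for s'
    using that bal' h wt dg unfolding good_def chain_def by metis
  have "outdeg n x a \<le> n * M" by (rule outdeg_le[OF bal wt])
  then have dgW: "Suc (dg a) \<le> n * M" using dg by simp
  have e0: "exp_val w (Bin Add dgE (Num 1)) s = Suc (dg a)"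
    using val_dgE[OF sc a] dgW small_sums by simp
  show ?thesis unfolding absorb_def
  proof (rule run_Seq[OF run_put_dg[OF sc _ e0 a(2) order_refl]])
    fix s1 assume "scale s1 j (sets half x (labels Cap dg)) x ?dg (count_full n Cap dg) \<and> frame {} {} s s1 j"
      and f1: "frame ?R UNIV s s1 j"
    then have sc1: "scale s1 j (sets half x (labels Cap dg)) x ?dg (count_full n Cap dg)" by blast
    have r1: "regs s1 9 = a" "regs s1 7 = half" using fr[OF f1] a h by simp_all
    have d1: "exp_val w dgE s1 = Suc (dg a)" using val_dgE[OF sc1 r1(1) a(2)] by simp
    have c1: "exp_val w (Bin Less (Reg 4) dgE) s1 = of_bool (Cap < Suc (dg a))"
      using d1 scale_regs[OF sc1] by simp
    show "run j ?R UNIV (700 * Cap + 900) (Cond (Bin Less (Reg 4) dgE) Skip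
      (Seq (Assign 12 (Bin Add dgE (Num 1))) (Seq (Assign 13 (Bin Add dgE (Num 2))) (Seq relabel
        (Cond (Bin Eq dgE (Reg 4)) (put 5 (Num 0) (Num 0) (Num 0) (Bin Add badE (Num 1))) Skip))))) s1
      (\<lambda>s'. good s' j half wt)"
    proof (rule run_Cond[where K = "700 * Cap + 800"])
      assume "exp_val w (Bin Less (Reg 4) dgE) s1 \<noteq> 0"
      then have lt: "Cap \<le> dg a" by (simp only: c1) simp
      then have "labels Cap ?dg = labels Cap dg" by (auto simp: labels_def fun_eq_iff)
      moreover have "count_full n Cap ?dg = count_full n Cap dg"
        using count_full_upd[OF a(2), of Cap dg "Suc (dg a)"] lt by simp
      ultimately show "run j ?R UNIV (700 * Cap + 800) Skip s1 (\<lambda>s'. good s' j half wt)"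
        using sc1 r1 by (intro run_Skip goodI) simp_all
    next
      assume "exp_val w (Bin Less (Reg 4) dgE) s1 = 0"
      then have lt: "dg a < Cap" by (simp only: c1) simp
      then have la: "labels Cap dg a = dg a" and l': "labels Cap ?dg = (labels Cap dg)(a := Suc (dg a))"
        by (simp_all add: labels_def fun_eq_iff)
      have cf: "count_full n Cap ?dg = count_full n Cap dg + of_bool (Suc (dg a) = Cap)"
        using count_full_upd[OF a(2), of Cap dg "Suc (dg a)"] lt by simp
      \<comment> \<open>The degree array already contains the new value, so adding \<open>1\<close>
        to it gives the old bucket index, which is the old label plus \<open>2\<close>.\<close>
      have e1: "exp_val w (Bin Add dgE (Num 1)) s1 = labels Cap dg a + 2"
        using d1 lt la small_sums by simp
      show "run j ?R UNIV (700 * Cap + 800) (Seq (Assign 12 (Bin Add dgE (Num 1))) (Seq (Assign 13 (Bin Add dgE (Num 2))) (Seq relabel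
        (Cond (Bin Eq dgE (Reg 4)) (put 5 (Num 0) (Num 0) (Num 0) (Bin Add badE (Num 1))) Skip)))) s1
        (\<lambda>s'. good s' j half wt)"
      proof (rule run_Seq[OF run_assign[OF sc1 e1 _ _ order_refl]])
        fix s2 assume "scale s2 j (sets half x (labels Cap dg)) x ?dg (count_full n Cap dg) \<and>
            regs s2 12 = labels Cap dg a + 2 \<and> frame {12} {} s1 s2 j"
        then have sc2: "scale s2 j (sets half x (labels Cap dg)) x ?dg (count_full n Cap dg)"
          and t2: "regs s2 12 = labels Cap dg a + 2" and f2: "frame {12} {} s1 s2 j" by auto
        have r2: "regs s2 9 = a" "regs s2 7 = half" using frame_reg[OF f2] r1 by simp_all
        have e2: "exp_val w (Bin Add dgE (Num 2)) s2 = Suc (dg a) + 2"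
          using val_dgE[OF sc2 r2(1) a(2)] lt small_sums by simp
        show "run j ?R UNIV (700 * Cap + 700) (Seq (Assign 13 (Bin Add dgE (Num 2))) (Seq relabel
          (Cond (Bin Eq dgE (Reg 4)) (put 5 (Num 0) (Num 0) (Num 0) (Bin Add badE (Num 1))) Skip))) s2
          (\<lambda>s'. good s' j half wt)"
        proof (rule run_Seq[OF run_assign[OF sc2 e2 _ _ order_refl]])
          fix s3 assume "scale s3 j (sets half x (labels Cap dg)) x ?dg (count_full n Cap dg) \<and>
              regs s3 13 = Suc (dg a) + 2 \<and> frame {13} {} s2 s3 j"
          then have sc3: "scale s3 j (sets half x (labels Cap dg)) x ?dg (count_full n Cap dg)"
            and t3: "regs s3 13 = Suc (dg a) + 2" and f3: "frame {13} {} s2 s3 j" by auto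
          have r3: "regs s3 9 = a" "regs s3 7 = half" "regs s3 12 = labels Cap dg a + 2"
            using frame_reg[OF f3] r2 t2 by simp_all
          have b1: "labels Cap dg a + 2 < M" "Suc (dg a) + 2 < M" "Suc (dg a) \<noteq> labels Cap dg a"
            using lt la MCap by auto
          \<comment> \<open>Labels change only below the cap. There the number of out-neighbours is
            at most the new outdegree, hence at most \<open>Cap\<close>; this bounds the cost of
            relabelling.\<close>
          have cN: "card {v. 0 < x a v} \<le> Cap" using card_out_le[OF bal, of a] dg lt by simp
          show "run j ?R UNIV (700 * Cap + 600) (Seq relabel
            (Cond (Bin Eq dgE (Reg 4)) (put 5 (Num 0) (Num 0) (Num 0) (Bin Add badE (Num 1))) Skip)) s3
            (\<lambda>s'. good s' j half wt)"
          proof (rule run_Seq[where K = "700 * Cap + 100" and K' = 200 and P =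
                "\<lambda>s'. scale s' j (sets half x (labels Cap ?dg)) x ?dg (count_full n Cap dg) \<and> frame {14,15} UNIV s3 s' j"])
            show "run j ?R UNIV (700 * Cap + 100) relabel s3
              (\<lambda>s'. scale s' j (sets half x (labels Cap ?dg)) x ?dg (count_full n Cap dg) \<and> frame {14,15} UNIV s3 s' j)"
            proof (rule run_weaken[OF run_relabel[OF sc3 r3(1) a(2) r3(3) b1(1) t3 b1(2,3)]])
              show "0 < x u v \<Longrightarrow> u < n \<and> v < n" for u v using balancedD[OF bal] by blast
              fix s' assume *: "scale s' j (sets half x ((labels Cap dg)(a := Suc (dg a)))) x ?dg (count_full n Cap dg)"
                and "frame {14, 15} {(u, t). 2 \<le> t} s3 s' j"
              then have "frame {14, 15} UNIV s3 s' j" using frame_trans[OF frame_refl[of "{}" "{}" s3 j]] by blast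
              then show "scale s' j (sets half x (labels Cap ?dg)) x ?dg (count_full n Cap dg) \<and> frame {14,15} UNIV s3 s' j"
                using * l' by simp
            qed (use cN in auto)
            fix s4 assume "scale s4 j (sets half x (labels Cap ?dg)) x ?dg (count_full n Cap dg) \<and> frame {14,15} UNIV s3 s4 j"
            then have sc4: "scale s4 j (sets half x (labels Cap ?dg)) x ?dg (count_full n Cap dg)"
              and f4: "frame {14,15} UNIV s3 s4 j" by auto
            have r4: "regs s4 9 = a" "regs s4 7 = half" using frame_reg[OF f4] r3 by simp_all
            have c4: "exp_val w (Bin Eq dgE (Reg 4)) s4 = of_bool (Suc (dg a) = Cap)"
              using val_dgE[OF sc4 r4(1) a(2)] scale_regs[OF sc4] by simp
            show "run j ?R UNIV 200 (Cond (Bin Eq dgE (Reg 4)) (put 5 (Num 0) (Num 0) (Num 0) (Bin Add badE (Num 1))) Skip) s4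
              (\<lambda>s'. good s' j half wt)"
            proof (rule run_Cond[where K = 100])
              assume "exp_val w (Bin Eq dgE (Reg 4)) s4 \<noteq> 0"
              then have eq: "Suc (dg a) = Cap" by (simp only: c4) simp
              have e4: "exp_val w (Bin Add badE (Num 1)) s4 = count_full n Cap ?dg"
                using val_bad[OF sc4] cf eq small_sums count_full_le[of n Cap dg] by simp
              show "run j ?R UNIV 100 (put 5 (Num 0) (Num 0) (Num 0) (Bin Add badE (Num 1))) s4 (\<lambda>s'. good s' j half wt)"
              proof (rule run_weaken[OF run_put_bad[OF sc4 e4 order_refl, of ?R UNIV]])
                fix s' assume *: "scale s' j (sets half x (labels Cap ?dg)) x ?dg (count_full n Cap ?dg) \<and> frame {} {} s4 s' j"
                then have "regs s' 7 = half" using frame_reg[of "{}" "{}" s4 s' j 7] r4 by simp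
                then show "good s' j half wt" using * by (intro goodI) auto
              qed auto
            next
              assume "exp_val w (Bin Eq dgE (Reg 4)) s4 = 0"
              then have "Suc (dg a) \<noteq> Cap" by (simp only: c4) simp
              then show "run j ?R UNIV 100 Skip s4 (\<lambda>s'. good s' j half wt)"
                using cf sc4 r4 by (intro run_Skip goodI) simp_all
            qed simp
          qed simp_all
        qed simp_all
      qed simp_all
    qed simp
  qed (use a scale_regs[OF sc] in simp_all)
qed

lemma run_release:
  assumes c: "chain s j half x dg wt" and a: "regs s 9 = a" "a < n"
    and dg: "outdeg n x = dg(a := dg a - 1)" "0 < dg a"
    and stuck: "\<And>v. 0 < x v a \<Longrightarrow> labels Cap dg v \<le> labels Cap dg a"
  shows "run j {12, 13, 14, 15} UNIV (700 * Cap + 1000) release s (\<lambda>s'. good s' j half wt)"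
proof -
  from c have sc: "scale s j (sets half x (labels Cap dg)) x dg (count_full n Cap dg)"
    and bal: "balanced n x (labels Cap dg) wt" and h: "regs s 7 = half" "half < M" and wt: "\<And>u v. wt u v < M"
    by (auto simp: chain_def)
  let ?R = "{12, 13, 14, 15} :: nat set"
  let ?dg = "dg(a := dg a - 1)"
  note fr = frame_reg[where R = ?R and X = UNIV and j = j]
  have bal': "balanced n x (labels Cap ?dg) wt" by (rule balanced_release[OF bal stuck])
  have goodI: "good s' j half wt"
    if "scale s' j (sets half x (labels Cap ?dg)) x ?dg (count_full n Cap ?dg)" "regs s' 7 = half" for s'
    using that bal' h wt dg(1) unfolding good_def chain_def by metis
  have "outdeg n x a \<le> n * M" by (rule outdeg_le[OF bal wt])
  then have dgW: "dg a - 1 \<le> n * M" using dg(1) by simp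
  have e0: "exp_val w (Bin Sub dgE (Num 1)) s = dg a - 1"
    using val_dgE[OF sc a] dg(2) by (subst exp_val_Sub) simp_all
  show ?thesis unfolding release_def
  proof (rule run_Seq[OF run_put_dg[OF sc _ e0 a(2) order_refl]])
    fix s1 assume "scale s1 j (sets half x (labels Cap dg)) x ?dg (count_full n Cap dg) \<and> frame {} {} s s1 j"
      and f1: "frame ?R UNIV s s1 j"
    then have sc1: "scale s1 j (sets half x (labels Cap dg)) x ?dg (count_full n Cap dg)" by blast
    have r1: "regs s1 9 = a" "regs s1 7 = half" using fr[OF f1] a h by simp_all
    have d1: "exp_val w dgE s1 = dg a - 1" using val_dgE[OF sc1 r1(1) a(2)] by simp
    have c1: "exp_val w (Bin Less dgE (Reg 4)) s1 = of_bool (dg a - 1 < Cap)"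
      using d1 scale_regs[OF sc1] by simp
    show "run j ?R UNIV (700 * Cap + 900) (Cond (Bin Less dgE (Reg 4))
      (Seq (Assign 12 (Bin Add dgE (Num 3))) (Seq (Assign 13 (Bin Add dgE (Num 2))) (Seq relabel
        (Cond (Bin Eq (Bin Add dgE (Num 1)) (Reg 4)) (put 5 (Num 0) (Num 0) (Num 0) (Bin Sub badE (Num 1))) Skip))))
      Skip) s1
      (\<lambda>s'. good s' j half wt)"
    proof (rule run_Cond[where K = "700 * Cap + 800"])
      assume "exp_val w (Bin Less dgE (Reg 4)) s1 \<noteq> 0"
      then have lt: "dg a - 1 < Cap" by (simp only: c1) simp
      \<comment> \<open>The test concerns the decreased degree. A vertex exactly at the cap is thus
        included, and it is the one for which the counter drops.\<close>
      with dg(2) have lt: "dg a \<le> Cap" by linarith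
      then have la: "labels Cap dg a = dg a" and l': "labels Cap ?dg = (labels Cap dg)(a := dg a - 1)"
        by (simp_all add: labels_def fun_eq_iff)
      have cf: "count_full n Cap ?dg + of_bool (dg a = Cap) = count_full n Cap dg"
        proof -
        have "\<not> Cap \<le> dg a - 1" "(Cap \<le> dg a) = (dg a = Cap)" using lt dg(2) by linarith+
        then show ?thesis using count_full_upd[OF a(2), of Cap dg "dg a - 1"] by simp
      qed
      \<comment> \<open>The stored degree is already decreased by one, so the old bucket index, the
        old label plus \<open>2\<close>, is reached by adding \<open>3\<close>.\<close>
      have e1: "exp_val w (Bin Add dgE (Num 3)) s1 = labels Cap dg a + 2"
        using d1 lt la small_sums dg(2) by simp
      show "run j ?R UNIV (700 * Cap + 800) (Seq (Assign 12 (Bin Add dgE (Num 3))) (Seq (Assign 13 (Bin Add dgE (Num 2))) (Seq relabel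
        (Cond (Bin Eq (Bin Add dgE (Num 1)) (Reg 4)) (put 5 (Num 0) (Num 0) (Num 0) (Bin Sub badE (Num 1))) Skip)))) s1
        (\<lambda>s'. good s' j half wt)"
      proof (rule run_Seq[OF run_assign[OF sc1 e1 _ _ order_refl]])
        fix s2 assume "scale s2 j (sets half x (labels Cap dg)) x ?dg (count_full n Cap dg) \<and>
            regs s2 12 = labels Cap dg a + 2 \<and> frame {12} {} s1 s2 j"
        then have sc2: "scale s2 j (sets half x (labels Cap dg)) x ?dg (count_full n Cap dg)"
          and t2: "regs s2 12 = labels Cap dg a + 2" and f2: "frame {12} {} s1 s2 j" by auto
        have r2: "regs s2 9 = a" "regs s2 7 = half" using frame_reg[OF f2] r1 by simp_all
        have e2: "exp_val w (Bin Add dgE (Num 2)) s2 = dg a - 1 + 2"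
          using val_dgE[OF sc2 r2(1) a(2)] lt small_sums by simp
        show "run j ?R UNIV (700 * Cap + 700) (Seq (Assign 13 (Bin Add dgE (Num 2))) (Seq relabel
          (Cond (Bin Eq (Bin Add dgE (Num 1)) (Reg 4)) (put 5 (Num 0) (Num 0) (Num 0) (Bin Sub badE (Num 1))) Skip))) s2
          (\<lambda>s'. good s' j half wt)"
        proof (rule run_Seq[OF run_assign[OF sc2 e2 _ _ order_refl]])
          fix s3 assume "scale s3 j (sets half x (labels Cap dg)) x ?dg (count_full n Cap dg) \<and>
              regs s3 13 = dg a - 1 + 2 \<and> frame {13} {} s2 s3 j"
          then have sc3: "scale s3 j (sets half x (labels Cap dg)) x ?dg (count_full n Cap dg)"
            and t3: "regs s3 13 = dg a - 1 + 2" and f3: "frame {13} {} s2 s3 j" by auto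
          have r3: "regs s3 9 = a" "regs s3 7 = half" "regs s3 12 = labels Cap dg a + 2"
            using frame_reg[OF f3] r2 t2 by simp_all
          have b1: "labels Cap dg a + 2 < M" "dg a - 1 + 2 < M" "dg a - 1 \<noteq> labels Cap dg a"
            using lt la MCap dg(2) by auto
          have cN: "card {v. 0 < x a v} \<le> Cap" using card_out_le[OF bal, of a] dg lt by simp
          show "run j ?R UNIV (700 * Cap + 600) (Seq relabel
            (Cond (Bin Eq (Bin Add dgE (Num 1)) (Reg 4)) (put 5 (Num 0) (Num 0) (Num 0) (Bin Sub badE (Num 1))) Skip)) s3
            (\<lambda>s'. good s' j half wt)"
          proof (rule run_Seq[where K = "700 * Cap + 100" and K' = 200 and P =
                "\<lambda>s'. scale s' j (sets half x (labels Cap ?dg)) x ?dg (count_full n Cap dg) \<and> frame {14,15} UNIV s3 s' j"])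
            show "run j ?R UNIV (700 * Cap + 100) relabel s3
              (\<lambda>s'. scale s' j (sets half x (labels Cap ?dg)) x ?dg (count_full n Cap dg) \<and> frame {14,15} UNIV s3 s' j)"
            proof (rule run_weaken[OF run_relabel[OF sc3 r3(1) a(2) r3(3) b1(1) t3 b1(2,3)]])
              show "0 < x u v \<Longrightarrow> u < n \<and> v < n" for u v using balancedD[OF bal] by blast
              fix s' assume *: "scale s' j (sets half x ((labels Cap dg)(a := dg a - 1))) x ?dg (count_full n Cap dg)"
                and "frame {14, 15} {(u, t). 2 \<le> t} s3 s' j"
              then have "frame {14, 15} UNIV s3 s' j" using frame_trans[OF frame_refl[of "{}" "{}" s3 j]] by blast
              then show "scale s' j (sets half x (labels Cap ?dg)) x ?dg (count_full n Cap dg) \<and> frame {14,15} UNIV s3 s' j"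
                using * l' by simp
            qed (use cN in auto)
            fix s4 assume "scale s4 j (sets half x (labels Cap ?dg)) x ?dg (count_full n Cap dg) \<and> frame {14,15} UNIV s3 s4 j"
            then have sc4: "scale s4 j (sets half x (labels Cap ?dg)) x ?dg (count_full n Cap dg)"
              and f4: "frame {14,15} UNIV s3 s4 j" by auto
            have r4: "regs s4 9 = a" "regs s4 7 = half" using frame_reg[OF f4] r3 by simp_all
            have c4: "exp_val w (Bin Eq (Bin Add dgE (Num 1)) (Reg 4)) s4 = of_bool (dg a = Cap)"
              using val_dgE[OF sc4 r4(1) a(2)] scale_regs[OF sc4] lt dg(2) small_sums by simp
            show "run j ?R UNIV 200 (Cond (Bin Eq (Bin Add dgE (Num 1)) (Reg 4)) (put 5 (Num 0) (Num 0) (Num 0) (Bin Sub badE (Num 1))) Skip) s4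
              (\<lambda>s'. good s' j half wt)"
            proof (rule run_Cond[where K = 100])
              assume "exp_val w (Bin Eq (Bin Add dgE (Num 1)) (Reg 4)) s4 \<noteq> 0"
              then have eq: "dg a = Cap" by (simp only: c4) simp
              have e4: "exp_val w (Bin Sub badE (Num 1)) s4 = count_full n Cap ?dg"
                using val_bad[OF sc4] cf eq by (subst exp_val_Sub) simp_all
              show "run j ?R UNIV 100 (put 5 (Num 0) (Num 0) (Num 0) (Bin Sub badE (Num 1))) s4 (\<lambda>s'. good s' j half wt)"
              proof (rule run_weaken[OF run_put_bad[OF sc4 e4 order_refl, of ?R UNIV]])
                fix s' assume *: "scale s' j (sets half x (labels Cap ?dg)) x ?dg (count_full n Cap ?dg) \<and> frame {} {} s4 s' j"
                then have "regs s' 7 = half" using frame_reg[of "{}" "{}" s4 s' j 7] r4 by simp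
                then show "good s' j half wt" using * by (intro goodI) auto
              qed auto
            next
              assume "exp_val w (Bin Eq (Bin Add dgE (Num 1)) (Reg 4)) s4 = 0"
              then have "dg a \<noteq> Cap" by (simp only: c4) simp
              then show "run j ?R UNIV 100 Skip s4 (\<lambda>s'. good s' j half wt)"
                using cf sc4 r4 by (intro run_Skip goodI) simp_all
            qed simp
          qed simp_all
        qed simp_all
      qed simp_all
    next
      assume "exp_val w (Bin Less dgE (Reg 4)) s1 = 0"
      then have lt: "Cap \<le> dg a - 1" by (simp only: c1) simp
      then have "labels Cap ?dg = labels Cap dg" using lt by (auto simp: labels_def fun_eq_iff)
      moreover have "count_full n Cap ?dg = count_full n Cap dg"
        using count_full_upd[OF a(2), of Cap dg "dg a - 1"] lt le_trans[OF lt, of "dg a"] by simp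
      ultimately show "run j ?R UNIV (700 * Cap + 800) Skip s1 (\<lambda>s'. good s' j half wt)"
        using sc1 r1 by (intro run_Skip goodI) simp_all
    qed simp
  qed (use a scale_regs[OF sc] in simp_all)
qed

end

section \<open>Walks that carry a surplus or a deficit of one copy\<close>

definition push_step :: com where
  "push_step = Seq (Assign 16 (Num 0)) (Cond (Bin Less dgE (Reg 4))
     (Seq scan_out (Cond (Reg 16) (Seq (flip_copy 9 10) (Assign 9 (Reg 10))) Skip)) Skip)"

definition insert_copy :: com where
  "insert_copy = Seq (Cond (Bin Less (labE 1) (labE 0))
       (Seq (Assign 9 (Reg 1)) (Assign 10 (Reg 0))) (Seq (Assign 9 (Reg 0)) (Assign 10 (Reg 1))))
     (Seq (inc_copies 9 10) (Seq (Assign 16 (Num 1)) (Seq (While (Reg 16) push_step) absorb)))"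

definition pull_step :: com where
  "pull_step = Seq (Assign 10 (cell 0 (Reg 9) (Bin Add (labE 9) (Num 3)) (Num 0)))
     (Seq (flip_copy 10 9) (Assign 9 (Reg 10)))"

definition delete_copy :: com where
  "delete_copy = Seq (Cond (cell 3 (Reg 0) (Reg 1) (Num 0))
       (Seq (Assign 9 (Reg 0)) (Assign 10 (Reg 1))) (Seq (Assign 9 (Reg 1)) (Assign 10 (Reg 0))))
     (Seq (dec_copies 9 10)
     (Seq (While (cell 2 (Reg 9) (Bin Add (labE 9) (Num 3)) (Num 0)) pull_step) release))"

abbreviation scratch :: "nat set" where "scratch \<equiv> {9, 10, 11, 12, 13, 14, 15, 16}"

context machine
begin

lemma chainD:
  assumes "chain s j half x dg wt"
  shows "scale s j (sets half x (labels Cap dg)) x dg (count_full n Cap dg)" "balanced n x (labels Cap dg) wt"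
    "regs s 7 = half" "half < M" "wt u v < M"
  using assms by (auto simp: chain_def)

lemma chain_frame:
  assumes "chain s j half x dg wt" "scale s' j (sets half x (labels Cap dg)) x dg (count_full n Cap dg)"
    "frame R X s s' j" "7 \<notin> R"
  shows "chain s' j half x dg wt"
  using assms frame_reg[OF assms(3), of 7] by (simp add: chain_def)

lemma run_assign_chain:
  assumes "chain s j half x dg wt" "exp_val w e s = v" "i \<notin> {2, 3, 4, 5, 7}" "i \<in> R" "1 + exp_cost e \<le> K"
  shows "run j R X K (Assign i e) s (\<lambda>s'. chain s' j half x dg wt \<and> regs s' i = v \<and> frame {i} {} s s' j)"
proof (rule run_weaken[OF run_assign[OF chainD(1)[OF assms(1)] assms(2) _ assms(4) order_refl]])
  fix s' assume *: "scale s' j (sets half x (labels Cap dg)) x dg (count_full n Cap dg) \<and> regs s' i = v \<and> frame {i} {} s s' j"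
  then show "chain s' j half x dg wt \<and> regs s' i = v \<and> frame {i} {} s s' j"
    using chain_frame[OF assms(1), of s' "{i}" "{}"] assms(3) by auto
qed (use assms in auto)

lemma run_assign_pair:
  assumes c: "chain s j half x dg wt" and r: "regs s p = u" "regs s q = v" "p \<noteq> 9" "q \<noteq> 9" "p < 9" "q < 9"
  shows "run j scratch UNIV 10 (Seq (Assign 9 (Reg p)) (Assign 10 (Reg q))) s
    (\<lambda>s'. chain s' j half x dg wt \<and> regs s' 9 = u \<and> regs s' 10 = v)"
proof (rule run_Seq[OF run_assign_chain[OF c _ _ _ order_refl]])
  show "exp_val w (Reg p) s = u" using r scale_regs[OF chainD(1)[OF c]] by simp
  fix s1 assume *: "chain s1 j half x dg wt \<and> regs s1 9 = u \<and> frame {9} {} s s1 j"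
  then have c1: "chain s1 j half x dg wt" by blast
  have "regs s1 q = v" using * r frame_reg[of "{9}" "{}" s s1 j q] by simp
  then have v1: "exp_val w (Reg q) s1 = v" using scale_regs(1)[OF chainD(1)[OF c1]] by simp
  show "run j scratch UNIV 5 (Assign 10 (Reg q)) s1
    (\<lambda>s'. chain s' j half x dg wt \<and> regs s' 9 = u \<and> regs s' 10 = v)"
  proof (rule run_weaken[OF run_assign_chain[OF c1 v1 _ _ order_refl, of 10 scratch]])
    fix s2 assume "chain s2 j half x dg wt \<and> regs s2 10 = v \<and> frame {10} {} s1 s2 j"
    then show "chain s2 j half x dg wt \<and> regs s2 9 = u \<and> regs s2 10 = v"
      using * frame_reg[of "{10}" "{}" s1 s2 j 9] by simp
  qed auto
qed simp_all

text \<open>Reversing a copy from \<open>a\<close> to \<open>b\<close> takes the surplus away from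
  \<open>a\<close> and gives it to \<open>b\<close>. The recorded degrees \<open>dg\<close> and with
  them all labels remain unchanged, so the orientation stays balanced in the middle of the
  walk.\<close>

lemma run_push_step:
  assumes c: "chain s j half x dg wt" and a: "regs s 9 = a" "a < n" and dg: "outdeg n x = dg(a := Suc (dg a))"
  shows "run j {9, 10, 11, 14, 15, 16} UNIV (300 * Cap + 3000) push_step s (\<lambda>s'. \<exists>x' a'.
    chain s' j half x' dg wt \<and> regs s' 9 = a' \<and> a' < n \<and> outdeg n x' = dg(a' := Suc (dg a')) \<and>
    (regs s' 16 = 0 \<and> (Cap \<le> dg a' \<or> (\<forall>v. 0 < x' a' v \<longrightarrow> labels Cap dg a' \<le> labels Cap dg v)) \<or>
     regs s' 16 = 1 \<and> labels Cap dg a' < labels Cap dg a))" (is "run j ?R UNIV _ _ _ ?P")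
  unfolding push_step_def
proof (rule run_Seq[OF run_assign_chain[OF c _ _ _ order_refl]])
  fix s1 assume *: "chain s1 j half x dg wt \<and> regs s1 16 = 0 \<and> frame {16} {} s s1 j"
  then have c1: "chain s1 j half x dg wt" and z1: "regs s1 16 = 0" and f1: "frame {16} {} s s1 j" by auto
  note sc1 = chainD(1)[OF c1] and bal = chainD(2)[OF c1]
  have r1: "regs s1 9 = a" using frame_reg[OF f1] a by simp
  have cond: "exp_val w (Bin Less dgE (Reg 4)) s1 = of_bool (dg a < Cap)"
    using val_dgE[OF sc1 r1 a(2)] scale_regs[OF sc1] by simp
  show "run j ?R UNIV (300 * Cap + 2990) (Cond (Bin Less dgE (Reg 4))
     (Seq scan_out (Cond (Reg 16) (Seq (flip_copy 9 10) (Assign 9 (Reg 10))) Skip)) Skip) s1 ?P"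
  proof (rule run_Cond[where K = "300 * Cap + 2900"])
    assume "exp_val w (Bin Less dgE (Reg 4)) s1 = 0"
    then have "Cap \<le> dg a" by (simp only: cond) simp
    then show "run j ?R UNIV (300 * Cap + 2900) Skip s1 ?P"
      using c1 z1 r1 a dg by (intro run_Skip) auto
  next
    assume "exp_val w (Bin Less dgE (Reg 4)) s1 \<noteq> 0"
    then have lt: "dg a < Cap" by (simp only: cond) simp
    have N: "card {v. 0 < x a v} \<le> Cap" using card_out_le[OF bal, of a] dg lt by simp
    have S0: "sets half x (labels Cap dg) a 0 = {v. 0 < x a v}" by (simp add: sets_def)
    have xn: "0 < x u v \<Longrightarrow> u < n \<and> v < n" for u v using balancedD[OF bal] by blast
    show "run j ?R UNIV (300 * Cap + 2900) (Seq scan_out (Cond (Reg 16) (Seq (flip_copy 9 10) (Assign 9 (Reg 10))) Skip)) s1 ?P"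
    proof (rule run_Seq[OF run_weaken[OF run_scan_out[OF sc1 r1 a(2) S0 xn N z1]]])
      fix s' assume "scale s' j (sets half x (labels Cap dg)) x dg (count_full n Cap dg) \<and>
        (regs s' 16 = 0 \<and> (\<forall>v. 0 < x a v \<longrightarrow> labels Cap dg a \<le> labels Cap dg v) \<or>
         regs s' 16 = 1 \<and> 0 < x a (regs s' 10) \<and> labels Cap dg (regs s' 10) < labels Cap dg a)"
        "frame {10, 14, 15, 16} {} s1 s' j"
      then show "chain s' j half x dg wt \<and> regs s' 9 = a \<and>
        (regs s' 16 = 0 \<and> (\<forall>v. 0 < x a v \<longrightarrow> labels Cap dg a \<le> labels Cap dg v) \<or>
         regs s' 16 = 1 \<and> 0 < x a (regs s' 10) \<and> labels Cap dg (regs s' 10) < labels Cap dg a)"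
        using chain_frame[OF c1] frame_reg[of "{10, 14, 15, 16}" "{}" s1 s' j 9] r1 by auto
    next
      fix s2 assume *: "chain s2 j half x dg wt \<and> regs s2 9 = a \<and>
        (regs s2 16 = 0 \<and> (\<forall>v. 0 < x a v \<longrightarrow> labels Cap dg a \<le> labels Cap dg v) \<or>
         regs s2 16 = 1 \<and> 0 < x a (regs s2 10) \<and> labels Cap dg (regs s2 10) < labels Cap dg a)"
      then have c2: "chain s2 j half x dg wt" and r2: "regs s2 9 = a" by auto
      have e2: "exp_val w (Reg 16) s2 = regs s2 16" using scale_regs[OF chainD(1)[OF c2]] by simp
      show "run j ?R UNIV 2750 (Cond (Reg 16) (Seq (flip_copy 9 10) (Assign 9 (Reg 10))) Skip) s2 ?P"
      proof (rule run_Cond[where K = 2700])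
        assume "exp_val w (Reg 16) s2 = 0"
        then show "run j ?R UNIV 2700 Skip s2 ?P"
          using * a dg e2 by (intro run_Skip) auto
      next
        define b where "b = regs s2 10"
        assume "exp_val w (Reg 16) s2 \<noteq> 0"
        then have one: "regs s2 16 = 1" and pos: "0 < x a b" and l: "labels Cap dg b < labels Cap dg a"
          using * e2 by (auto simp: b_def)
        have ab: "a \<noteq> b" using l by auto
        have bn: "b < n" using xn[OF pos] by simp
        have od: "outdeg n (flip x a b) = dg(b := Suc (dg b))"
        proof
          fix y show "outdeg n (flip x a b) y = (dg(b := Suc (dg b))) y"
            using outdeg_flip[of a n b x y] a(2) bn pos ab dg by (auto split: if_splits)
        qed
        show "run j ?R UNIV 2700 (Seq (flip_copy 9 10) (Assign 9 (Reg 10))) s2 ?P"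
        proof (rule run_Seq[OF run_weaken[OF run_flip[OF c2 r2 b_def[symmetric] _ _ _ _ pos ab]]])
          fix s' assume "chain s' j half (flip x a b) dg wt" "frame {11} UNIV s2 s' j"
          then show "chain s' j half (flip x a b) dg wt \<and> regs s' 16 = 1 \<and> regs s' 10 = b"
            using frame_reg[of "{11}" UNIV s2 s' j] one b_def by simp
        next
          fix s3 assume *: "chain s3 j half (flip x a b) dg wt \<and> regs s3 16 = 1 \<and> regs s3 10 = b"
          then have c3: "chain s3 j half (flip x a b) dg wt" by blast
          have e3: "exp_val w (Reg 10) s3 = b" using * scale_regs[OF chainD(1)[OF c3]] by simp
          show "run j ?R UNIV 10 (Assign 9 (Reg 10)) s3 ?P"
          proof (rule run_weaken[OF run_assign_chain[OF c3 e3 _ _ order_refl, of 9 ?R]])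
            fix s4 assume **: "chain s4 j half (flip x a b) dg wt \<and> regs s4 9 = b \<and> frame {9} {} s3 s4 j"
            then have "regs s4 16 = 1" using * frame_reg[of "{9}" "{}" s3 s4 j 16] by simp
            then show "?P s4" using ** bn od l by blast
          qed auto
        qed (use l in auto)
      qed auto
    qed auto
  qed auto
qed (use c in auto)

text \<open>The new copy starts at the end with the smaller label, where it is balanced with respect
  to the old labels; only the surplus outdegree has to be placed. As labels strictly decrease along
  the walk, there are at most \<open>Suc Cap\<close> steps, each with one scan of at most
  \<open>Cap\<close> out-neighbours.\<close>

lemma run_insert_copy:
  assumes g: "good s j half wt" and u: "regs s 0 = u" "u < n" and v: "regs s 1 = v" "v < n"
    and uv: "u \<noteq> v" and wtM: "Suc (wt u v) < M" and sym: "wt v u = wt u v"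
  shows "run j scratch UNIV (6000 * (Suc Cap * Suc Cap)) insert_copy s
    (\<lambda>s'. good s' j half (shift_wt wt u v (Suc (wt u v))))"
proof -
  from g obtain x where c: "chain s j half x (outdeg n x) wt" by (auto simp: good_def)
  define dg where "dg = outdeg n x"
  let ?wt = "shift_wt wt u v (Suc (wt u v))"
  have c: "chain s j half x dg wt" using c dg_def by simp
  note sc = chainD(1)[OF c]
  have lab: "exp_val w (Bin Less (labE 1) (labE 0)) s = of_bool (labels Cap dg v < labels Cap dg u)"
    using val_lab[OF sc, of 1] val_lab[OF sc, of 0] u v by (simp add: labels_def)
  define Q where "Q s1 \<longleftrightarrow> (\<exists>a b. {a, b} = {u, v} \<and> regs s1 9 = a \<and> regs s1 10 = b \<and> chain s1 j half x dg wt \<and>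
    labels Cap dg a \<le> labels Cap dg b)" for s1
  define I where "I s1 \<longleftrightarrow> (\<exists>x a. chain s1 j half x dg ?wt \<and> regs s1 9 = a \<and> a < n \<and> outdeg n x = dg(a := Suc (dg a)) \<and>
    (regs s1 16 = 0 \<and> (Cap \<le> dg a \<or> (\<forall>v. 0 < x a v \<longrightarrow> labels Cap dg a \<le> labels Cap dg v)) \<or> regs s1 16 = 1))" for s1
  \<comment> \<open>The successor is taken so that the last step, which only clears register
    \<open>16\<close> without moving, also lowers the measure.\<close>
  define \<mu> where "\<mu> (s1 :: ram) = (if regs s1 16 = 0 then 0 else Suc (labels Cap dg (regs s1 9)))" for s1
  show ?thesis
    unfolding insert_copy_def
  proof (rule run_Seq[where K = 200 and P = Q and K' = "5000 * (Suc Cap * Suc Cap)"], rule run_Cond[where K = 10])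
    assume "exp_val w (Bin Less (labE 1) (labE 0)) s \<noteq> 0"
    then have lt: "labels Cap dg v < labels Cap dg u" by (simp only: lab) simp
    show "run j scratch UNIV 10 (Seq (Assign 9 (Reg 1)) (Assign 10 (Reg 0))) s Q"
      by (rule run_weaken[OF run_assign_pair[OF c v(1) u(1)]]) (use lt in \<open>auto simp: Q_def\<close>)
  next
    assume "exp_val w (Bin Less (labE 1) (labE 0)) s = 0"
    then have lt: "labels Cap dg u \<le> labels Cap dg v" by (simp only: lab) simp
    show "run j scratch UNIV 10 (Seq (Assign 9 (Reg 0)) (Assign 10 (Reg 1))) s Q"
      by (rule run_weaken[OF run_assign_pair[OF c u(1) v(1)]]) (use lt in \<open>auto simp: Q_def\<close>)
  next
    fix s1 assume "Q s1"
    then obtain a b where ab: "{a, b} = {u, v}" "regs s1 9 = a" "regs s1 10 = b"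
      and c1: "chain s1 j half x dg wt" and l: "labels Cap dg a \<le> labels Cap dg b" by (auto simp: Q_def)
    have an: "a < n" "b < n" "a \<noteq> b" and wtab: "wt a b = wt u v" and sh: "shift_wt wt a b k = shift_wt wt u v k" for k
      using ab(1) u v uv sym by (auto simp: doubleton_eq_iff shift_wt_commute)
    note bal1 = chainD(2)[OF c1]
    have xM: "x a b < M" using balanced_bound[OF bal1, of a b] wtM wtab by simp
    have wtM': "?wt p q < M" for p q
      using chainD(5)[OF c1, of p q] wtM by (auto simp: shift_wt_def bump_def)
    let ?x = "bump x a b (Suc (x a b))"
    have bal2: "balanced n ?x (labels Cap dg) ?wt"
      using balanced_inc[OF bal1 an l] wtab sh by simp
    have od2: "outdeg n ?x = dg(a := Suc (dg a))"
    proof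
      fix y show "outdeg n ?x y = (dg(a := Suc (dg a))) y"
        using outdeg_bump[OF an(2), of x a "Suc (x a b)" y] by (auto simp: dg_def split: if_splits)
    qed
    have la: "labels Cap dg a = min (dg a) Cap" by (simp add: labels_def)
    show "run j scratch UNIV (5000 * (Suc Cap * Suc Cap))
      (Seq (inc_copies 9 10) (Seq (Assign 16 (Num 1)) (Seq (While (Reg 16) push_step) absorb))) s1
      (\<lambda>s'. good s' j half ?wt)"
    proof (rule run_Seq[OF run_weaken[where K' = 1000, OF run_inc_copies[OF chainD(1,3,4)[OF c1] ab(2) an(1) ab(3) an(2) la refl xM]]])
      fix s' assume sc': "scale s' j (sets half ?x (labels Cap dg)) ?x dg (count_full n Cap dg)" and f: "frame {11} UNIV s1 s' j"
      have "regs s' 7 = half" "regs s' 9 = a" using frame_reg[OF f] chainD(3)[OF c1] ab by simp_all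
      then show "chain s' j half ?x dg ?wt \<and> regs s' 9 = a"
        using sc' bal2 wtM' chainD(4)[OF c1] by (simp add: chain_def)
    next
      fix s2 assume s2: "chain s2 j half ?x dg ?wt \<and> regs s2 9 = a"
      then have c2: "chain s2 j half ?x dg ?wt" by blast
      show "run j scratch UNIV (4000 * (Suc Cap * Suc Cap)) (Seq (Assign 16 (Num 1)) (Seq (While (Reg 16) push_step) absorb)) s2
        (\<lambda>s'. good s' j half ?wt)"
      proof (rule run_Seq[OF run_assign_chain[OF c2 _ _ _ order_refl]])
        fix s3 assume *: "chain s3 j half ?x dg ?wt \<and> regs s3 16 = 1 \<and> frame {16} {} s2 s3 j"
        have r3: "regs s3 9 = a" using * s2 frame_reg[of "{16}" "{}" s2 s3 j 9] by simp
        show "run j scratch UNIV (3900 * (Suc Cap * Suc Cap)) (Seq (While (Reg 16) push_step) absorb) s3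
          (\<lambda>s'. good s' j half ?wt)"
        proof (rule run_Seq[where K = "3100 * (Suc Cap * Suc Cap)" and K' = "700 * Cap + 1000" and P = "\<lambda>s'. I s' \<and> regs s' 16 = 0"])
          show "run j scratch UNIV (3100 * (Suc Cap * Suc Cap)) (While (Reg 16) push_step) s3 (\<lambda>s'. I s' \<and> regs s' 16 = 0)"
          proof (rule run_For[where I = I and \<mu> = \<mu> and B = "300 * Cap + 3000"])
            show "I s3" unfolding I_def using * r3 an od2 by blast
            fix s4 assume "I s4"
            then obtain x a where c4: "chain s4 j half x dg ?wt" and a: "regs s4 9 = a" "a < n"
              and od: "outdeg n x = dg(a := Suc (dg a))" by (auto simp: I_def)
            have e: "exp_val w (Reg 16) s4 = regs s4 16" using scale_regs[OF chainD(1)[OF c4]] by simp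
            show "exp_val w (Reg 16) s4 = 0 \<Longrightarrow> I s4 \<and> regs s4 16 = 0" using e \<open>I s4\<close> by simp
            assume nz: "exp_val w (Reg 16) s4 \<noteq> 0"
            show "run j scratch UNIV (300 * Cap + 3000) push_step s4 (\<lambda>s'. I s' \<and> \<mu> s' < \<mu> s4)"
            proof (rule run_weaken[OF run_push_step[OF c4 a od]])
              fix s' assume "\<exists>x' a'. chain s' j half x' dg ?wt \<and> regs s' 9 = a' \<and> a' < n \<and> outdeg n x' = dg(a' := Suc (dg a')) \<and>
                (regs s' 16 = 0 \<and> (Cap \<le> dg a' \<or> (\<forall>v. 0 < x' a' v \<longrightarrow> labels Cap dg a' \<le> labels Cap dg v)) \<or>
                 regs s' 16 = 1 \<and> labels Cap dg a' < labels Cap dg a)"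
              then obtain x' a' where *: "chain s' j half x' dg ?wt" "regs s' 9 = a'" "a' < n" "outdeg n x' = dg(a' := Suc (dg a'))"
                "regs s' 16 = 0 \<and> (Cap \<le> dg a' \<or> (\<forall>v. 0 < x' a' v \<longrightarrow> labels Cap dg a' \<le> labels Cap dg v)) \<or>
                 regs s' 16 = 1 \<and> labels Cap dg a' < labels Cap dg a" by blast
              have "I s'" unfolding I_def using * by blast
              moreover have "\<mu> s' < \<mu> s4" using * nz e a by (auto simp: \<mu>_def)
              ultimately show "I s' \<and> \<mu> s' < \<mu> s4" ..
            qed auto
          next
            have "\<mu> s3 \<le> Suc Cap" by (simp add: \<mu>_def labels_def)
            then have "(1 + exp_cost (Reg 16) + (300 * Cap + 3000)) * \<mu> s3 \<le> (3002 * Suc Cap) * Suc Cap"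
              by (intro mult_le_mono) auto
            moreover have "Suc Cap \<le> Suc Cap * Suc Cap" by simp
            ultimately show "(1 + exp_cost (Reg 16) + (300 * Cap + 3000)) * \<mu> s3 + 1 + exp_cost (Reg 16) \<le> 3100 * (Suc Cap * Suc Cap)"
              by (simp add: algebra_simps)
          qed
          fix s4 assume "I s4 \<and> regs s4 16 = 0"
          then obtain x a where c4: "chain s4 j half x dg ?wt" and a: "regs s4 9 = a" "a < n"
              and od: "outdeg n x = dg(a := Suc (dg a))"
              and wf_state: "Cap \<le> dg a \<or> (\<forall>v. 0 < x a v \<longrightarrow> labels Cap dg a \<le> labels Cap dg v)" by (auto simp: I_def)
          show "run j scratch UNIV (700 * Cap + 1000) absorb s4 (\<lambda>s'. good s' j half ?wt)"
            by (rule run_weaken[OF run_absorb[OF c4 a od wf_state]]) auto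
        next
          show "3100 * (Suc Cap * Suc Cap) + (700 * Cap + 1000) \<le> 3900 * (Suc Cap * Suc Cap)"
            by (simp add: algebra_simps) (use Cap_def Lpos in simp)
        qed
      qed simp_all
    qed simp_all
  qed (use Cap_def Lpos in simp_all)
qed

text \<open>Reversing a copy from an in-neighbour \<open>b\<close> repairs the deficit of
  \<open>a\<close> and passes it on to \<open>b\<close>. That \<open>dg b\<close> is positive must
  be carried along, for otherwise the truncated subtraction \<open>dg b - 1\<close> would not
  describe a deficit.\<close>

lemma run_pull_step:
  assumes c: "chain s j half x dg wt" and a: "regs s 9 = a" "a < n" and dg: "outdeg n x = dg(a := dg a - 1)" "0 < dg a"
    and ne: "{v. 0 < x v a \<and> labels Cap dg v = Suc (labels Cap dg a)} \<noteq> {}"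
  shows "run j {9, 10, 11} UNIV 2700 pull_step s (\<lambda>s'. \<exists>x' a'.
    chain s' j half x' dg wt \<and> regs s' 9 = a' \<and> a' < n \<and> outdeg n x' = dg(a' := dg a' - 1) \<and> 0 < dg a' \<and>
    labels Cap dg a' = Suc (labels Cap dg a))" (is "run j ?R UNIV _ _ _ ?P")
proof -
  note sc = chainD(1)[OF c] and bal = chainD(2)[OF c]
  \<comment> \<open>Bucket indices are labels plus \<open>2\<close>; hence \<open>3\<close> selects
    the in-neighbours whose label is larger by exactly one.\<close>
  let ?S = "sets half x (labels Cap dg)" and ?t = "labels Cap dg a + 3"
  have S: "?S a ?t = {v. 0 < x v a \<and> labels Cap dg v = Suc (labels Cap dg a)}" by (auto simp: sets_def)
  have tM: "?t < M" using MCap by (simp add: labels_def)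
  have t: "exp_val w (Bin Add (labE 9) (Num 3)) s = ?t"
    using val_lab[OF sc, of 9] a small_sums by (simp add: labels_def)
  have cpos: "0 < card (?S a ?t)" using ne S scale_sets(2)[OF sc a(2) tM] by (simp add: card_gt_0_iff)
  define b where "b = view M (mem s) j (0, a, ?t, 0)"
  have e9: "exp_val w (Reg 9) s = a" "exp_val w (Num 0) s = 0" using a scale_regs[OF sc] by simp_all
  note el = val_elem[OF sc e9(1) t e9(2) a(2) tM cpos]
  have pos: "0 < x b a" and l: "labels Cap dg b = Suc (labels Cap dg a)" using el(2) S b_def by auto
  have ab: "b \<noteq> a" using l by auto
  have bn: "b < n" using balancedD[OF bal pos] by simp
  have "x b a \<le> outdeg n x b" unfolding outdeg_def using a(2) by (intro member_le_sum) auto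
  then have db: "0 < dg b" using pos dg ab by simp
  have od: "outdeg n (flip x b a) = dg(b := dg b - 1)"
  proof
    fix y show "outdeg n (flip x b a) y = (dg(b := dg b - 1)) y"
      using outdeg_flip[of b n a x y] a(2) bn pos ab dg db by (auto split: if_splits)
  qed
  show ?thesis unfolding pull_step_def
  proof (rule run_Seq[OF run_assign_chain[OF c el(1)[folded b_def] _ _ order_refl]])
    fix s1 assume *: "chain s1 j half x dg wt \<and> regs s1 10 = b \<and> frame {10} {} s s1 j"
    then have c1: "chain s1 j half x dg wt" and r1: "regs s1 10 = b" "regs s1 9 = a"
      using frame_reg[of "{10}" "{}" s s1 j 9] a by auto
    show "run j ?R UNIV 2600 (Seq (flip_copy 10 9) (Assign 9 (Reg 10))) s1 ?P"
    proof (rule run_Seq[OF run_weaken[OF run_flip[OF c1 r1 _ _ _ _ pos ab]]])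
      fix s' assume "chain s' j half (flip x b a) dg wt" "frame {11} UNIV s1 s' j"
      then show "chain s' j half (flip x b a) dg wt \<and> regs s' 10 = b"
        using frame_reg[of "{11}" UNIV s1 s' j] r1 by simp
    next
      fix s3 assume *: "chain s3 j half (flip x b a) dg wt \<and> regs s3 10 = b"
      then have c3: "chain s3 j half (flip x b a) dg wt" by blast
      have e3: "exp_val w (Reg 10) s3 = b" using * scale_regs[OF chainD(1)[OF c3]] by simp
      show "run j ?R UNIV 10 (Assign 9 (Reg 10)) s3 ?P"
        by (rule run_weaken[OF run_assign_chain[OF c3 e3 _ _ order_refl, of 9 ?R]]) (use bn od db l in auto)
    qed (use l in auto)
  qed auto
qed

lemma run_delete_copy:
  assumes g: "good s j half wt" and u: "regs s 0 = u" "u < n" and v: "regs s 1 = v" "v < n"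
    and uv: "u \<noteq> v" and wtM: "0 < wt u v" and sym: "wt v u = wt u v"
  shows "run j scratch UNIV (6000 * (Suc Cap * Suc Cap)) delete_copy s
    (\<lambda>s'. good s' j half (shift_wt wt u v (wt u v - 1)))"
proof -
  from g obtain x where c: "chain s j half x (outdeg n x) wt" by (auto simp: good_def)
  define dg where "dg = outdeg n x"
  let ?wt = "shift_wt wt u v (wt u v - 1)"
  have c: "chain s j half x dg wt" using c dg_def by simp
  note sc = chainD(1)[OF c]
  have xuv: "exp_val w (cell 3 (Reg 0) (Reg 1) (Num 0)) s = x u v"
    using val_x[OF sc, of "Reg 0" "Reg 1"] u v scale_regs[OF sc] by simp
  define Q where "Q s1 \<longleftrightarrow> (\<exists>a b. {a, b} = {u, v} \<and> regs s1 9 = a \<and> regs s1 10 = b \<and> chain s1 j half x dg wt \<and> 0 < x a b)" for s1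
  define I where "I s1 \<longleftrightarrow> (\<exists>x a. chain s1 j half x dg ?wt \<and> regs s1 9 = a \<and> a < n \<and> outdeg n x = dg(a := dg a - 1) \<and>
    0 < dg a)" for s1
  \<comment> \<open>Each step of the walk raises the label by one, and truncation ends this at
    \<open>Cap\<close>.\<close>
  define \<mu> where "\<mu> (s1 :: ram) = Cap - labels Cap dg (regs s1 9)" for s1
  let ?e = "cell 2 (Reg 9) (Bin Add (labE 9) (Num 3)) (Num 0)"
  have e: "exp_val w ?e s1 = card {v. 0 < x v a \<and> labels Cap dg v = Suc (labels Cap dg a)}"
    "finite {v. 0 < x v a \<and> labels Cap dg v = Suc (labels Cap dg a)}"
    if "chain s1 j half x dg wt'" "regs s1 9 = a" "a < n" for s1 x a wt'
  proof -
    note sc1 = chainD(1)[OF that(1)]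
    have S: "sets half x (labels Cap dg) a (labels Cap dg a + 3) =
      {v. 0 < x v a \<and> labels Cap dg v = Suc (labels Cap dg a)}" by (auto simp: sets_def)
    have tM: "labels Cap dg a + 3 < M" using MCap by (simp add: labels_def)
    have t: "exp_val w (Bin Add (labE 9) (Num 3)) s1 = labels Cap dg a + 3"
      using val_lab[OF sc1, of 9] that(2,3) small_sums by (simp add: labels_def)
    show "exp_val w ?e s1 = card {v. 0 < x v a \<and> labels Cap dg v = Suc (labels Cap dg a)}"
      using val_card[OF sc1, of "Reg 9" "Bin Add (labE 9) (Num 3)"] that(2,3) t tM S scale_regs[OF sc1] by simp
    show "finite {v. 0 < x v a \<and> labels Cap dg v = Suc (labels Cap dg a)}"
      using scale_sets(2)[OF sc1 that(3) tM] S by simp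
  qed
  show ?thesis
    unfolding delete_copy_def
  proof (rule run_Seq[where K = 200 and P = Q and K' = "5000 * (Suc Cap * Suc Cap)"], rule run_Cond[where K = 10])
    assume "exp_val w (cell 3 (Reg 0) (Reg 1) (Num 0)) s \<noteq> 0"
    then have lt: "0 < x u v" using xuv by simp
    show "run j scratch UNIV 10 (Seq (Assign 9 (Reg 0)) (Assign 10 (Reg 1))) s Q"
      by (rule run_weaken[OF run_assign_pair[OF c u(1) v(1)]]) (use lt in \<open>auto simp: Q_def\<close>)
  next
    assume "exp_val w (cell 3 (Reg 0) (Reg 1) (Num 0)) s = 0"
    then have lt: "0 < x v u" using xuv balanced_sum[OF chainD(2)[OF c], of u v] wtM by simp
    show "run j scratch UNIV 10 (Seq (Assign 9 (Reg 1)) (Assign 10 (Reg 0))) s Q"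
      by (rule run_weaken[OF run_assign_pair[OF c v(1) u(1)]]) (use lt in \<open>auto simp: Q_def\<close>)
  next
    fix s1 assume "Q s1"
    then obtain a b where ab: "{a, b} = {u, v}" "regs s1 9 = a" "regs s1 10 = b"
      and c1: "chain s1 j half x dg wt" and l: "0 < x a b" by (auto simp: Q_def)
    have an: "a < n" "b < n" "a \<noteq> b" and wtab: "wt a b = wt u v" and sh: "shift_wt wt a b k = shift_wt wt u v k" for k
      using ab(1) u v uv sym by (auto simp: doubleton_eq_iff shift_wt_commute)
    note bal1 = chainD(2)[OF c1]
    define m where "m = x a b - 1"
    have m: "x a b = Suc m" using l by (simp add: m_def)
    have mM: "m < M" using balanced_bound[OF bal1, of a b] chainD(5)[OF c1, of a b] m by simp
    have wtM': "?wt p q < M" for p q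
      using chainD(5)[OF c1, of p q] chainD(5)[OF c1, of u v] by (auto simp: shift_wt_def bump_def)
    let ?x = "bump x a b m"
    have bal2: "balanced n ?x (labels Cap dg) ?wt"
      using balanced_dec[OF bal1 m an(3)] wtab sh by simp
    have "x a b \<le> outdeg n x a" unfolding outdeg_def using an(2) by (intro member_le_sum) auto
    then have dpos: "0 < dg a" using l by (simp add: dg_def)
    have od2: "outdeg n ?x = dg(a := dg a - 1)"
    proof
      fix y show "outdeg n ?x y = (dg(a := dg a - 1)) y"
        using outdeg_bump[OF an(2), of x a m y] m by (auto simp: dg_def split: if_splits)
    qed
    have la: "labels Cap dg a = min (dg a) Cap" by (simp add: labels_def)
    show "run j scratch UNIV (5000 * (Suc Cap * Suc Cap))
      (Seq (dec_copies 9 10) (Seq (While ?e pull_step) release)) s1 (\<lambda>s'. good s' j half ?wt)"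
    proof (rule run_Seq[OF run_weaken[where K' = 1500, OF run_dec_copies[OF chainD(1,3,4)[OF c1] ab(2) an(1) ab(3) an(2) la m mM]]])
      fix s' assume sc': "scale s' j (sets half ?x (labels Cap dg)) ?x dg (count_full n Cap dg)" and f: "frame {11} UNIV s1 s' j"
      have "regs s' 7 = half" "regs s' 9 = a" using frame_reg[OF f] chainD(3)[OF c1] ab by simp_all
      then show "chain s' j half ?x dg ?wt \<and> regs s' 9 = a"
        using sc' bal2 wtM' chainD(4)[OF c1] by (simp add: chain_def)
    next
      fix s2 assume s2: "chain s2 j half ?x dg ?wt \<and> regs s2 9 = a"
      show "run j scratch UNIV (3900 * (Suc Cap * Suc Cap)) (Seq (While ?e pull_step) release) s2
          (\<lambda>s'. good s' j half ?wt)"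
      proof (rule run_Seq[where K = "3100 * (Suc Cap * Suc Cap)" and K' = "700 * Cap + 1000" and P = "\<lambda>s'. I s' \<and> exp_val w ?e s' = 0"])
        show "run j scratch UNIV (3100 * (Suc Cap * Suc Cap)) (While ?e pull_step) s2 (\<lambda>s'. I s' \<and> exp_val w ?e s' = 0)"
        proof (rule run_For[where I = I and \<mu> = \<mu> and B = 2700])
          show "I s2" unfolding I_def using s2 an od2 dpos by blast
          fix s4 assume "I s4"
          then obtain x a where c4: "chain s4 j half x dg ?wt" and a: "regs s4 9 = a" "a < n"
            and od: "outdeg n x = dg(a := dg a - 1)" "0 < dg a" by (auto simp: I_def)
          show "exp_val w ?e s4 = 0 \<Longrightarrow> I s4 \<and> exp_val w ?e s4 = 0" using \<open>I s4\<close> by simp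
          assume nz: "exp_val w ?e s4 \<noteq> 0"
          then have ne: "{v. 0 < x v a \<and> labels Cap dg v = Suc (labels Cap dg a)} \<noteq> {}"
            unfolding e(1)[OF c4 a] by fastforce
          show "run j scratch UNIV 2700 pull_step s4 (\<lambda>s'. I s' \<and> \<mu> s' < \<mu> s4)"
          proof (rule run_weaken[OF run_pull_step[OF c4 a od ne]])
            fix s' assume "\<exists>x' a'. chain s' j half x' dg ?wt \<and> regs s' 9 = a' \<and> a' < n \<and>
              outdeg n x' = dg(a' := dg a' - 1) \<and> 0 < dg a' \<and> labels Cap dg a' = Suc (labels Cap dg a)"
            then obtain x' a' where *: "chain s' j half x' dg ?wt" "regs s' 9 = a'" "a' < n"
              "outdeg n x' = dg(a' := dg a' - 1)" "0 < dg a'" "labels Cap dg a' = Suc (labels Cap dg a)" by blast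
            have "I s'" unfolding I_def using * by blast
            moreover have "labels Cap dg a' \<le> Cap" by (simp add: labels_def)
            then have "\<mu> s' < \<mu> s4" using * a by (simp add: \<mu>_def)
            ultimately show "I s' \<and> \<mu> s' < \<mu> s4" ..
          qed auto
        next
          have "\<mu> s2 \<le> Suc Cap" by (simp add: \<mu>_def)
          then have "(1 + exp_cost ?e + 2700) * \<mu> s2 \<le> (2800 * Suc Cap) * Suc Cap"
            by (intro mult_le_mono) auto
          moreover have "Suc Cap \<le> Suc Cap * Suc Cap" by simp
          ultimately show "(1 + exp_cost ?e + 2700) * \<mu> s2 + 1 + exp_cost ?e \<le> 3100 * (Suc Cap * Suc Cap)"
            by (simp add: algebra_simps)
        qed
        fix s4 assume *: "I s4 \<and> exp_val w ?e s4 = 0"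
        then obtain x a where c4: "chain s4 j half x dg ?wt" and a: "regs s4 9 = a" "a < n"
            and od: "outdeg n x = dg(a := dg a - 1)" "0 < dg a" by (auto simp: I_def)
        have "{v. 0 < x v a \<and> labels Cap dg v = Suc (labels Cap dg a)} = {}"
          using e[OF c4 a] * by simp
        then have "labels Cap dg v \<noteq> Suc (labels Cap dg a)" if "0 < x v a" for v
          using that by blast
        \<comment> \<open>Balance already excludes in-neighbours whose label exceeds that of
          \<open>a\<close> by two or more. An empty bucket for label plus one therefore certifies
          that no in-neighbour has a larger label, although only one bucket was inspected.\<close>
        then have wf_state: "labels Cap dg v \<le> labels Cap dg a" if "0 < x v a" for v
          using balancedD(3)[OF chainD(2)[OF c4] that] that by (metis le_antisym not_less_eq_eq)
        show "run j scratch UNIV (700 * Cap + 1000) release s4 (\<lambda>s'. good s' j half ?wt)"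
          by (rule run_weaken[OF run_release[OF c4 a od wf_state]]) auto
      next
        show "3100 * (Suc Cap * Suc Cap) + (700 * Cap + 1000) \<le> 3900 * (Suc Cap * Suc Cap)"
          by (simp add: algebra_simps) (use Cap_def Lpos in simp)
      qed
    qed (use Cap_def Lpos in simp_all)
  qed (use Cap_def Lpos in simp_all)
qed

end

section \<open>Updates at all scales\<close>

text \<open>
  Register \<open>6\<close> holds \<open>2 ^ j\<close>, register \<open>7\<close> holds \<open>L div 2 ^ j\<close>, and register \<open>8\<close> counts the remaining
  copies, whose number is odd so that every edge has a majority direction.
\<close>

definition update :: "com \<Rightarrow> com" where
  "update c = Seq (Assign 5 (Num 0)) (Seq (Assign 6 (Num 1)) (While (Bin Less (Reg 6) (Bin Add (Reg 3) (Num 1)))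
    (Seq (Assign 7 (Bin Div (Reg 3) (Reg 6)))
    (Seq (Assign 8 (Bin Add (Bin Mul (Num 2) (Reg 7)) (Num 1)))
    (Seq (While (Reg 8) (Seq c (Assign 8 (Bin Sub (Reg 8) (Num 1)))))
    (Seq (Assign 6 (Bin Mul (Num 2) (Reg 6))) (Assign 5 (Bin Add (Reg 5) (Num 1)))))))))"

lemma shift_wt_same: "shift_wt wt u v k u v = k" "shift_wt wt u v k v u = k"
  by (auto simp: shift_wt_def bump_def)

lemma shift_wt_shift: "shift_wt (shift_wt wt u v k) u v k' = shift_wt wt u v k'"
  by (auto simp: shift_wt_def bump_def fun_eq_iff)

lemma edge_weight_insert: "{u, v} \<notin> E \<Longrightarrow> shift_wt (edge_weight E B) u v B = edge_weight (insert {u, v} E) B"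
  by (auto simp: shift_wt_def bump_def edge_weight_def fun_eq_iff doubleton_eq_iff insert_commute)

lemma edge_weight_delete: "shift_wt (edge_weight E B) u v 0 = edge_weight (E - {{u, v}}) B"
  by (auto simp: shift_wt_def bump_def edge_weight_def fun_eq_iff doubleton_eq_iff insert_commute)

lemma edge_weight_in: "{u, v} \<in> E \<Longrightarrow> shift_wt (edge_weight E B) u v B = edge_weight E B"
  by (auto simp: shift_wt_def bump_def edge_weight_def fun_eq_iff doubleton_eq_iff insert_commute)

lemma edge_weight_notin: "{u, v} \<notin> E \<Longrightarrow> shift_wt (edge_weight E B) u v 0 = edge_weight E B"
  by (auto simp: shift_wt_def bump_def edge_weight_def fun_eq_iff doubleton_eq_iff insert_commute)

context machine
begin

abbreviation "halfs j \<equiv> L div 2 ^ j"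
abbreviation "copies j \<equiv> 2 * (L div 2 ^ j) + 1"

text \<open>Registers \<open>5\<close> and \<open>7\<close> hold the parameters of whichever scale
  is being processed. To state the invariant of an arbitrary scale, they are hypothetically replaced
  by its own values.\<close>

definition good_at where
  "good_at s j wt \<longleftrightarrow> good (s\<lparr>regs := (regs s)(5 := j, 7 := halfs j)\<rparr>) j (halfs j) wt"

lemma good_cong:
  assumes "good s j half wt" "wf_state s'" "regs s' 5 = j" "regs s' 7 = half" "view M (mem s') j = view M (mem s) j"
  shows "good s' j half wt"
  using assms unfolding good_def chain_def scale_def by auto

lemma good_at_iff:
  assumes "wf_state s" "regs s 5 = j" "regs s 7 = halfs j"
  shows "good_at s j wt \<longleftrightarrow> good s j (halfs j) wt"
proof -
  have "s\<lparr>regs := (regs s)(5 := j, 7 := halfs j)\<rparr> = s" using assms by (simp add: fun_upd_idem)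
  then show ?thesis by (simp add: good_at_def)
qed

lemma good_at_cong:
  assumes "good_at s j wt" "wf_state s'" "view M (mem s') j = view M (mem s) j"
  shows "good_at s' j wt"
  unfolding good_at_def
proof (rule good_cong[OF assms(1)[unfolded good_at_def]])
  from assms(1) have "j < M" by (auto simp: good_at_def good_def chain_def scale_def)
  moreover have "halfs j < W" using LM M_W div_le_dividend[of L "2 ^ j"] by linarith
  ultimately show "wf_state (s'\<lparr>regs := (regs s')(5 := j, 7 := halfs j)\<rparr>)"
    using assms(2) M_W by (simp add: wf_state_def)
qed (use assms(3) in simp_all)

lemma good_wf_state: "good s j half wt \<Longrightarrow> wf_state s \<and> regs s 5 = j \<and> regs s 7 = half \<and> j < M"
  by (auto simp: good_def chain_def scale_def)

lemma halfs_le: "halfs j \<le> L"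
  by (rule div_le_dividend)

lemma pow_Suc_le: "2 ^ j \<le> L \<Longrightarrow> j < L"
  using less_exp[of j] by linarith

lemma run_assign_good:
  assumes "good s j half wt" "exp_val w e s = v" "i \<notin> {2, 3, 4, 5, 7}" "i \<in> R" "1 + exp_cost e \<le> K"
  shows "run j R X K (Assign i e) s (\<lambda>s'. good s' j half wt \<and> regs s' i = v \<and> frame {i} {} s s' j)"
proof -
  obtain x where c: "chain s j half x (outdeg n x) wt" using assms(1) by (auto simp: good_def)
  show ?thesis
    by (rule run_weaken[OF run_assign_chain[OF c assms(2-5)]]) (auto simp: good_def)
qed

definition unit_cost :: nat where
  "unit_cost = 6000 * (Suc Cap * Suc Cap) + 20"

text \<open>\<open>g i\<close> is the weight of the pair while register \<open>8\<close> still
  counts \<open>i\<close> rounds. The same loop then covers insertion, with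
  \<open>g i = 2 * half + 1 - i\<close>, and deletion, with \<open>g i = i\<close>.\<close>

lemma run_copies:
  assumes step: "\<And>s wt i. good s j half (shift_wt wt u v (g (Suc i))) \<Longrightarrow> regs s 0 = u \<Longrightarrow> regs s 1 = v \<Longrightarrow>
      i < 2 * half + 1 \<Longrightarrow>
      run j scratch UNIV (6000 * (Suc Cap * Suc Cap)) c s (\<lambda>s'. good s' j half (shift_wt wt u v (g i)))"
    and g: "good s j half (shift_wt wt u v (g (2 * half + 1)))" and r: "regs s 0 = u" "regs s 1 = v" "regs s 8 = 2 * half + 1"
  shows "run j (insert 8 scratch) UNIV (unit_cost * (2 * half + 1) + 10)
    (While (Reg 8) (Seq c (Assign 8 (Bin Sub (Reg 8) (Num 1))))) s (\<lambda>s'. good s' j half (shift_wt wt u v (g 0)))"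
proof (rule run_For[where I = "\<lambda>s. good s j half (shift_wt wt u v (g (regs s 8))) \<and> regs s 0 = u \<and> regs s 1 = v \<and>
      regs s 8 \<le> 2 * half + 1" and \<mu> = "\<lambda>s. regs s 8" and B = "6000 * (Suc Cap * Suc Cap) + 10"])
  fix s1 assume I: "good s1 j half (shift_wt wt u v (g (regs s1 8))) \<and> regs s1 0 = u \<and> regs s1 1 = v \<and> regs s1 8 \<le> 2 * half + 1"
  then have bd: "bdd W (regs s1)" using good_wf_state unfolding wf_state_def by blast
  then have e: "exp_val w (Reg 8) s1 = regs s1 8" by simp
  show "exp_val w (Reg 8) s1 = 0 \<Longrightarrow> good s1 j half (shift_wt wt u v (g 0))" using e I by simp
  assume "exp_val w (Reg 8) s1 \<noteq> 0"
  then obtain i where i: "regs s1 8 = Suc i" using e by (cases "regs s1 8") auto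
  show "run j (insert 8 scratch) UNIV (6000 * (Suc Cap * Suc Cap) + 10) (Seq c (Assign 8 (Bin Sub (Reg 8) (Num 1)))) s1
    (\<lambda>s'. (good s' j half (shift_wt wt u v (g (regs s' 8))) \<and> regs s' 0 = u \<and> regs s' 1 = v \<and> regs s' 8 \<le> 2 * half + 1) \<and>
      regs s' 8 < regs s1 8)"
  proof (rule run_Seq[OF run_weaken[OF step[of s1 wt i]]])
    fix s' assume "good s' j half (shift_wt wt u v (g i))" "frame scratch UNIV s1 s' j"
    then show "good s' j half (shift_wt wt u v (g i)) \<and> regs s' 0 = u \<and> regs s' 1 = v \<and> regs s' 8 = Suc i"
      using frame_reg[of scratch UNIV s1 s' j] I i by simp
  next
    fix s2 assume *: "good s2 j half (shift_wt wt u v (g i)) \<and> regs s2 0 = u \<and> regs s2 1 = v \<and> regs s2 8 = Suc i"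
    then have g2: "good s2 j half (shift_wt wt u v (g i))" and bd: "bdd W (regs s2)" using good_wf_state unfolding wf_state_def by blast+
    have e2: "exp_val w (Bin Sub (Reg 8) (Num 1)) s2 = i" using * bd by (subst exp_val_Sub) simp_all
    show "run j (insert 8 scratch) UNIV 10 (Assign 8 (Bin Sub (Reg 8) (Num 1))) s2
     (\<lambda>s'. (good s' j half (shift_wt wt u v (g (regs s' 8))) \<and> regs s' 0 = u \<and> regs s' 1 = v \<and> regs s' 8 \<le> 2 * half + 1) \<and>
      regs s' 8 < regs s1 8)"
    proof (rule run_weaken[OF run_assign_good[OF g2 e2 _ _ order_refl, of 8 "insert 8 scratch"]])
      fix s3 assume "good s3 j half (shift_wt wt u v (g i)) \<and> regs s3 8 = i \<and> frame {8} {} s2 s3 j"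
      then show "(good s3 j half (shift_wt wt u v (g (regs s3 8))) \<and> regs s3 0 = u \<and> regs s3 1 = v \<and> regs s3 8 \<le> 2 * half + 1) \<and>
      regs s3 8 < regs s1 8"
        using * I i frame_reg[of "{8}" "{}" s2 s3 j] by simp
    qed auto
  qed (use I i in auto)
qed (use g r in \<open>auto simp: unit_cost_def algebra_simps\<close>)

lemma wp_update:
  assumes step: "\<And>j half s wt i. half \<le> L \<Longrightarrow> good s j half (shift_wt wt u v (g half (Suc i))) \<Longrightarrow> regs s 0 = u \<Longrightarrow>
      regs s 1 = v \<Longrightarrow> i < 2 * half + 1 \<Longrightarrow>
      run j scratch UNIV (6000 * (Suc Cap * Suc Cap)) c s (\<lambda>s'. good s' j half (shift_wt wt u v (g half i)))"
    and s: "wf_state s" and good: "\<And>j. 2 ^ j \<le> L \<Longrightarrow> good_at s j (shift_wt (wt j) u v (g (halfs j) (copies j)))"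
    and r: "regs s 0 = u" "regs s 1 = v"
  shows "wp w (update c) s (\<lambda>T s'. T \<le> 6 * (unit_cost + 100) * L + 50 \<and> wf_state s' \<and>
    (\<forall>j. 2 ^ j \<le> L \<longrightarrow> good_at s' j (shift_wt (wt j) u v (g (halfs j) 0))))"
proof -
  \<comment> \<open>Scale \<open>j\<close> handles \<open>copies j \<le> 3 * halfs j\<close> copies.
    Passing to the next scale at least halves \<open>L div 2 ^ j\<close>, so with the coefficient
    \<open>6\<close> the potential falls by at least three units of cost per \<open>halfs j\<close>.
    The geometric series thus keeps the total at O(\<open>L\<close>) copies, without a factor for
    the number of scales.\<close>
  define pot where "pot s = 6 * (unit_cost + 100) * (L div regs s 6)" for s :: ram
  define I where "I s \<longleftrightarrow> wf_state s \<and> regs s 0 = u \<and> regs s 1 = v \<and> (\<exists>j. regs s 5 = j \<and> regs s 6 = 2 ^ j \<and> 2 ^ j \<le> 2 * L \<and>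
    (\<forall>j'. 2 ^ j' \<le> L \<longrightarrow> good_at s j' (shift_wt (wt j') u v (g (halfs j') (if j' < j then 0 else copies j')))))" for s
  let ?e = "Bin Less (Reg 6) (Bin Add (Reg 3) (Num 1))"
  let ?body = "Seq (Assign 7 (Bin Div (Reg 3) (Reg 6)))
    (Seq (Assign 8 (Bin Add (Bin Mul (Num 2) (Reg 7)) (Num 1)))
    (Seq (While (Reg 8) (Seq c (Assign 8 (Bin Sub (Reg 8) (Num 1)))))
    (Seq (Assign 6 (Bin Mul (Num 2) (Reg 6))) (Assign 5 (Bin Add (Reg 5) (Num 1))))))"
  have cond: "exp_val w ?e s = of_bool (regs s 6 \<le> L)" if "I s" for s
    using that LM M_W by (simp add: I_def wf_state_def)
  have loop: "wp w (While ?e ?body) s1 (\<lambda>t s'. I s' \<and> exp_val w ?e s' = 0 \<and> t + pot s' \<le> pot s1 + 1 + exp_cost ?e)"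
    if "I s1" for s1
  proof (rule wp_While[where I = I and pot = pot, OF _ that])
    fix s assume I: "I s" and "exp_val w ?e s \<noteq> 0"
    then have le: "regs s 6 \<le> L" by (simp only: cond) simp
    define j where "j = regs s 5"
    from I have wf_state: "wf_state s" and r0: "regs s 0 = u" "regs s 1 = v" and k: "regs s 6 = 2 ^ j"
      and goods: "\<And>j'. 2 ^ j' \<le> L \<Longrightarrow> good_at s j' (shift_wt (wt j') u v (g (halfs j') (if j' < j then 0 else copies j')))"
      by (auto simp: I_def j_def)
    have jL: "j < L" using le k pow_Suc_le by simp
    have jM: "j < M" using jL LM by linarith
    have hpos: "1 \<le> halfs j" using le k by (simp add: Suc_leI div_greater_zero_iff)
    have hL: "halfs j \<le> L" by simp
    have LW: "2 * L + 2 < W" using LM M_W by linarith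
    define s1 where "s1 = s\<lparr>regs := (regs s)(7 := halfs j, 8 := copies j)\<rparr>"
    have hW: "halfs j < W" "2 * halfs j < W" "2 * halfs j + 1 < W" using LW hL by linarith+
    have st1: "wf_state s1" using wf_state hW by (simp add: wf_state_def s1_def)
    have "good_at s j (shift_wt (wt j) u v (g (halfs j) (copies j)))" using goods[of j] le k by simp
    from good_at_cong[OF this st1] have g1: "good s1 j (halfs j) (shift_wt (wt j) u v (g (halfs j) (copies j)))"
      using good_at_iff[OF st1] by (simp add: s1_def j_def)
    have "run j (insert 8 scratch) UNIV (unit_cost * copies j + 10) (While (Reg 8) (Seq c (Assign 8 (Bin Sub (Reg 8) (Num 1))))) s1
      (\<lambda>s'. good s' j (halfs j) (shift_wt (wt j) u v (g (halfs j) 0)))"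
    proof (rule run_copies[where g = "g (halfs j)", OF _ g1])
      show "run j scratch UNIV (6000 * (Suc Cap * Suc Cap)) c s' (\<lambda>s'. good s' j (halfs j) (shift_wt wt' u v (g (halfs j) i)))"
        if "good s' j (halfs j) (shift_wt wt' u v (g (halfs j) (Suc i)))" "regs s' 0 = u" "regs s' 1 = v" "i < copies j" for s' wt' i
        using step[OF hL that] .
    qed (use r0 in \<open>simp_all add: s1_def\<close>)
    then have "wp w (While (Reg 8) (Seq c (Assign 8 (Bin Sub (Reg 8) (Num 1))))) s1 (\<lambda>T s2. T \<le> unit_cost * copies j + 10 \<and>
      frame (insert 8 scratch) UNIV s1 s2 j \<and> good s2 j (halfs j) (shift_wt (wt j) u v (g (halfs j) 0)))"
      unfolding run_def .
    then have "wp w (While (Reg 8) (Seq c (Assign 8 (Bin Sub (Reg 8) (Num 1))))) s1 (\<lambda>T s2.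
      wp w (Seq (Assign 6 (Bin Mul (Num 2) (Reg 6))) (Assign 5 (Bin Add (Reg 5) (Num 1)))) s2
        (\<lambda>T' s'. I s' \<and> 1 + exp_cost ?e + (10 + T + T') + pot s' \<le> pot s))"
    proof (rule wp_mono)
      fix T s2 assume *: "T \<le> unit_cost * copies j + 10 \<and>
        frame (insert 8 scratch) UNIV s1 s2 j \<and> good s2 j (halfs j) (shift_wt (wt j) u v (g (halfs j) 0))"
      then have T: "T \<le> unit_cost * copies j + 10" and f2: "frame (insert 8 scratch) UNIV s1 s2 j"
        and g2: "good s2 j (halfs j) (shift_wt (wt j) u v (g (halfs j) 0))" by auto
      from good_wf_state[OF g2] have st2: "wf_state s2" and r2: "regs s2 5 = j" "regs s2 7 = halfs j" by auto
      have r2': "regs s2 0 = u" "regs s2 1 = v" "regs s2 6 = 2 ^ j"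
        using frame_reg[OF f2] r0 k by (simp_all add: s1_def)
      define s3 where "s3 = s2\<lparr>regs := (regs s2)(6 := 2 ^ Suc j, 5 := Suc j)\<rparr>"
      have two: "2 * 2 ^ j \<le> 2 * L" using le k by simp
      have st3: "wf_state s3" using st2 two LW jL by (simp add: wf_state_def s3_def)
      have I3: "I s3"
        unfolding I_def
      proof (intro conjI exI[of _ "Suc j"] allI impI)
        fix j' assume j': "2 ^ j' \<le> L"
        show "good_at s3 j' (shift_wt (wt j') u v (g (halfs j') (if j' < Suc j then 0 else copies j')))"
        proof (cases "j' = j")
          case True
          then have "good_at s2 j' (shift_wt (wt j') u v (g (halfs j') 0))"
            using g2 good_at_iff[OF st2 r2] by simp
          then show ?thesis using True good_at_cong[OF _ st3] by (simp add: s3_def)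
        next
          case False
          have "j' < M" using pow_Suc_le[OF j'] LM by linarith
          then have "view M (mem s3) j' = view M (mem s) j'" using f2 False by (simp add: frame_def s3_def s1_def)
          moreover have "(if j' < Suc j then 0 else copies j') = (if j' < j then 0 else copies j')" using False by auto
          ultimately show ?thesis using good_at_cong[OF goods[OF j'] st3] by presburger
        qed
      qed (use st3 r2' two in \<open>auto simp: s3_def\<close>)
      have "pot s3 + 3 * (unit_cost + 100) * halfs j \<le> pot s"
      proof -
        have "2 * (L div (2 * 2 ^ j)) \<le> halfs j"
          by (metis div_mult2_eq mult.commute times_div_less_eq_dividend)
        moreover have "2 * c * p + c * q \<le> 2 * c * q" if "2 * p \<le> q" for c p q :: nat
          using mult_le_mono2[OF that, of c] by (simp add: algebra_simps del: mult_le_cancel1)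
        ultimately have gen: "2 * c * (L div (2 * 2 ^ j)) + c * halfs j \<le> 2 * c * halfs j" for c by blast
        have "6 * (unit_cost + 100) = 2 * (3 * (unit_cost + 100))" by simp
        then show ?thesis using gen[of "3 * (unit_cost + 100)"]
          by (simp only: pot_def s3_def k ram.simps fun_upd_same fun_upd_other power_Suc) simp
      qed
      moreover have "T + 100 \<le> 3 * (unit_cost + 100) * halfs j"
      proof -
        \<comment> \<open>The additional copy that makes the number odd is charged to
          \<open>halfs j\<close>, which is at least one while \<open>2 ^ j \<le> L\<close>.\<close>
        have "unit_cost * copies j \<le> unit_cost * (3 * halfs j)" using hpos by (intro mult_le_mono2) linarith
        moreover have "3 * (unit_cost + 100) * halfs j = unit_cost * (3 * halfs j) + 300 * halfs j"
          by (simp add: algebra_simps)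
        ultimately show ?thesis using T hpos by linarith
      qed
      ultimately have time: "T + 100 + pot s3 \<le> pot s" by linarith
      have ev2: "exp_val w (Bin Mul (Num 2) (Reg 6)) s2 = 2 ^ Suc j"
        using st2 r2' two LW by (simp add: wf_state_def exp_val.simps(4))
      have ev3: "exp_val w (Bin Add (Reg 5) (Num 1)) (s2\<lparr>regs := (regs s2)(6 := 2 ^ Suc j)\<rparr>) = Suc j"
        using st2 r2 two LW jL by (simp add: wf_state_def)
      show "wp w (Seq (Assign 6 (Bin Mul (Num 2) (Reg 6))) (Assign 5 (Bin Add (Reg 5) (Num 1)))) s2
        (\<lambda>T' s'. I s' \<and> 1 + exp_cost ?e + (10 + T + T') + pot s' \<le> pot s)"
        unfolding wp_Seq wp_Assign ev2 ev3 using I3 time by (simp add: s3_def)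
    qed
    then have F: "wp w (Seq (While (Reg 8) (Seq c (Assign 8 (Bin Sub (Reg 8) (Num 1)))))
        (Seq (Assign 6 (Bin Mul (Num 2) (Reg 6))) (Assign 5 (Bin Add (Reg 5) (Num 1))))) s1
      (\<lambda>T s'. I s' \<and> 1 + exp_cost ?e + (10 + T) + pot s' \<le> pot s)"
      by (simp only: add.assoc wp_Seq[of w "While (Reg 8) (Seq c (Assign 8 (Bin Sub (Reg 8) (Num 1))))"])
    have ev7: "exp_val w (Bin Div (Reg 3) (Reg 6)) s = halfs j"
      using wf_state k hW by (simp add: wf_state_def exp_val.simps(4))
    have ev8: "exp_val w (Bin Add (Bin Mul (Num 2) (Reg 7)) (Num 1)) (s\<lparr>regs := (regs s)(7 := halfs j)\<rparr>) = copies j"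
      using wf_state hW by (simp add: wf_state_def exp_val.simps(4)[of _ Mul])
    have s1: "(s\<lparr>regs := (regs s)(7 := halfs j)\<rparr>)\<lparr>regs := (regs (s\<lparr>regs := (regs s)(7 := halfs j)\<rparr>))(8 := copies j)\<rparr> = s1"
      by (simp add: s1_def)
    show "wp w ?body s (\<lambda>t s'. I s' \<and> 1 + exp_cost ?e + t + pot s' \<le> pot s)"
      unfolding wp_Seq[of w "Assign 7 (Bin Div (Reg 3) (Reg 6))"]
        wp_Seq[of w "Assign 8 (Bin Add (Bin Mul (Num 2) (Reg 7)) (Num 1))"] wp_Assign ev7 ev8 s1
      by (rule wp_mono[OF F]) simp
  qed
  define s0 where "s0 = s\<lparr>regs := (regs s)(5 := 0, 6 := 1)\<rparr>"
  have "1 < W" using M_W M32 by linarith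
  then have st0: "wf_state s0" using s by (simp add: s0_def wf_state_def)
  have I0: "I s0" unfolding I_def
    using st0 r Lpos good good_at_cong[OF _ st0] by (auto simp: s0_def)
  have p0: "pot s0 = 6 * (unit_cost + 100) * L" by (simp add: pot_def s0_def)
  have v01: "exp_val w (Num 0) s = 0" "exp_val w (Num 1) s = 1" for s by simp_all
  have s0eq: "(s\<lparr>regs := (regs s)(5 := 0)\<rparr>)\<lparr>regs := (regs (s\<lparr>regs := (regs s)(5 := 0)\<rparr>))(6 := 1)\<rparr> = s0"
    by (simp add: s0_def)
  show ?thesis
    unfolding update_def wp_Seq[of w "Assign 5 (Num 0)"] wp_Seq[of w "Assign 6 (Num 1)"] wp_Assign v01 s0eq
  proof (rule wp_mono[OF loop[OF I0]])
    fix T s'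
    assume *: "I s' \<and> exp_val w ?e s' = 0 \<and> T + pot s' \<le> pot s0 + 1 + exp_cost ?e"
    then have I': "I s'" by blast
    have "of_bool (regs s' 6 \<le> L) = (0::nat)" using * by (simp only: cond[OF I', symmetric])
    then have "\<not> regs s' 6 \<le> L" by simp
    with I'     obtain j where j: "\<not> 2 ^ j \<le> L" and goods: "\<And>j'. 2 ^ j' \<le> L \<Longrightarrow>
        good_at s' j' (shift_wt (wt j') u v (g (halfs j') (if j' < j then 0 else copies j')))" by (auto simp: I_def)
    have "good_at s' j' (shift_wt (wt j') u v (g (halfs j') 0))" if "2 ^ j' \<le> L" for j'
    proof -
      have "j' < j"
      proof (rule ccontr)
        assume "\<not> j' < j"
        then have "(2::nat) ^ j \<le> 2 ^ j'" by simp
        then show False using j that by linarith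
      qed
      then show ?thesis using goods[OF that] by simp
    qed
    then show "1 + exp_cost (Num 0) + (1 + exp_cost (Num 1) + T) \<le> 6 * (unit_cost + 100) * L + 50 \<and> wf_state s' \<and>
      (\<forall>j. 2 ^ j \<le> L \<longrightarrow> good_at s' j (shift_wt (wt j) u v (g (halfs j) 0)))"
      using * p0 I' by (simp add: I_def)
  qed
qed

definition represents where
  "represents s E \<longleftrightarrow> wf_state s \<and> graph_on n E \<and> (\<forall>j. 2 ^ j \<le> L \<longrightarrow> good_at s j (edge_weight E (copies j)))"

lemma wf_state_pass_edge: "wf_state s \<Longrightarrow> u < n \<Longrightarrow> v < n \<Longrightarrow> wf_state (pass_edge u v s)"
  using nM M_W by (simp add: wf_state_def pass_edge_def)

lemma good_at_pass_edge: "good_at s j wt \<Longrightarrow> wf_state s \<Longrightarrow> u < n \<Longrightarrow> v < n \<Longrightarrow> good_at (pass_edge u v s) j wt"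
  by (erule good_at_cong) (simp_all add: wf_state_pass_edge, simp add: pass_edge_def)

lemma wp_insert_edge:
  assumes "represents s E" "u < n" "v < n" "u \<noteq> v" "{u, v} \<notin> E"
  shows "wp w (update insert_copy) (pass_edge u v s)
    (\<lambda>T s'. T \<le> 6 * (unit_cost + 100) * L + 50 \<and> represents s' (insert {u, v} E))"
proof (rule wp_mono[OF wp_update[where u = u and v = v and g = "\<lambda>half i. 2 * half + 1 - i" and wt = "\<lambda>j. edge_weight E (copies j)"]])
  let ?g = "\<lambda>half i. 2 * half + 1 - i :: nat"
  fix j half s wt i
  assume *: "half \<le> L" "good s j half (shift_wt wt u v (?g half (Suc i)))" "regs s 0 = u" "regs s 1 = v" "i < 2 * half + 1"
  have Sg: "Suc (?g half (Suc i)) = ?g half i" using *(5) by simp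
  have "Suc (shift_wt wt u v (?g half (Suc i)) u v) < M" using *(1) LM by (simp add: shift_wt_same)
  from run_insert_copy[OF *(2,3) assms(2) *(4) assms(3,4) this]
  show "run j scratch UNIV (6000 * (Suc Cap * Suc Cap)) insert_copy s (\<lambda>s'. good s' j half (shift_wt wt u v (?g half i)))"
    by (simp only: shift_wt_same shift_wt_shift Sg)
next
  fix T s' assume *: "T \<le> 6 * (unit_cost + 100) * L + 50 \<and> wf_state s' \<and>
    (\<forall>j. 2 ^ j \<le> L \<longrightarrow> good_at s' j (shift_wt (edge_weight E (copies j)) u v (2 * halfs j + 1 - 0)))"
  have "graph_on n (insert {u, v} E)" using assms unfolding represents_def graph_on_def by blast
  then show "T \<le> 6 * (unit_cost + 100) * L + 50 \<and> represents s' (insert {u, v} E)"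
    using * unfolding represents_def by (simp only: edge_weight_insert[OF assms(5)] diff_zero) blast
next
  fix j assume "2 ^ j \<le> L"
  then have "good_at s j (edge_weight E (copies j))" using assms(1) by (simp add: represents_def)
  then show "good_at (pass_edge u v s) j (shift_wt (edge_weight E (copies j)) u v (2 * halfs j + 1 - copies j))"
    using assms good_at_pass_edge by (simp add: edge_weight_notin represents_def)
qed (use assms wf_state_pass_edge in \<open>auto simp: represents_def pass_edge_def\<close>)

lemma wp_delete_edge:
  assumes "represents s E" "{u, v} \<in> E"
  shows "wp w (update delete_copy) (pass_edge u v s)
    (\<lambda>T s'. T \<le> 6 * (unit_cost + 100) * L + 50 \<and> represents s' (E - {{u, v}}))"
proof -
  have g: "graph_on n E" using assms by (simp add: represents_def)
  from graph_onD[OF g assms(2)] have uv: "u < n" "v < n" "u \<noteq> v" by (auto simp: doubleton_eq_iff)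
  show ?thesis
  proof (rule wp_mono[OF wp_update[where u = u and v = v and g = "\<lambda>half i. i" and wt = "\<lambda>j. edge_weight E (copies j)"]])
    fix j half s wt i
    assume *: "half \<le> L" "good s j half (shift_wt wt u v (Suc i))" "regs s 0 = u" "regs s 1 = v" "i < 2 * half + 1"
    have "0 < shift_wt wt u v (Suc i) u v" by (simp add: shift_wt_same)
    from run_delete_copy[OF *(2,3) uv(1) *(4) uv(2,3) this]
    show "run j scratch UNIV (6000 * (Suc Cap * Suc Cap)) delete_copy s (\<lambda>s'. good s' j half (shift_wt wt u v i))"
      by (simp only: shift_wt_same shift_wt_shift diff_Suc_1)
  next
    fix T s' assume *: "T \<le> 6 * (unit_cost + 100) * L + 50 \<and> wf_state s' \<and>
      (\<forall>j. 2 ^ j \<le> L \<longrightarrow> good_at s' j (shift_wt (edge_weight E (copies j)) u v 0))"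
    have "graph_on n (E - {{u, v}})" using g unfolding graph_on_def by blast
    then show "T \<le> 6 * (unit_cost + 100) * L + 50 \<and> represents s' (E - {{u, v}})"
      using * unfolding represents_def by (simp only: edge_weight_delete) blast
  next
    fix j assume "2 ^ j \<le> L"
    then have "good_at s j (edge_weight E (copies j))" using assms(1) by (simp add: represents_def)
    then show "good_at (pass_edge u v s) j (shift_wt (edge_weight E (copies j)) u v (copies j))"
      using assms uv good_at_pass_edge by (simp only: edge_weight_in[OF assms(2)] represents_def)
  qed (use assms uv wf_state_pass_edge in \<open>auto simp: represents_def pass_edge_def\<close>)
qed

end

section \<open>Colouring functional graphs\<close>

lemma pow2_Suc: "\<exists>c. (2::nat) ^ k = Suc c"
  by (metis not0_implies_Suc power_not_zero zero_neq_numeral)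

lemma xor_nat_lt: "p < 2 ^ L \<Longrightarrow> q < 2 ^ L \<Longrightarrow> xor p q < (2::nat) ^ L"
  by (metis take_bit_nat_eq_self_iff take_bit_xor)

lemma lowest_bit_mask: "0 < (x::nat) \<Longrightarrow> \<exists>k. xor x (x - 1) = 2 ^ Suc k - 1 \<and> bit x k"
proof (induction x rule: less_induct)
  case (less x)
  show ?case
  proof (cases "odd x")
    case True
    then obtain m where "x = 2 * m + 1" by (auto elim: oddE)
    then have "xor x (x - 1) = 2 ^ Suc 0 - 1 \<and> bit x 0" by (subst xor_rec) (simp add: bit_0)
    then show ?thesis by blast
  next
    case False
    then obtain m where m: "x = 2 * m" "0 < m" using less.prems by (auto elim: evenE)
    with less.IH[of m] obtain k where k: "xor m (m - 1) = 2 ^ Suc k - 1" "bit m k" by auto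
    have "x - 1 = 2 * (m - 1) + 1" using m by simp
    then have "xor x (x - 1) = 1 + 2 * xor m (m - 1)" using m(1) by (subst xor_rec) simp
    also have "\<dots> = 2 ^ Suc (Suc k) - 1"
      using k(1) pow2_Suc[of k] by auto
    finally have "xor x (x - 1) = 2 ^ Suc (Suc k) - 1" .
    moreover have "bit x (Suc k)" using k(2) m(1) by (simp add: bit_Suc)
    ultimately show ?thesis by blast
  qed
qed

definition low_mask :: "nat \<Rightarrow> nat \<Rightarrow> nat" where
  "low_mask p q = xor (xor p q) (xor p q - 1)"

text \<open>One step of Cole and Vishkin's colour reduction, with the bit index \<open>k\<close> represented by \<open>2 ^ Suc k - 1\<close>.\<close>

definition bit_color :: "nat \<Rightarrow> nat \<Rightarrow> nat" where
  "bit_color p q = 2 * low_mask p q + p div (low_mask p q div 2 + 1) mod 2"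

lemma bit_color_cases:
  assumes "p \<noteq> q" "p < 2 ^ L" "q < 2 ^ L"
  obtains k where "k < L" "low_mask p q = 2 ^ Suc k - 1" "bit p k \<noteq> bit q k" "bit_color p q = 2 * (2 ^ Suc k - 1) + of_bool (bit p k)"
proof -
  have "xor p q \<noteq> 0" using assms(1) by (metis xor.right_neutral xor.left_commute xor_self_eq)
  then obtain k where k: "low_mask p q = 2 ^ Suc k - 1" "bit (xor p q) k"
    using lowest_bit_mask[of "xor p q"] by (auto simp: low_mask_def)
  have "k < L"
  proof (rule ccontr)
    assume "\<not> k < L"
    then have "(2::nat) ^ L \<le> 2 ^ k" by simp
    then have "xor p q < 2 ^ k" using xor_nat_lt[OF assms(2,3)] by linarith
    then show False using k(2) by (simp add: bit_iff_odd)
  qed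
  moreover have "bit p k \<noteq> bit q k" using k(2) by (auto simp: bit_xor_iff)
  moreover have "low_mask p q div 2 + 1 = 2 ^ k" using k(1) pow2_Suc[of k] by auto
  then have "bit_color p q = 2 * (2 ^ Suc k - 1) + of_bool (bit p k)"
    unfolding bit_color_def using k(1) by (simp add: bit_iff_odd mod_2_eq_odd)
  ultimately show ?thesis using that k(1) by blast
qed

text \<open>Equal colours would give the same bit position and the same bit there. But that position
  was chosen as one in which \<open>p\<close> and \<open>q\<close> differ.\<close>

lemma bit_color_neq:
  assumes "p \<noteq> q" "q \<noteq> r" "p < 2 ^ L" "q < 2 ^ L" "r < 2 ^ L"
  shows "bit_color p q \<noteq> bit_color q r"
proof
  assume eq: "bit_color p q = bit_color q r"
  obtain k where k: "bit p k \<noteq> bit q k" "bit_color p q = 2 * (2 ^ Suc k - 1) + of_bool (bit p k)"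
    using bit_color_cases[OF assms(1,3,4)] by metis
  obtain l where l: "bit_color q r = 2 * (2 ^ Suc l - 1) + of_bool (bit q l)"
    using bit_color_cases[OF assms(2,4,5)] by metis
  have "bit_color p q mod 2 = of_bool (bit p k)" "bit_color q r mod 2 = of_bool (bit q l)"
    unfolding k(2) l by simp_all
  then have b: "bit p k = bit q l" using eq by (metis of_bool_eq_iff)
  then have "(2::nat) ^ Suc k - 1 = 2 ^ Suc l - 1" using eq k(2) l by simp
  then have "(2::nat) ^ Suc k = 2 ^ Suc l" by (metis One_nat_def Suc_pred' zero_less_power zero_less_numeral)
  then have "k = l" by simp
  then show False using b k(1) by simp
qed

locale functional_graph =
  fixes n L :: nat and root :: "nat \<Rightarrow> bool" and F :: "nat \<Rightarrow> nat"
  assumes nL: "n < 2 ^ L" and F: "\<And>p. p < n \<Longrightarrow> \<not> root p \<Longrightarrow> F p < n \<and> F p \<noteq> p"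
begin

definition c1 :: "nat \<Rightarrow> nat" where
  "c1 p = (if root p then 0 else bit_color p (F p))"

definition dir :: "nat \<Rightarrow> bool" where
  "dir p \<longleftrightarrow> c1 p < c1 (F p)"

definition stop :: "nat \<Rightarrow> bool" where
  "stop p \<longleftrightarrow> root (F p) \<or> dir (F p) \<noteq> dir p"

definition run_length :: "nat \<Rightarrow> nat" where
  "run_length p = (LEAST m. stop ((F ^^ m) p))"

text \<open>The value \<open>0\<close> is reserved for roots and \<open>1\<close> to
  \<open>4\<close> encode direction and parity. Vertices outside a slot thus contribute the digit
  \<open>0\<close>, which allows lists of different lengths to be compared.\<close>

definition code :: "nat \<Rightarrow> nat" where
  "code p = (if root p then 0 else 1 + 2 * of_bool (dir p) + run_length p mod 2)"

lemma c1_cases: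
  assumes "p < n" "\<not> root p"
  obtains k where "k < L" "c1 p = 2 * (2 ^ Suc k - 1)" | k where "k < L" "c1 p = 2 * (2 ^ Suc k - 1) + 1"
proof -
  have *: "F p < 2 ^ L" "F p \<noteq> p" "p < 2 ^ L" using F[OF assms] nL assms(1) by auto
  obtain k where k: "k < L" "bit_color p (F p) = 2 * (2 ^ Suc k - 1) + of_bool (bit p k)"
    using bit_color_cases[of p "F p" L] * by metis
  show ?thesis using that[of k] k assms(2) by (cases "bit p k") (auto simp: c1_def)
qed

lemma c1_pos: "p < n \<Longrightarrow> \<not> root p \<Longrightarrow> 0 < c1 p"
proof (rule c1_cases)
  show "c1 p = 2 * (2 ^ Suc k - 1) \<Longrightarrow> 0 < c1 p" for k using pow2_Suc[of k] by auto
qed auto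

lemma c1_less: "p < n \<Longrightarrow> c1 p < 2 ^ (L + 2)"
proof (cases "root p")
  case False
  assume "p < n"
  have *: "2 * (2 ^ Suc k - 1) + 1 < (2::nat) ^ (L + 2)" if "k < L" for k
  proof -
    have "(2::nat) ^ Suc k \<le> 2 ^ L" using that by (intro power_increasing) auto
    then show ?thesis using pow2_Suc[of k] by auto
  qed
  show ?thesis by (rule c1_cases[OF \<open>p < n\<close> False]) (use * in fastforce)+
qed (simp add: c1_def)

lemma c1_neq: "p < n \<Longrightarrow> \<not> root p \<Longrightarrow> c1 p \<noteq> c1 (F p)"
proof (cases "root (F p)")
  case True
  assume "p < n" "\<not> root p"
  then show ?thesis using c1_pos[of p] True by (simp add: c1_def)
next
  case False
  assume p: "p < n" "\<not> root p"
  have q: "F p < n" "F p \<noteq> p" using F[OF p] by auto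
  have r: "F (F p) < n" "F (F p) \<noteq> F p" using F[OF q(1) False] by auto
  show ?thesis unfolding c1_def using bit_color_neq[of p "F p" "F (F p)" L] p q r False nL by simp
qed

text \<open>While no stop occurs, the colours \<open>c1\<close> are strictly monotone and hence
  pairwise distinct, but a non-root has only \<open>2 * L\<close> possible colours: one for each bit
  position and bit. A monotone stretch with \<open>2 * L + 2\<close> vertices is impossible. This
  also rules out running around a cycle of the functional graph.\<close>

lemma stops:
  assumes p: "p < n" "\<not> root p"
  shows "\<exists>m\<le>2 * L. stop ((F ^^ m) p)"
proof (rule ccontr)
  assume "\<not> ?thesis"
  then have ns: "\<not> stop ((F ^^ m) p)" if "m \<le> 2 * L" for m using that by blast
  have represents: "(F ^^ m) p < n \<and> \<not> root ((F ^^ m) p) \<and> dir ((F ^^ m) p) = dir p" if "m \<le> Suc (2 * L)" for m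
    using that
  proof (induction m)
    case (Suc m)
    then have "\<not> stop ((F ^^ m) p)" "(F ^^ m) p < n \<and> \<not> root ((F ^^ m) p) \<and> dir ((F ^^ m) p) = dir p" using ns by auto
    then show ?case using F unfolding stop_def by simp
  qed (use p in simp)
  define g where "g m = c1 ((F ^^ m) p)" for m
  have step: "if dir p then g m < g (Suc m) else g (Suc m) < g m" if "m \<le> Suc (2 * L)" for m
    using represents[OF that] c1_neq[of "(F ^^ m) p"] unfolding dir_def g_def by (auto simp: not_less dir_def)
  have mono: "if dir p then g a < g b else g b < g a" if "a < b" "b \<le> Suc (2 * L)" for a b
    using that
  proof (induction b)
    case (Suc b)
    then show ?case using step[of b] by (cases "a = b") (auto split: if_splits)
  qed simp
  have "inj_on g {..Suc (2 * L)}"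
    by (rule linorder_inj_onI') (use mono in \<open>force split: if_splits\<close>)
  then have c: "card (g ` {..Suc (2 * L)}) = 2 * L + 2" by (simp add: card_image)
  let ?V = "(\<lambda>k. 2 * (2 ^ Suc k - 1)) ` {..<L} \<union> (\<lambda>k. 2 * (2 ^ Suc k - 1) + 1) ` {..<L} :: nat set"
  have sub: "g ` {..Suc (2 * L)} \<subseteq> ?V"
  proof
    fix y assume "y \<in> g ` {..Suc (2 * L)}"
    then obtain m where m: "m \<le> Suc (2 * L)" "y = g m" by auto
    show "y \<in> ?V" by (rule c1_cases[of "(F ^^ m) p"]) (use represents[OF m(1)] m(2) g_def in auto)
  qed
  have "card ?V \<le> card {..<L} + card {..<L}"
    by (rule order_trans[OF card_Un_le add_mono[OF card_image_le card_image_le]]) auto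
  then have "card (g ` {..Suc (2 * L)}) \<le> 2 * L" using card_mono[OF _ sub] by simp
  then show False using c by simp
qed

lemma run_length_le: "p < n \<Longrightarrow> \<not> root p \<Longrightarrow> run_length p \<le> 2 * L"
  unfolding run_length_def using stops Least_le by (metis (mono_tags, lifting) order_trans)

lemma run_length_stop: "stop p \<Longrightarrow> run_length p = 0"
  unfolding run_length_def by (rule Least_equality) auto

lemma run_length_step:
  assumes "p < n" "\<not> root p" "\<not> stop p"
  shows "run_length p = Suc (run_length (F p))"
proof -
  obtain m where "stop ((F ^^ m) p)" using stops[OF assms(1,2)] by blast
  then have "run_length p = Suc (LEAST m. stop ((F ^^ Suc m) p))"
    unfolding run_length_def by (rule Least_Suc) (use assms(3) in simp)
  then show ?thesis unfolding run_length_def by (simp add: funpow_swap1)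
qed

text \<open>Three cases: a root successor has code \<open>0\<close>; at a stop the directions
  differ; otherwise the directions agree and the distances to the stop differ by one, so their
  parities differ.\<close>

lemma code_neq:
  assumes "p < n" "\<not> root p"
  shows "code p \<noteq> code (F p)"
proof (cases "root (F p)")
  case True
  then show ?thesis using assms by (simp add: code_def)
next
  case False
  show ?thesis
  proof (cases "stop p")
    case True
    then have "dir (F p) \<noteq> dir p" using False by (simp add: stop_def)
    moreover have "code p div 2 \<noteq> code (F p) div 2 \<or> code p mod 2 \<noteq> code (F p) mod 2"
      if "dir (F p) \<noteq> dir p"
      using that assms False mod_less_divisor[of 2 "run_length p"] mod_less_divisor[of 2 "run_length (F p)"]
      unfolding code_def by (cases "dir p"; cases "run_length p mod 2 = 0"; cases "run_length (F p) mod 2 = 0") auto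
    ultimately show ?thesis by metis
  next
    case ns: False
    then have "dir (F p) = dir p" by (auto simp: stop_def)
    then show ?thesis using run_length_step[OF assms ns] assms False by (simp add: code_def mod_Suc)
  qed
qed

lemma code_less: "code p < 8"
  using mod_less_divisor[of 2 "run_length p"] by (auto simp: code_def)

end

section \<open>Queries\<close>

definition c1_code :: "nat \<Rightarrow> nat \<Rightarrow> nat \<Rightarrow> com" where
  "c1_code q d f = Cond (Bin Less (Reg 10) (cell 2 (Reg q) (Num 1) (Num 0)))
    (Seq (Assign f (cell 0 (Reg q) (Num 1) (Reg 10)))
    (Seq (Assign 18 (Bin Xor (Reg q) (Reg f)))
    (Seq (Assign 18 (Bin Xor (Reg 18) (Bin Sub (Reg 18) (Num 1))))
      (Assign d (Bin Add (Bin Mul (Num 2) (Reg 18))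
        (Bin Mod (Bin Div (Reg q) (Bin Add (Bin Div (Reg 18) (Num 2)) (Num 1))) (Num 2)))))))
    (Assign d (Num 0))"

text \<open>
  Registers \<open>13\<close>, \<open>14\<close>, \<open>15\<close> hold the next vertex \<open>t\<close>, its colour and its successor. Colour \<open>0\<close> belongs to
  roots only, hence it also serves to end the loop.
\<close>

definition slot_step :: com where
  "slot_step = Seq (c1_code 15 12 19) (Cond (Bin Eq (Bin Less (Reg 14) (Reg 12)) (Reg 16))
    (Seq (Assign 17 (Bin Sub (Num 1) (Reg 17))) (Seq (Assign 13 (Reg 15)) (Seq (Assign 14 (Reg 12)) (Assign 15 (Reg 19)))))
    (Assign 14 (Num 0)))"

definition slot_code :: com where
  "slot_code = Seq (c1_code 9 12 13) (Seq (c1_code 13 14 15) (Seq (Assign 16 (Bin Less (Reg 12) (Reg 14)))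
    (Seq (Assign 17 (Num 0)) (While (Reg 14) slot_step))))"

definition slot_loop :: com where
  "slot_loop = Seq (Assign 11 (Num 0)) (Seq (Assign 10 (Num 0))
    (While (Bin Less (Reg 10) (cell 2 (Reg 9) (Num 1) (Num 0)))
      (Seq slot_code (Seq
        (Assign 11 (Bin Add (Reg 11) (Bin Shl (Bin Add (Bin Add (Num 1) (Bin Mul (Num 2) (Reg 16))) (Reg 17))
          (Bin Mul (Num 3) (Reg 10)))))
        (Assign 10 (Bin Add (Reg 10) (Num 1)))))))"

text \<open>Slot \<open>i\<close> sends every vertex to the \<open>i\<close>-th entry of its list of
  majority out-neighbours. A vertex whose list has at most \<open>i\<close> entries has no successor
  in this slot and acts as a root.\<close>

abbreviation rootH :: "(nat \<times> nat \<times> nat \<times> nat \<Rightarrow> nat) \<Rightarrow> nat \<Rightarrow> nat \<Rightarrow> bool" where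
  "rootH H i \<equiv> \<lambda>p. H (2, p, Suc 0, 0) \<le> i"

abbreviation succH :: "(nat \<times> nat \<times> nat \<times> nat \<Rightarrow> nat) \<Rightarrow> nat \<Rightarrow> nat \<Rightarrow> nat" where
  "succH H i \<equiv> \<lambda>p. H (0, p, Suc 0, i)"

abbreviation codeH :: "(nat \<times> nat \<times> nat \<times> nat \<Rightarrow> nat) \<Rightarrow> nat \<Rightarrow> nat \<Rightarrow> nat" where
  "codeH H i \<equiv> functional_graph.code (rootH H i) (succH H i)"

context machine
begin

definition slots_ok where
  "slots_ok H \<longleftrightarrow> (\<forall>p<n. H (2, p, Suc 0, 0) \<le> n \<and> (\<forall>i<H (2, p, Suc 0, 0). H (0, p, Suc 0, i) < n \<and> H (0, p, Suc 0, i) \<noteq> p))"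

lemma functional_graphI: "slots_ok H \<Longrightarrow> functional_graph n L (rootH H i) (succH H i)"
  using nL by unfold_locales (auto simp: slots_ok_def)

text \<open>The memory is fixed to a constant \<open>m\<close>, since queries do not store anything.
  Successive answers therefore refer to one and the same colouring.\<close>

definition query_state where
  "query_state m j s \<longleftrightarrow> wf_state s \<and> regs s 5 = j \<and> j < M \<and> mem s = m"

lemma run_assign_query:
  assumes "query_state m j s" "exp_val w e s = v" "i \<notin> {2, 3, 4, 5}" "i \<in> R" "1 + exp_cost e \<le> K"
  shows "run j R {} K (Assign i e) s (\<lambda>s'. query_state m j s' \<and> regs s' i = v \<and> frame {i} {} s s' j)"
  using assms exp_val_less[of w e s] by (auto simp: run_def wp_Assign query_state_def wf_state_def frame_def)

lemma query_state_regs: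
  assumes "query_state m j s"
  shows "bdd W (regs s)" "bdd W (mem s)" "regs s 2 = M" "regs s 3 = L" "regs s 4 = Cap" "regs s 5 = j" "j < M"
    "exp_val w (Reg i) s = regs s i"
  using assms by (auto simp: query_state_def wf_state_def)

lemma big_W: "2 ^ (L + 4) \<le> W"
proof -
  have "L + 4 \<le> w" using Lpos by (simp add: w_def)
  then show ?thesis by (rule power_increasing) simp
qed

lemma val_Mod: "exp_val w (Bin Mod d e) s = exp_val w d s mod exp_val w e s"
proof -
  have "exp_val w d s mod exp_val w e s < W"
    using exp_val_less[of w d s] mod_less_eq_dividend[of "exp_val w d s" "exp_val w e s"] by linarith
  then show ?thesis by (simp add: exp_val.simps(4))
qed

lemma val_Div: "exp_val w (Bin Div d e) s = exp_val w d s div exp_val w e s"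
proof -
  have "exp_val w d s div exp_val w e s < W"
    using exp_val_less[of w d s] div_le_dividend[of "exp_val w d s" "exp_val w e s"] by linarith
  then show ?thesis by (simp add: exp_val.simps(4))
qed

lemma val_Mul: "exp_val w d s * exp_val w e s < W \<Longrightarrow> exp_val w (Bin Mul d e) s = exp_val w d s * exp_val w e s"
  by (simp add: exp_val.simps(4))

lemma val_Xor: "exp_val w (Bin Xor d e) s = xor (exp_val w d s) (exp_val w e s)"
  using xor_nat_lt[OF exp_val_less exp_val_less, of w d s e s] by (simp add: exp_val.simps(4))

lemma run_c1_code:
  assumes q: "query_state m j s" and ok: "slots_ok (view M m j)" and p: "regs s q = p" "p < n" and i: "regs s 10 = i" "i < M"
    and r: "q \<notin> {18, d, f}" "d \<notin> {2, 3, 4, 5, 10, 18, f}" "f \<notin> {2, 3, 4, 5, 10, 18}" "q < 18" "f < 20" "d < 18"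
  defines "H \<equiv> view M m j"
  shows "run j {d, f, 18} {} 200 (c1_code q d f) s (\<lambda>s'. query_state m j s' \<and>
    regs s' d = functional_graph.c1 (rootH H i) (succH H i) p \<and> (\<not> rootH H i p \<longrightarrow> regs s' f = succH H i p))"
proof -
  interpret functional_graph n L "rootH H i" "succH H i" using functional_graphI[OF ok] H_def by simp
  note qr = query_state_regs[OF q]
  have ms: "mem s = m" using q by (simp add: query_state_def)
  have c: "exp_val w (cell 2 (Reg q) (Num 1) (Num 0)) s = H (2, p, Suc 0, 0)"
    using val_cell[of s 2 "Reg q" "Num 1" "Num 0"] qr p nM ms by (simp add: H_def)
  have cond: "exp_val w (Bin Less (Reg 10) (cell 2 (Reg q) (Num 1) (Num 0))) s = of_bool (\<not> rootH H i p)"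
    using c i qr by simp
  show ?thesis
    unfolding c1_code_def
  proof (rule run_Cond[where K = 100])
    assume "exp_val w (Bin Less (Reg 10) (cell 2 (Reg q) (Num 1) (Num 0))) s = 0"
    then have rt: "rootH H i p" by (simp only: cond) simp
    have e: "exp_val w (Num 0) s = 0" by simp
    show "run j {d, f, 18} {} 100 (Assign d (Num 0)) s (\<lambda>s'. query_state m j s' \<and>
      regs s' d = c1 p \<and> (\<not> rootH H i p \<longrightarrow> regs s' f = succH H i p))"
      by (rule run_weaken[OF run_assign_query[OF q e _ _ order_refl, of d "{d, f, 18}"]]) (use r rt in \<open>auto simp: c1_def\<close>)
  next
    assume "exp_val w (Bin Less (Reg 10) (cell 2 (Reg q) (Num 1) (Num 0))) s \<noteq> 0"
    then have nr: "\<not> rootH H i p" by (simp only: cond) simp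
    define t where "t = succH H i p"
    have t: "t < n" "t \<noteq> p" using F[OF p(2) nr] by (simp_all add: t_def)
    have e1: "exp_val w (cell 0 (Reg q) (Num 1) (Reg 10)) s = t"
      using val_cell[of s 0 "Reg q" "Num 1" "Reg 10"] qr p i nM ms by (simp add: H_def t_def)
    show "run j {d, f, 18} {} 100 (Seq (Assign f (cell 0 (Reg q) (Num 1) (Reg 10)))
      (Seq (Assign 18 (Bin Xor (Reg q) (Reg f)))
      (Seq (Assign 18 (Bin Xor (Reg 18) (Bin Sub (Reg 18) (Num 1))))
        (Assign d (Bin Add (Bin Mul (Num 2) (Reg 18))
          (Bin Mod (Bin Div (Reg q) (Bin Add (Bin Div (Reg 18) (Num 2)) (Num 1))) (Num 2))))))) s (\<lambda>s'. query_state m j s' \<and>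
        regs s' d = c1 p \<and> (\<not> rootH H i p \<longrightarrow> regs s' f = succH H i p))"
    proof (rule run_Seq[OF run_assign_query[OF q e1 _ _ order_refl]])
      fix s1 assume s1: "query_state m j s1 \<and> regs s1 f = t \<and> frame {f} {} s s1 j"
      then have q1: "query_state m j s1" and r1: "regs s1 q = p" "regs s1 f = t"
        using frame_reg[of "{f}" "{}" s s1 j] p r by auto
      have e2: "exp_val w (Bin Xor (Reg q) (Reg f)) s1 = xor p t" using r1 query_state_regs[OF q1] by (simp add: val_Xor)
      show "run j {d, f, 18} {} 70 (Seq (Assign 18 (Bin Xor (Reg q) (Reg f)))
        (Seq (Assign 18 (Bin Xor (Reg 18) (Bin Sub (Reg 18) (Num 1))))
        (Assign d (Bin Add (Bin Mul (Num 2) (Reg 18))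
          (Bin Mod (Bin Div (Reg q) (Bin Add (Bin Div (Reg 18) (Num 2)) (Num 1))) (Num 2)))))) s1 (\<lambda>s'. query_state m j s' \<and>
        regs s' d = c1 p \<and> (\<not> rootH H i p \<longrightarrow> regs s' f = succH H i p))"
      proof (rule run_Seq[OF run_assign_query[OF q1 e2 _ _ order_refl]])
        fix s2 assume s2: "query_state m j s2 \<and> regs s2 18 = xor p t \<and> frame {18} {} s1 s2 j"
        then have q2: "query_state m j s2" and r2: "regs s2 q = p" "regs s2 f = t" "regs s2 18 = xor p t"
          using frame_reg[of "{18}" "{}" s1 s2 j] r1 r by auto
        have "xor p t \<noteq> 0" using t(2) by (metis xor.right_neutral xor.left_commute xor_self_eq)
        then have "exp_val w (Bin Sub (Reg 18) (Num 1)) s2 = xor p t - 1"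
          using r2 query_state_regs[OF q2] by (subst exp_val_Sub) simp_all
        then have e3: "exp_val w (Bin Xor (Reg 18) (Bin Sub (Reg 18) (Num 1))) s2 = low_mask p t"
          using r2 query_state_regs[OF q2] by (simp add: val_Xor low_mask_def)
        show "run j {d, f, 18} {} 50 (Seq (Assign 18 (Bin Xor (Reg 18) (Bin Sub (Reg 18) (Num 1))))
          (Assign d (Bin Add (Bin Mul (Num 2) (Reg 18))
            (Bin Mod (Bin Div (Reg q) (Bin Add (Bin Div (Reg 18) (Num 2)) (Num 1))) (Num 2))))) s2 (\<lambda>s'. query_state m j s' \<and>
          regs s' d = c1 p \<and> (\<not> rootH H i p \<longrightarrow> regs s' f = succH H i p))"
        proof (rule run_Seq[OF run_assign_query[OF q2 e3 _ _ order_refl]])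
          fix s3 assume s3: "query_state m j s3 \<and> regs s3 18 = low_mask p t \<and> frame {18} {} s2 s3 j"
          then have q3: "query_state m j s3" and r3: "regs s3 q = p" "regs s3 f = t" "regs s3 18 = low_mask p t"
            using frame_reg[of "{18}" "{}" s2 s3 j] r2 r by auto
          have bc: "c1 p = 2 * low_mask p t + p div (low_mask p t div 2 + 1) mod 2"
            using nr by (simp add: c1_def bit_color_def t_def)
          have lt: "2 * low_mask p t + p div (low_mask p t div 2 + 1) mod 2 < W"
          proof -
            have "(2::nat) ^ (L + 2) \<le> W" by (rule order_trans[OF power_increasing big_W]) auto
            then show ?thesis using c1_less[OF p(2)] bc by linarith
          qed
          have "low_mask p t div 2 \<le> low_mask p t" by simp
          then have lt2: "2 * low_mask p t < W" "low_mask p t div 2 + 1 < W" using lt M_W M32 by linarith+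
          have e4: "exp_val w (Bin Add (Bin Mul (Num 2) (Reg 18))
            (Bin Mod (Bin Div (Reg q) (Bin Add (Bin Div (Reg 18) (Num 2)) (Num 1))) (Num 2))) s3 = c1 p"
            using r3 query_state_regs[OF q3] lt lt2 by (simp add: val_Mul val_Mod val_Div bc)
          show "run j {d, f, 18} {} 20 (Assign d (Bin Add (Bin Mul (Num 2) (Reg 18))
            (Bin Mod (Bin Div (Reg q) (Bin Add (Bin Div (Reg 18) (Num 2)) (Num 1))) (Num 2)))) s3 (\<lambda>s'. query_state m j s' \<and>
            regs s' d = c1 p \<and> (\<not> rootH H i p \<longrightarrow> regs s' f = succH H i p))"
          proof (rule run_weaken[OF run_assign_query[OF q3 e4 _ _ order_refl, of d "{d, f, 18}"]])
            fix s4 assume s4: "query_state m j s4 \<and> regs s4 d = c1 p \<and> frame {d} {} s3 s4 j"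
            then have "regs s4 f = t" using frame_reg[of "{d}" "{}" s3 s4 j f] r3 r by auto
            then show "query_state m j s4 \<and> regs s4 d = c1 p \<and> (\<not> rootH H i p \<longrightarrow> regs s4 f = succH H i p)"
              using s4 by (simp add: t_def)
          qed (use r in auto)
        qed (use r in auto)
      qed (use r in auto)
    qed (use r in auto)
  qed simp
qed

lemma run_slot_code:
  assumes q: "query_state m j s" and ok: "slots_ok (view M m j)" and v: "regs s 9 = v" "v < n" and i: "regs s 10 = i" "i < M"
  defines "H \<equiv> view M m j"
  assumes nr: "\<not> rootH H i v"
  shows "run j {12, 13, 14, 15, 16, 17, 18, 19} {} (1500 * (L + 1)) slot_code s (\<lambda>s'. query_state m j s' \<and>
    codeH H i v = 1 + 2 * regs s' 16 + regs s' 17)"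
proof -
  interpret functional_graph n L "rootH H i" "succH H i" using functional_graphI[OF ok] H_def by simp
  let ?R = "{12, 13, 14, 15, 16, 17, 18, 19} :: nat set"
  let ?F = "succH H i" and ?root = "rootH H i"
  \<comment> \<open>Vertex \<open>t\<close> is the next one on the path whose direction has not been
    compared yet, and register \<open>17\<close> is the parity of the steps already made. If
    \<open>t\<close> continues the run, the step onto \<open>t\<close> and the rest of the run are
    still to be counted; otherwise the run has ended and nothing is added.\<close>
  define I where "I s1 \<longleftrightarrow> query_state m j s1 \<and> regs s1 16 = of_bool (dir v) \<and> regs s1 17 \<le> 1 \<and>
    (regs s1 14 = 0 \<and> run_length v mod 2 = regs s1 17 \<or>
     (\<exists>t. t < n \<and> \<not> ?root t \<and> regs s1 13 = t \<and> regs s1 14 = c1 t \<and> regs s1 15 = ?F t \<and>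
       run_length v mod 2 = (regs s1 17 + (if dir t = dir v then Suc (run_length t) else 0)) mod 2))" for s1
  \<comment> \<open>A vertex with the opposite direction costs one more round, in which register
    \<open>14\<close> is cleared; hence the offset \<open>2\<close> for vertices that continue the
    run.\<close>
  define \<mu> where "\<mu> (s1::ram) = (if regs s1 14 = 0 then 0 else if dir (regs s1 13) = dir v then run_length (regs s1 13) + 2 else 1)" for s1
  define t0 where "t0 = ?F v"
  have t0: "t0 < n" using F[OF v(2) nr] by (simp add: t0_def)
  note rc = run_c1_code[where m = m and j = j, OF _ ok, folded H_def]
  have step: "run j ?R {} 300 slot_step s1 (\<lambda>s'. I s' \<and> \<mu> s' < \<mu> s1)"
    if I1: "I s1" and nz: "regs s1 14 \<noteq> 0" and i1: "regs s1 10 = i" for s1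
  proof -
    from I1 nz obtain t where q1: "query_state m j s1" and r16: "regs s1 16 = of_bool (dir v)" and r17: "regs s1 17 \<le> 1"
      and t: "t < n" "\<not> ?root t" and r1: "regs s1 13 = t" "regs s1 14 = c1 t" "regs s1 15 = ?F t"
      and par: "run_length v mod 2 = (regs s1 17 + (if dir t = dir v then Suc (run_length t) else 0)) mod 2"
      by (auto simp: I_def)
    have Ft: "?F t < n" using F[OF t] by simp
    show ?thesis
      unfolding slot_step_def
    proof (rule run_Seq[OF run_weaken[OF rc[OF q1 r1(3) Ft i1 i(2), where d = 12 and f = 19], where P' = "\<lambda>s'. query_state m j s' \<and>
          regs s' 12 = c1 (?F t) \<and> (\<not> ?root (?F t) \<longrightarrow> regs s' 19 = ?F (?F t)) \<and> regs s' 13 = t \<and> regs s' 14 = c1 t \<and>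
          regs s' 15 = ?F t \<and> regs s' 16 = of_bool (dir v) \<and> regs s' 17 = regs s1 17"]])
      fix s' assume *: "query_state m j s' \<and> regs s' 12 = c1 (?F t) \<and> (\<not> ?root (?F t) \<longrightarrow> regs s' 19 = ?F (?F t))" "frame {12, 19, 18} {} s1 s' j"
      then show "query_state m j s' \<and>
          regs s' 12 = c1 (?F t) \<and> (\<not> ?root (?F t) \<longrightarrow> regs s' 19 = ?F (?F t)) \<and> regs s' 13 = t \<and> regs s' 14 = c1 t \<and>
          regs s' 15 = ?F t \<and> regs s' 16 = of_bool (dir v) \<and> regs s' 17 = regs s1 17"
        using frame_reg[OF *(2)] r1 r16 by simp
    next
      fix s2 assume s2: "query_state m j s2 \<and>
          regs s2 12 = c1 (?F t) \<and> (\<not> ?root (?F t) \<longrightarrow> regs s2 19 = ?F (?F t)) \<and> regs s2 13 = t \<and> regs s2 14 = c1 t \<and>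
          regs s2 15 = ?F t \<and> regs s2 16 = of_bool (dir v) \<and> regs s2 17 = regs s1 17"
      then have q2: "query_state m j s2" by blast
      have cond: "exp_val w (Bin Eq (Bin Less (Reg 14) (Reg 12)) (Reg 16)) s2 = of_bool (dir t = dir v)"
        using s2 query_state_regs[OF q2] by (simp add: dir_def)
      have mu1: "\<mu> s1 = (if dir t = dir v then run_length t + 2 else 1)" using nz r1 by (simp add: \<mu>_def)
      show "run j ?R {} 70 (Cond (Bin Eq (Bin Less (Reg 14) (Reg 12)) (Reg 16))
        (Seq (Assign 17 (Bin Sub (Num 1) (Reg 17))) (Seq (Assign 13 (Reg 15)) (Seq (Assign 14 (Reg 12)) (Assign 15 (Reg 19)))))
        (Assign 14 (Num 0))) s2 (\<lambda>s'. I s' \<and> \<mu> s' < \<mu> s1)"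
      proof (rule run_Cond[where K = 50])
        assume "exp_val w (Bin Eq (Bin Less (Reg 14) (Reg 12)) (Reg 16)) s2 = 0"
        then have ne: "dir t \<noteq> dir v" by (simp only: cond) simp
        have e: "exp_val w (Num 0) s2 = 0" by simp
        show "run j ?R {} 50 (Assign 14 (Num 0)) s2 (\<lambda>s'. I s' \<and> \<mu> s' < \<mu> s1)"
        proof (rule run_weaken[OF run_assign_query[OF q2 e _ _ order_refl, of 14 ?R]])
          fix s' assume *: "query_state m j s' \<and> regs s' 14 = 0 \<and> frame {14} {} s2 s' j"
          then have "regs s' 16 = of_bool (dir v)" "regs s' 17 = regs s1 17"
            using frame_reg[of "{14}" "{}" s2 s' j] s2 by simp_all
          then show "I s' \<and> \<mu> s' < \<mu> s1" using * ne par r17 mu1 by (auto simp: I_def \<mu>_def)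
        qed auto
      next
        assume "exp_val w (Bin Eq (Bin Less (Reg 14) (Reg 12)) (Reg 16)) s2 \<noteq> 0"
        then have eq: "dir t = dir v" by (simp only: cond) simp
        have e1: "exp_val w (Bin Sub (Num 1) (Reg 17)) s2 = 1 - regs s1 17"
          using s2 query_state_regs[OF q2] r17 by (subst exp_val_Sub) simp_all
        let ?c3 = "Seq (Assign 13 (Reg 15)) (Seq (Assign 14 (Reg 12)) (Assign 15 (Reg 19)))"
        show "run j ?R {} 50 (Seq (Assign 17 (Bin Sub (Num 1) (Reg 17))) ?c3) s2 (\<lambda>s'. I s' \<and> \<mu> s' < \<mu> s1)"
        proof (rule run_Seq[OF run_assign_query[OF q2 e1 _ _ order_refl]])
          fix s3 assume s3: "query_state m j s3 \<and> regs s3 17 = 1 - regs s1 17 \<and> frame {17} {} s2 s3 j"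
          then have q3: "query_state m j s3" and r3: "regs s3 12 = c1 (?F t)" "regs s3 15 = ?F t" "regs s3 16 = of_bool (dir v)"
            "regs s3 19 = regs s2 19" "regs s3 17 = 1 - regs s1 17"
            using frame_reg[of "{17}" "{}" s2 s3 j] s2 by simp_all
          have e3: "exp_val w (Reg 15) s3 = ?F t" using r3 query_state_regs[OF q3] by simp
          show "run j ?R {} 40 ?c3 s3 (\<lambda>s'. I s' \<and> \<mu> s' < \<mu> s1)"
          proof (rule run_Seq[OF run_assign_query[OF q3 e3 _ _ order_refl]])
            fix s4 assume s4: "query_state m j s4 \<and> regs s4 13 = ?F t \<and> frame {13} {} s3 s4 j"
            then have q4: "query_state m j s4" and r4: "regs s4 12 = c1 (?F t)" "regs s4 13 = ?F t" "regs s4 16 = of_bool (dir v)"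
              "regs s4 19 = regs s2 19" "regs s4 17 = 1 - regs s1 17"
              using frame_reg[of "{13}" "{}" s3 s4 j] r3 by simp_all
            have e4: "exp_val w (Reg 12) s4 = c1 (?F t)" using r4 query_state_regs[OF q4] by simp
            show "run j ?R {} 30 (Seq (Assign 14 (Reg 12)) (Assign 15 (Reg 19))) s4 (\<lambda>s'. I s' \<and> \<mu> s' < \<mu> s1)"
            proof (rule run_Seq[OF run_assign_query[OF q4 e4 _ _ order_refl]])
              fix s5 assume s5: "query_state m j s5 \<and> regs s5 14 = c1 (?F t) \<and> frame {14} {} s4 s5 j"
              then have q5: "query_state m j s5" and r5: "regs s5 14 = c1 (?F t)" "regs s5 13 = ?F t" "regs s5 16 = of_bool (dir v)"
                "regs s5 19 = regs s2 19" "regs s5 17 = 1 - regs s1 17"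
                using frame_reg[of "{14}" "{}" s4 s5 j] r4 by simp_all
              have e5: "exp_val w (Reg 19) s5 = regs s2 19" using r5 query_state_regs[OF q5] by simp
              show "run j ?R {} 20 (Assign 15 (Reg 19)) s5 (\<lambda>s'. I s' \<and> \<mu> s' < \<mu> s1)"
              proof (rule run_weaken[OF run_assign_query[OF q5 e5 _ _ order_refl, of 15 ?R]])
                fix s6 assume s6: "query_state m j s6 \<and> regs s6 15 = regs s2 19 \<and> frame {15} {} s5 s6 j"
                then have q6: "query_state m j s6" and r6: "regs s6 14 = c1 (?F t)" "regs s6 13 = ?F t" "regs s6 16 = of_bool (dir v)"
                  "regs s6 15 = regs s2 19" "regs s6 17 = 1 - regs s1 17"
                  using frame_reg[of "{15}" "{}" s5 s6 j] r5 by simp_all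
                show "I s6 \<and> \<mu> s6 < \<mu> s1"
                proof (cases "?root (?F t)")
                  case True
                  then have z: "c1 (?F t) = 0" "run_length t = 0"
                    using run_length_stop[of t] by (simp_all add: c1_def stop_def)
                  \<comment> \<open>The step onto \<open>t\<close> is counted by toggling register
                    \<open>17\<close>. As the successor of \<open>t\<close> is a root, its colour
                    \<open>0\<close> in register \<open>14\<close> ends the loop without a further
                    comparison.\<close>
                  have "run_length v mod 2 = 1 - regs s1 17"
                    using par eq z(2) r17 by (cases "regs s1 17") auto
                  then show ?thesis using q6 r6 z mu1 by (auto simp: I_def \<mu>_def)
                next
                  case False
                  have r15: "regs s6 15 = ?F (?F t)" using r6 s2 False by simp
                  have pos: "0 < c1 (?F t)" using c1_pos[OF Ft False] .
                  have rl: "run_length t = (if dir (?F t) = dir v then Suc (run_length (?F t)) else 0)"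
                    using run_length_stop[of t] run_length_step[OF t] False eq by (auto simp: stop_def)
                  have "run_length v mod 2 = (1 - regs s1 17 + (if dir (?F t) = dir v then Suc (run_length (?F t)) else 0)) mod 2"
                    using par eq rl r17 by (cases "regs s1 17") auto
                  then have "I s6" unfolding I_def using q6 r6 r15 Ft False by auto
                  moreover have "\<mu> s6 < \<mu> s1" using mu1 eq rl r6 pos by (auto simp: \<mu>_def)
                  ultimately show ?thesis ..
                qed
              qed auto
            qed auto
          qed auto
        qed auto
      qed simp
    qed auto
  qed
  have codev: "codeH H i v = 1 + 2 * of_bool (dir v) + run_length v mod 2" using nr by (simp add: code_def)
  let ?loop = "While (Reg 14) slot_step"
  show ?thesis
    unfolding slot_code_def
  proof (rule run_Seq[OF run_weaken[OF rc[OF q v i, where d = 12 and f = 13], where P' = "\<lambda>s'. query_state m j s' \<and>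
        regs s' 12 = c1 v \<and> regs s' 13 = t0 \<and> regs s' 10 = i" and R' = ?R and X' = "{}" and K' = 200]])
    fix s' assume *: "query_state m j s' \<and> regs s' 12 = c1 v \<and> (\<not> ?root v \<longrightarrow> regs s' 13 = ?F v)" "frame {12, 13, 18} {} s s' j"
    then show "query_state m j s' \<and> regs s' 12 = c1 v \<and> regs s' 13 = t0 \<and> regs s' 10 = i"
      using frame_reg[OF *(2)] nr i by (simp add: t0_def)
  next
    fix s1 assume s1: "query_state m j s1 \<and> regs s1 12 = c1 v \<and> regs s1 13 = t0 \<and> regs s1 10 = i"
    then have q1: "query_state m j s1" and r1: "regs s1 13 = t0" "regs s1 10 = i" by auto
    show "run j ?R {} (1300 * (L + 1)) (Seq (c1_code 13 14 15) (Seq (Assign 16 (Bin Less (Reg 12) (Reg 14)))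
      (Seq (Assign 17 (Num 0)) ?loop))) s1 (\<lambda>s'. query_state m j s' \<and> codeH H i v = 1 + 2 * regs s' 16 + regs s' 17)"
    proof (rule run_Seq[OF run_weaken[OF rc[OF q1 r1(1) t0 r1(2) i(2), where d = 14 and f = 15], where P' = "\<lambda>s'. query_state m j s' \<and>
        regs s' 14 = c1 t0 \<and> (\<not> ?root t0 \<longrightarrow> regs s' 15 = ?F t0) \<and> regs s' 13 = t0 \<and> regs s' 12 = c1 v \<and> regs s' 10 = i" and
        R' = ?R and X' = "{}" and K' = 200]])
      fix s' assume *: "query_state m j s' \<and> regs s' 14 = c1 t0 \<and> (\<not> ?root t0 \<longrightarrow> regs s' 15 = ?F t0)" "frame {14, 15, 18} {} s1 s' j"
      then show "query_state m j s' \<and> regs s' 14 = c1 t0 \<and> (\<not> ?root t0 \<longrightarrow> regs s' 15 = ?F t0) \<and> regs s' 13 = t0 \<and> regs s' 12 = c1 v \<and> regs s' 10 = i"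
        using frame_reg[OF *(2)] s1 by simp
    next
      fix s2 assume s2: "query_state m j s2 \<and> regs s2 14 = c1 t0 \<and> (\<not> ?root t0 \<longrightarrow> regs s2 15 = ?F t0) \<and> regs s2 13 = t0 \<and> regs s2 12 = c1 v \<and> regs s2 10 = i"
      then have q2: "query_state m j s2" by blast
      have e2: "exp_val w (Bin Less (Reg 12) (Reg 14)) s2 = of_bool (dir v)"
        using s2 query_state_regs[OF q2] by (simp add: dir_def t0_def)
      show "run j ?R {} (1000 * (L + 1)) (Seq (Assign 16 (Bin Less (Reg 12) (Reg 14)))
        (Seq (Assign 17 (Num 0)) ?loop)) s2 (\<lambda>s'. query_state m j s' \<and> codeH H i v = 1 + 2 * regs s' 16 + regs s' 17)"
      proof (rule run_Seq[OF run_assign_query[OF q2 e2 _ _ order_refl]])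
        fix s3 assume s3: "query_state m j s3 \<and> regs s3 16 = of_bool (dir v) \<and> frame {16} {} s2 s3 j"
        then have q3: "query_state m j s3" by blast
        have e3: "exp_val w (Num 0) s3 = 0" by simp
        show "run j ?R {} (990 * (L + 1)) (Seq (Assign 17 (Num 0)) ?loop) s3
          (\<lambda>s'. query_state m j s' \<and> codeH H i v = 1 + 2 * regs s' 16 + regs s' 17)"
        proof (rule run_Seq[OF run_assign_query[OF q3 e3 _ _ order_refl]])
          fix s4 assume s4: "query_state m j s4 \<and> regs s4 17 = 0 \<and> frame {17} {} s3 s4 j"
          have r4: "regs s4 16 = of_bool (dir v)" "regs s4 14 = c1 t0" "\<not> ?root t0 \<longrightarrow> regs s4 15 = ?F t0" "regs s4 13 = t0" "regs s4 10 = i"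
            using frame_reg[of "{17}" "{}" s3 s4 j] frame_reg[of "{16}" "{}" s2 s3 j] s4 s3 s2 by simp_all
          have I4: "I s4"
          proof (cases "?root t0")
            case True
            then have "c1 t0 = 0" "run_length v = 0"
              using run_length_stop[of v] by (simp_all add: c1_def stop_def t0_def)
            then show ?thesis using s4 r4 by (simp add: I_def)
          next
            case False
            have "run_length v = (if dir t0 = dir v then Suc (run_length t0) else 0)"
              using run_length_stop[of v] run_length_step[OF v(2) nr] False by (auto simp: stop_def t0_def)
            then show ?thesis unfolding I_def using s4 r4 t0 False by auto
          qed
          have mu: "\<mu> s4 \<le> 2 * L + 2"
            using run_length_le[OF t0] r4 c1_def[of t0] by (auto simp: \<mu>_def)
          show "run j ?R {} (980 * (L + 1)) ?loop s4 (\<lambda>s'. query_state m j s' \<and> codeH H i v = 1 + 2 * regs s' 16 + regs s' 17)"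
          proof (rule run_For[where I = I and \<mu> = \<mu> and B = 300])
            show "I s4" by (rule I4)
            fix s5 assume I5: "I s5" and f5: "frame ?R {} s4 s5 j"
            have e5: "exp_val w (Reg 14) s5 = regs s5 14" using I5 query_state_regs(8)[of m j s5] by (simp add: I_def)
            show "run j ?R {} 300 slot_step s5 (\<lambda>s'. I s' \<and> \<mu> s' < \<mu> s5)" if "exp_val w (Reg 14) s5 \<noteq> 0"
              by (rule step[OF I5]) (use that e5 frame_reg[OF f5] r4 in simp_all)
            show "query_state m j s5 \<and> codeH H i v = 1 + 2 * regs s5 16 + regs s5 17" if z: "exp_val w (Reg 14) s5 = 0"
            proof -
              have "regs s5 14 \<noteq> c1 t" if "t < n" "\<not> ?root t" for t using c1_pos[OF that] z e5 by simp
              then show ?thesis using I5 codev unfolding I_def by auto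
            qed
          next
            have "(1 + exp_cost (Reg 14) + 300) * \<mu> s4 \<le> 302 * (2 * L + 2)"
              using mu by (intro mult_le_mono) auto
            then show "(1 + exp_cost (Reg 14) + 300) * \<mu> s4 + 1 + exp_cost (Reg 14) \<le> 980 * (L + 1)" by simp
          qed
        qed auto
      qed auto
    qed auto
  qed auto
qed

end

section \<open>Base-8 colours and the choice of the scale\<close>

lemma digit_sum_less: "(\<And>i. c i < (8::nat)) \<Longrightarrow> (\<Sum>i<N. c i * 8 ^ i) < 8 ^ N"
proof (induction N)
  case (Suc N)
  then have "(\<Sum>i<N. c i * 8 ^ i) < 8 ^ N" by blast
  moreover have "c N * 8 ^ N \<le> 7 * 8 ^ N" using Suc.prems[of N] by (intro mult_le_mono1) simp
  ultimately have "(\<Sum>i<N. c i * 8 ^ i) + c N * 8 ^ N < 8 ^ N + 7 * 8 ^ N" by (rule add_less_le_mono)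
  then show ?case by simp
qed simp

lemma digit_sum_eq:
  assumes "\<And>i. c i < (8::nat)" "\<And>i. d i < (8::nat)" "(\<Sum>i<N. c i * 8 ^ i) = (\<Sum>i<N. d i * 8 ^ i)" "i < N"
  shows "c i = d i"
  using assms(3,4)
proof (induction N)
  case (Suc N)
  let ?c = "\<Sum>i<N. c i * 8 ^ i" and ?d = "\<Sum>i<N. d i * 8 ^ i"
  have lt: "?c < 8 ^ N" "?d < 8 ^ N" using digit_sum_less assms(1,2) by blast+
  have eq: "?c + c N * 8 ^ N = ?d + d N * 8 ^ N" using Suc.prems(1) by simp
  have "?c = ?d" using arg_cong[OF eq, of "\<lambda>x. x mod 8 ^ N"] lt by simp
  moreover have "c N = d N" using eq \<open>?c = ?d\<close> by simp
  ultimately show ?case using Suc.IH Suc.prems(2) by (cases "i = N") auto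
qed simp

definition find_step :: com where
  "find_step = Seq (Assign 6 (Bin Mul (Num 2) (Reg 6))) (Assign 5 (Bin Add (Reg 5) (Num 1)))"

text \<open>The product of the two comparisons serves as their conjunction. If no scale passes the
  search, the vertex name itself is the colour. All colours are shifted by one so that they start at
  \<open>1\<close>.\<close>

definition query_code :: com where
  "query_code = Seq (Assign 9 (Reg 0)) (Seq (Assign 5 (Num 0)) (Seq (Assign 6 (Num 1))
    (Seq (While (Bin Mul (Bin Less (Num 0) badE) (Bin Less (Reg 6) (Bin Add (Reg 3) (Num 1)))) find_step)
      (Cond (Bin Less (Reg 3) (Reg 6)) (Assign 0 (Bin Add (Reg 9) (Num 1)))
        (Seq slot_loop (Assign 0 (Bin Add (Reg 11) (Num 1))))))))"

definition slot_color :: "(nat \<times> nat \<times> nat \<times> nat \<Rightarrow> nat) \<Rightarrow> nat \<Rightarrow> nat" where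
  "slot_color H v = (\<Sum>i<H (2, v, Suc 0, 0). codeH H i v * 8 ^ i)"

context machine
begin

lemma codeH_less: "slots_ok H \<Longrightarrow> codeH H i v < 8"
  by (rule functional_graph.code_less[OF functional_graphI])

lemma codeH_root: "slots_ok H \<Longrightarrow> H (2, v, Suc 0, 0) \<le> i \<Longrightarrow> codeH H i v = 0"
  by (simp add: functional_graph.code_def[OF functional_graphI])

lemma color_W: "k \<le> 7 * L \<Longrightarrow> 8 ^ k + 8 < W"
proof -
  assume "k \<le> 7 * L"
  then have "(8::nat) ^ k \<le> 8 ^ (7 * L)" by (rule power_increasing) simp
  also have "\<dots> = (2 ^ 3) ^ (7 * L)" by simp
  also have "\<dots> = 2 ^ (3 * (7 * L))" by (simp only: power_mult)
  also have "\<dots> = 2 ^ (21 * L)" by simp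
  finally have 1: "(8::nat) ^ k \<le> 2 ^ (21 * L)" .
  have "(16::nat) \<le> 2 ^ (4 * L)" using power_increasing[of 4 "4 * L" "2::nat"] Lpos by simp
  then have "2 ^ (21 * L) * (16::nat) \<le> 2 ^ (21 * L) * 2 ^ (4 * L)" by (rule mult_le_mono2)
  also have "\<dots> = 2 ^ (25 * L)" by (simp add: power_add[symmetric])
  also have "\<dots> \<le> W" unfolding w_def by (rule power_increasing) auto
  finally have "2 ^ (21 * L) * 16 \<le> W" .
  moreover have "(1::nat) \<le> 2 ^ (21 * L)" by simp
  ultimately show ?thesis using 1 by linarith
qed

lemma val_Shl: "exp_val w d s * 2 ^ exp_val w e s < W \<Longrightarrow> exp_val w (Bin Shl d e) s = exp_val w d s * 2 ^ exp_val w e s"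
  by (simp add: exp_val.simps(4))

lemma run_slot_loop:
  assumes q: "query_state m j s" and ok: "slots_ok (view M m j)" and v: "regs s 9 = v" "v < n"
  defines "H \<equiv> view M m j"
  assumes k: "H (2, v, Suc 0, 0) \<le> N" "N \<le> 7 * L"
  shows "run j {10, 11, 12, 13, 14, 15, 16, 17, 18, 19} {} (2000 * (L + 1) * N + 200) slot_loop s
    (\<lambda>s'. query_state m j s' \<and> regs s' 11 = slot_color H v)"
proof -
  let ?R = "{10, 11, 12, 13, 14, 15, 16, 17, 18, 19} :: nat set"
  define C where "C = H (2, v, Suc 0, 0)"
  define S where "S k = (\<Sum>i<k. codeH H i v * 8 ^ i)" for k
  have okH: "slots_ok H" using ok by (simp add: H_def)
  have CM: "C < M" using okH v nM by (auto simp: slots_ok_def C_def intro: le_less_trans)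
  define I where "I s1 \<longleftrightarrow> query_state m j s1 \<and> regs s1 10 \<le> C \<and> regs s1 11 = S (regs s1 10)" for s1
  let ?step = "Seq slot_code (Seq
        (Assign 11 (Bin Add (Reg 11) (Bin Shl (Bin Add (Bin Add (Num 1) (Bin Mul (Num 2) (Reg 16))) (Reg 17))
          (Bin Mul (Num 3) (Reg 10)))))
        (Assign 10 (Bin Add (Reg 10) (Num 1))))"
  have e0: "exp_val w (Num 0) s = 0" for s by simp
  show ?thesis unfolding slot_loop_def
  proof (rule run_Seq[OF run_assign_query[OF q e0 _ _ order_refl]])
    fix s1 assume s1: "query_state m j s1 \<and> regs s1 11 = 0 \<and> frame {11} {} s s1 j"
    then have q1: "query_state m j s1" and r1: "regs s1 9 = v" using frame_reg[of "{11}" "{}" s s1 j] v by auto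
    show "run j ?R {} (2000 * (L + 1) * N + 150) (Seq (Assign 10 (Num 0))
      (While (Bin Less (Reg 10) (cell 2 (Reg 9) (Num 1) (Num 0))) ?step)) s1 (\<lambda>s'. query_state m j s' \<and> regs s' 11 = slot_color H v)"
    proof (rule run_Seq[OF run_assign_query[OF q1 e0 _ _ order_refl]])
      fix s2 assume s2: "query_state m j s2 \<and> regs s2 10 = 0 \<and> frame {10} {} s1 s2 j"
      then have r2: "regs s2 11 = 0" "regs s2 10 = 0" "regs s2 9 = v" using frame_reg[of "{10}" "{}" s1 s2 j] s1 r1 by auto
      show "run j ?R {} (2000 * (L + 1) * N + 100) (While (Bin Less (Reg 10) (cell 2 (Reg 9) (Num 1) (Num 0))) ?step) s2
        (\<lambda>s'. query_state m j s' \<and> regs s' 11 = slot_color H v)"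
      proof (rule run_For[where I = I and \<mu> = "\<lambda>s. C - regs s 10" and B = "1600 * (L + 1)"])
        show "I s2" using s2 r2 by (simp add: I_def S_def)
        fix s3 assume I3: "I s3" and f3: "frame ?R {} s2 s3 j"
        let ?i = "regs s3 10"
        have q3: "query_state m j s3" and le: "?i \<le> C" and r3: "regs s3 11 = S ?i" "regs s3 9 = v"
          using I3 frame_reg[OF f3] r2 by (auto simp: I_def)
        have "exp_val w (cell 2 (Reg 9) (Num 1) (Num 0)) s3 = C"
          using val_cell[of s3 2 "Reg 9" "Num 1" "Num 0"] query_state_regs[OF q3] r3 v nM q3 by (simp add: H_def C_def query_state_def)
        then have cond: "exp_val w (Bin Less (Reg 10) (cell 2 (Reg 9) (Num 1) (Num 0))) s3 = of_bool (?i < C)"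
          using query_state_regs[OF q3] by simp
        {
          assume "exp_val w (Bin Less (Reg 10) (cell 2 (Reg 9) (Num 1) (Num 0))) s3 = 0"
          then have "?i = C" using le by (simp only: cond) simp
          then show "query_state m j s3 \<and> regs s3 11 = slot_color H v" using q3 r3 by (simp add: S_def slot_color_def C_def)
        }
        assume "exp_val w (Bin Less (Reg 10) (cell 2 (Reg 9) (Num 1) (Num 0))) s3 \<noteq> 0"
        then have i: "?i < C" by (simp only: cond) simp
        have iM: "?i < M" using i CM by linarith
        have nr: "\<not> rootH (view M m j) ?i v" using i by (simp add: C_def H_def)
        show "run j ?R {} (1600 * (L + 1)) ?step s3 (\<lambda>s'. I s' \<and> C - regs s' 10 < C - regs s3 10)"
        proof (rule run_Seq[OF run_weaken[OF run_slot_code[OF q3 ok r3(2) v(2) refl iM nr], where R' = ?R and X' = "{}" and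
              K' = "1500 * (L + 1)" and P' = "\<lambda>s'. query_state m j s' \<and> codeH H ?i v = 1 + 2 * regs s' 16 + regs s' 17 \<and>
              regs s' 10 = ?i \<and> regs s' 11 = S ?i"]])
          fix s' assume *: "query_state m j s' \<and> codeH (view M m j) ?i v = 1 + 2 * regs s' 16 + regs s' 17"
            "frame {12, 13, 14, 15, 16, 17, 18, 19} {} s3 s' j"
          then show "query_state m j s' \<and> codeH H ?i v = 1 + 2 * regs s' 16 + regs s' 17 \<and> regs s' 10 = ?i \<and> regs s' 11 = S ?i"
            using frame_reg[OF *(2)] r3 by (simp add: H_def)
        next
          fix s4 assume s4: "query_state m j s4 \<and> codeH H ?i v = 1 + 2 * regs s4 16 + regs s4 17 \<and> regs s4 10 = ?i \<and> regs s4 11 = S ?i"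
          then have q4: "query_state m j s4" by blast
          have c8: "1 + 2 * regs s4 16 + regs s4 17 < 8" using codeH_less[OF okH, of ?i v] s4 by simp
          have "S (Suc ?i) < 8 ^ Suc ?i" unfolding S_def by (rule digit_sum_less) (rule codeH_less[OF okH])
          moreover have "(8::nat) ^ Suc ?i + 8 < W" by (rule color_W) (use i k in \<open>simp add: C_def\<close>)
          ultimately have SW: "S ?i + (1 + 2 * regs s4 16 + regs s4 17) * 8 ^ ?i < W" using s4 by (simp add: S_def)
          have p8: "(2::nat) ^ (3 * ?i) = 8 ^ ?i" by (simp add: power_mult)
          have iW: "3 * ?i < W" using i k LM M_W C_def by linarith
          have e4: "exp_val w (Bin Add (Reg 11) (Bin Shl (Bin Add (Bin Add (Num 1) (Bin Mul (Num 2) (Reg 16))) (Reg 17))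
            (Bin Mul (Num 3) (Reg 10)))) s4 = S (Suc ?i)"
          proof -
            have v1: "exp_val w (Bin Add (Bin Add (Num 1) (Bin Mul (Num 2) (Reg 16))) (Reg 17)) s4 = 1 + 2 * regs s4 16 + regs s4 17"
              using query_state_regs[OF q4] c8 M_W M32 by (simp add: val_Mul)
            have v2: "exp_val w (Bin Mul (Num 3) (Reg 10)) s4 = 3 * ?i"
              using query_state_regs[OF q4] s4 iW by (simp add: val_Mul)
            have v3: "exp_val w (Bin Shl (Bin Add (Bin Add (Num 1) (Bin Mul (Num 2) (Reg 16))) (Reg 17)) (Bin Mul (Num 3) (Reg 10))) s4
              = (1 + 2 * regs s4 16 + regs s4 17) * 8 ^ ?i"
            proof -
              have "(1 + 2 * regs s4 16 + regs s4 17) * 8 ^ ?i < W" using SW by linarith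
              then show ?thesis using val_Shl[of "Bin Add (Bin Add (Num 1) (Bin Mul (Num 2) (Reg 16))) (Reg 17)" s4
                "Bin Mul (Num 3) (Reg 10)"] by (simp only: v1 v2 p8)
            qed
            have "exp_val w (Reg 11) s4 = S ?i" using query_state_regs[OF q4] s4 by simp
            then show ?thesis using SW s4 by (subst ev_Add) (simp_all only: v3, simp_all add: S_def)
          qed
          show "run j ?R {} (60 + 10) (Seq
              (Assign 11 (Bin Add (Reg 11) (Bin Shl (Bin Add (Bin Add (Num 1) (Bin Mul (Num 2) (Reg 16))) (Reg 17))
                (Bin Mul (Num 3) (Reg 10)))))
              (Assign 10 (Bin Add (Reg 10) (Num 1)))) s4 (\<lambda>s'. I s' \<and> C - regs s' 10 < C - regs s3 10)"
          proof (rule run_Seq[OF run_assign_query[OF q4 e4 _ _ order_refl]])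
            fix s5 assume s5: "query_state m j s5 \<and> regs s5 11 = S (Suc ?i) \<and> frame {11} {} s4 s5 j"
            then have q5: "query_state m j s5" and r5: "regs s5 10 = ?i" using frame_reg[of "{11}" "{}" s4 s5 j] s4 by auto
            have e5: "exp_val w (Bin Add (Reg 10) (Num 1)) s5 = Suc ?i"
              using query_state_regs[OF q5] r5 iM M_W by simp
            show "run j ?R {} 10 (Assign 10 (Bin Add (Reg 10) (Num 1))) s5 (\<lambda>s'. I s' \<and> C - regs s' 10 < C - regs s3 10)"
            proof (rule run_weaken[OF run_assign_query[OF q5 e5 _ _ order_refl, of 10 ?R]])
              fix s6 assume s6: "query_state m j s6 \<and> regs s6 10 = Suc ?i \<and> frame {10} {} s5 s6 j"
              then show "I s6 \<and> C - regs s6 10 < C - regs s3 10"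
                using frame_reg[of "{10}" "{}" s5 s6 j] s5 i by (simp add: I_def)
            qed auto
          qed auto
        qed auto
      next
        have "(1 + exp_cost (Bin Less (Reg 10) (cell 2 (Reg 9) (Num 1) (Num 0))) + 1600 * (L + 1)) * (C - regs s2 10)
          \<le> (2000 * (L + 1)) * N"
          using k C_def by (intro mult_le_mono) auto
        then show "(1 + exp_cost (Bin Less (Reg 10) (cell 2 (Reg 9) (Num 1) (Num 0))) + 1600 * (L + 1)) * (C - regs s2 10) + 1 +
          exp_cost (Bin Less (Reg 10) (cell 2 (Reg 9) (Num 1) (Num 0))) \<le> 2000 * (L + 1) * N + 100" by simp
      qed
    qed auto
  qed auto
qed

text \<open>Indices with \<open>2 ^ j > L\<close>, for which no copies are maintained, count as not
  crowded. Hence a least such index always exists, and if it satisfies \<open>L < 2 ^ j\<close>,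
  every maintained scale is crowded.\<close>

definition crowded where
  "crowded m j \<longleftrightarrow> view M m j (5, 0, 0, 0) \<noteq> 0 \<and> 2 ^ j \<le> L"

definition level where
  "level m = (LEAST j. \<not> crowded m j)"

definition query_color where
  "query_color m v = (if L < 2 ^ level m then v + 1 else slot_color (view M m (level m)) v + 1)"

lemma not_crowded_L: "\<not> crowded m L"
  using less_exp[of L] unfolding crowded_def by linarith

lemma not_crowded_level: "\<not> crowded m (level m)"
  unfolding level_def by (rule LeastI[of _ L]) (rule not_crowded_L)

lemma crowded_below_level: "j < level m \<Longrightarrow> crowded m j"
  unfolding level_def using not_less_Least by blast

lemma level_le: "level m \<le> L"
  unfolding level_def by (rule Least_le) (rule not_crowded_L)

lemma wp_find:
  assumes s: "wf_state s" "mem s = m" "regs s 5 = 0" "regs s 6 = 1" "regs s 9 = v"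
  shows "wp w (While (Bin Mul (Bin Less (Num 0) badE) (Bin Less (Reg 6) (Bin Add (Reg 3) (Num 1)))) find_step) s
    (\<lambda>T s'. T \<le> 100 * (L + 1) \<and> query_state m (level m) s' \<and> regs s' 6 = 2 ^ level m \<and> regs s' 9 = v)"
proof -
  let ?e = "Bin Mul (Bin Less (Num 0) badE) (Bin Less (Reg 6) (Bin Add (Reg 3) (Num 1)))"
  define I where "I s \<longleftrightarrow> query_state m (regs s 5) s \<and> regs s 9 = v \<and> regs s 5 \<le> level m \<and> regs s 6 = 2 ^ regs s 5" for s
  have LW: "2 * L + 2 < W" using LM M_W by linarith
  have cond: "exp_val w ?e s = of_bool (crowded m (regs s 5))" if "I s" for s
  proof -
    from that have q: "query_state m (regs s 5) s" and k: "regs s 6 = 2 ^ regs s 5" by (auto simp: I_def)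
    have "exp_val w badE s = view M m (regs s 5) (5, 0, 0, 0)"
      using val_cell[of s 5 "Num 0" "Num 0" "Num 0"] query_state_regs[OF q] q by (simp add: query_state_def)
    then show ?thesis using query_state_regs[OF q] k LW M_W M32
      by (simp add: val_Mul crowded_def less_Suc_eq_le)
  qed
  have "wp w (While ?e find_step) s (\<lambda>T s'. I s' \<and> exp_val w ?e s' = 0 \<and> T \<le> 70 * (level m - regs s 5) + 1 + exp_cost ?e)"
  proof (rule wp_For[where I = I and \<mu> = "\<lambda>s. level m - regs s 5"])
    show "I s" using s LM M_W by (simp add: I_def query_state_def)
    fix s1 assume I: "I s1" and "exp_val w ?e s1 \<noteq> 0"
    then have c: "crowded m (regs s1 5)" by (simp only: cond) simp
    let ?j = "regs s1 5"
    from I have q: "query_state m ?j s1" and k: "regs s1 6 = 2 ^ ?j" "regs s1 9 = v" and le: "?j \<le> level m" by (auto simp: I_def)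
    have lt: "?j < level m" using c not_crowded_level[of m] le by (metis le_neq_implies_less)
    have "2 ^ ?j \<le> L" using c by (simp add: crowded_def)
    then have e1: "exp_val w (Bin Mul (Num 2) (Reg 6)) s1 = 2 ^ Suc ?j" "(2::nat) ^ Suc ?j < W"
      using query_state_regs[OF q] k LW by (simp_all add: val_Mul)
    have jM: "Suc ?j < M" using lt level_le[of m] LM by linarith
    have e2: "exp_val w (Bin Add (Reg 5) (Num 1)) (s1\<lparr>regs := (regs s1)(6 := 2 ^ Suc ?j)\<rparr>) = Suc ?j"
      using q jM M_W e1(2) by (simp add: query_state_def wf_state_def)
    show "wp w find_step s1 (\<lambda>t s'. I s' \<and> level m - regs s' 5 < level m - regs s1 5 \<and> 1 + exp_cost ?e + t \<le> 70)"
      unfolding find_step_def wp_Seq wp_Assign e1 e2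
      using q k lt jM M_W e1(2) by (auto simp: I_def query_state_def wf_state_def)
  qed
  then show ?thesis
  proof (rule wp_mono)
    fix T s' assume *: "I s' \<and> exp_val w ?e s' = 0 \<and> T \<le> 70 * (level m - regs s 5) + 1 + exp_cost ?e"
    then have I: "I s'" by blast
    have "of_bool (crowded m (regs s' 5)) = (0::nat)" using * by (simp only: cond[OF I, symmetric])
    then have "\<not> crowded m (regs s' 5)" by simp
    then have "regs s' 5 = level m" using crowded_below_level I by (metis I_def le_neq_implies_less)
    moreover have "T \<le> 70 * L + 100"
    proof -
      have "T \<le> 70 * (level m - regs s 5) + 27" using * by simp
      moreover have "level m - regs s 5 \<le> L" using level_le[of m] by simp
      ultimately show ?thesis by linarith
    qed
    ultimately show "T \<le> 100 * (L + 1) \<and> query_state m (level m) s' \<and> regs s' 6 = 2 ^ level m \<and> regs s' 9 = v"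
      using I by (auto simp: I_def)
  qed
qed

lemma wp_query:
  assumes s: "wf_state s" "mem s = m" "regs s 0 = v" "v < n"
    and ok: "2 ^ level m \<le> L \<Longrightarrow> slots_ok (view M m (level m)) \<and> view M m (level m) (2, v, Suc 0, 0) \<le> N \<and> N \<le> 7 * L"
  shows "wp w query_code s (\<lambda>T s'. T \<le> 2000 * (L + 1) * N + 500 * (L + 1) \<and> wf_state s' \<and> mem s' = m \<and> regs s' 0 = query_color m v)"
proof -
  let ?W = "While (Bin Mul (Bin Less (Num 0) badE) (Bin Less (Reg 6) (Bin Add (Reg 3) (Num 1)))) find_step"
  let ?C = "Cond (Bin Less (Reg 3) (Reg 6)) (Assign 0 (Bin Add (Reg 9) (Num 1)))
        (Seq slot_loop (Assign 0 (Bin Add (Reg 11) (Num 1))))"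
  define s0 where "s0 = s\<lparr>regs := (regs s)(9 := v, 5 := 0, 6 := 1)\<rparr>"
  have vW: "v < W" "v + 1 < W" "1 < W" using s(4) nM M_W by linarith+
  have s0: "wf_state s0" "mem s0 = m" "regs s0 5 = 0" "regs s0 6 = 1" "regs s0 9 = v"
    using s vW by (simp_all add: s0_def wf_state_def)
  have e: "exp_val w (Reg 0) s = v" "exp_val w (Num 0) s' = 0" "exp_val w (Num 1) s' = 1" for s'
    using s by (simp_all add: wf_state_def)
  have "wp w (Seq ?W ?C) s0 (\<lambda>T s'. T \<le> 2000 * (L + 1) * N + 400 * (L + 1) \<and> wf_state s' \<and> mem s' = m \<and> regs s' 0 = query_color m v)"
  proof (rule wp_SeqI[OF wp_find[OF s0]])
    fix T s1 assume *: "T \<le> 100 * (L + 1) \<and> query_state m (level m) s1 \<and> regs s1 6 = 2 ^ level m \<and> regs s1 9 = v"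
    then have q1: "query_state m (level m) s1" and r1: "regs s1 9 = v" by auto
    have cond: "exp_val w (Bin Less (Reg 3) (Reg 6)) s1 = of_bool (L < 2 ^ level m)"
      using * query_state_regs[OF q1] by simp
    have "run (level m) UNIV {} (2000 * (L + 1) * N + 300 * (L + 1)) ?C s1 (\<lambda>s'. query_state m (level m) s' \<and> regs s' 0 = query_color m v)"
    proof (rule run_Cond[where K = "2000 * (L + 1) * N + 250 * (L + 1)"])
      assume "exp_val w (Bin Less (Reg 3) (Reg 6)) s1 \<noteq> 0"
      then have c: "L < 2 ^ level m" by (simp only: cond) simp
      have e1: "exp_val w (Bin Add (Reg 9) (Num 1)) s1 = query_color m v"
        using r1 query_state_regs[OF q1] vW c by (simp add: query_color_def)
      show "run (level m) UNIV {} (2000 * (L + 1) * N + 250 * (L + 1)) (Assign 0 (Bin Add (Reg 9) (Num 1))) s1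
        (\<lambda>s'. query_state m (level m) s' \<and> regs s' 0 = query_color m v)"
        by (rule run_weaken[OF run_assign_query[OF q1 e1 _ _ order_refl, of 0 UNIV]]) auto
    next
      assume "exp_val w (Bin Less (Reg 3) (Reg 6)) s1 = 0"
      then have c: "\<not> L < 2 ^ level m" by (simp only: cond) simp
      then have ok': "slots_ok (view M m (level m))" "view M m (level m) (2, v, Suc 0, 0) \<le> N" "N \<le> 7 * L" using ok by auto
      show "run (level m) UNIV {} (2000 * (L + 1) * N + 250 * (L + 1)) (Seq slot_loop (Assign 0 (Bin Add (Reg 11) (Num 1)))) s1
        (\<lambda>s'. query_state m (level m) s' \<and> regs s' 0 = query_color m v)"
      proof (rule run_Seq[OF run_weaken[OF run_slot_loop[OF q1 ok'(1) r1 s(4) ok'(2,3)], where R' = UNIV and X' = "{}" and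
            K' = "2000 * (L + 1) * N + 200" and P' = "\<lambda>s'. query_state m (level m) s' \<and> regs s' 11 = slot_color (view M m (level m)) v"]])
        fix s2 assume s2: "query_state m (level m) s2 \<and> regs s2 11 = slot_color (view M m (level m)) v"
        then have q2: "query_state m (level m) s2" by blast
        have "slot_color (view M m (level m)) v < 8 ^ view M m (level m) (2, v, Suc 0, 0)"
          unfolding slot_color_def by (rule digit_sum_less) (rule codeH_less[OF ok'(1)])
        moreover have "8 ^ view M m (level m) (2, v, Suc 0, 0) + 8 < W" by (rule color_W) (use ok' in simp)
        ultimately have e2: "exp_val w (Bin Add (Reg 11) (Num 1)) s2 = query_color m v"
          using s2 query_state_regs[OF q2] c by (simp add: query_color_def)
        show "run (level m) UNIV {} 10 (Assign 0 (Bin Add (Reg 11) (Num 1))) s2 (\<lambda>s'. query_state m (level m) s' \<and> regs s' 0 = query_color m v)"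
          by (rule run_weaken[OF run_assign_query[OF q2 e2 _ _ order_refl, of 0 UNIV]]) auto
      qed auto
    qed simp
    then show "wp w ?C s1 (\<lambda>T' s'. T + T' \<le> 2000 * (L + 1) * N + 400 * (L + 1) \<and> wf_state s' \<and> mem s' = m \<and> regs s' 0 = query_color m v)"
      unfolding run_def by (rule wp_mono) (use * in \<open>auto simp: query_state_def\<close>)
  qed
  note main = this
  have s0eq: "((s\<lparr>regs := (regs s)(9 := v)\<rparr>)\<lparr>regs := (regs (s\<lparr>regs := (regs s)(9 := v)\<rparr>))(5 := 0)\<rparr>)
    \<lparr>regs := (regs ((s\<lparr>regs := (regs s)(9 := v)\<rparr>)\<lparr>regs := (regs (s\<lparr>regs := (regs s)(9 := v)\<rparr>))(5 := 0)\<rparr>))(6 := 1)\<rparr> = s0"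
    by (simp add: s0_def)
  show ?thesis
    unfolding query_code_def wp_Seq[of w "Assign 9 (Reg 0)"] wp_Seq[of w "Assign 5 (Num 0)"] wp_Seq[of w "Assign 6 (Num 1)"]
      wp_Assign e s0eq
    by (rule wp_mono[OF main]) auto
qed

end

section \<open>Initialization and the number of colours\<close>

definition init_code :: com where
  "init_code = Seq (Assign 2 (Bin Mul (Num 16) (Reg 0))) (Seq (Assign 6 (Num 1))
    (Seq (While (Bin Less (Reg 6) (Bin Add (Reg 0) (Num 1)))
      (Seq (Assign 6 (Bin Mul (Num 2) (Reg 6))) (Assign 3 (Bin Add (Reg 3) (Num 1)))))
      (Assign 4 (Bin Mul (Num 7) (Reg 3)))))"

definition coloring_structure :: data_structure where
  "coloring_structure = \<lparr>initialize = init_code, insert_edge = update insert_copy,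
     delete_edge = update delete_copy, query = query_code\<rparr>"

text \<open>Each out-neighbour counted here takes at least \<open>Suc h\<close> copies of the
  outdegree. This turns the bound on copies into a bound on owned edges.\<close>

lemma card_heavy:
  assumes "balanced n x l wt"
  shows "card {v. h < x u v} * Suc h \<le> outdeg n x u"
proof -
  have "card {v. h < x u v} * Suc h = (\<Sum>v\<in>{v. h < x u v}. Suc h)" by simp
  also have "\<dots> \<le> (\<Sum>v\<in>{v. h < x u v}. x u v)" by (rule sum_mono) auto
  also have "\<dots> \<le> outdeg n x u"
  proof -
    have "{v. h < x u v} \<subseteq> {..<n}"
    proof
      fix v assume "v \<in> {v. h < x u v}"
      then have "0 < x u v" by auto
      then show "v \<in> {..<n}" using balancedD(2)[OF assms] by simp
    qed
    then show ?thesis unfolding outdeg_def by (intro sum_mono2) auto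
  qed
  finally show ?thesis .
qed

context machine
begin

lemma represents_scale:
  assumes "represents s E" "2 ^ j \<le> L"
  obtains x where "balanced n x (labels Cap (outdeg n x)) (edge_weight E (copies j))"
    "\<And>u t. u < n \<Longrightarrow> t < M \<Longrightarrow> sets (halfs j) x (labels Cap (outdeg n x)) u t \<subseteq> {..<n} \<and>
      setrep (view M (mem s) j) u t (sets (halfs j) x (labels Cap (outdeg n x)) u t)"
    "view M (mem s) j (5, 0, 0, 0) = count_full n Cap (outdeg n x)"
proof -
  from assms have "good_at s j (edge_weight E (copies j))" by (simp add: represents_def)
  then obtain x where "chain (s\<lparr>regs := (regs s)(5 := j, 7 := halfs j)\<rparr>) j (halfs j) x (outdeg n x) (edge_weight E (copies j))"
    by (auto simp: good_at_def good_def)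
  from chainD(1,2)[OF this] show ?thesis by (intro that[of x]) (auto simp: scale_def)
qed

lemma heavy_setrep:
  assumes "\<And>u t. u < n \<Longrightarrow> t < M \<Longrightarrow> sets h x l u t \<subseteq> {..<n} \<and> setrep H u t (sets h x l u t)" "p < n"
  shows "setrep H p (Suc 0) {v. h < x p v}" "{v. h < x p v} \<subseteq> {..<n}"
  using assms(1)[of p "Suc 0"] assms(2) by (simp_all add: sets_def)

lemma balanced_loop:
  assumes "graph_on n E" "balanced n x l (edge_weight E B)"
  shows "x p p = 0"
proof -
  have "{p} \<notin> E" using graph_onD[OF assms(1), of "{p}"] by auto
  then have "edge_weight E B p p = 0" by (simp add: edge_weight_def)
  then show ?thesis using balanced_sum[OF assms(2), of p p] by simp
qed

lemma represents_slots_ok: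
  assumes "represents s E" "2 ^ j \<le> L"
  shows "slots_ok (view M (mem s) j)"
proof -
  obtain x where bal: "balanced n x (labels Cap (outdeg n x)) (edge_weight E (copies j))"
    and sets: "\<And>u t. u < n \<Longrightarrow> t < M \<Longrightarrow> sets (halfs j) x (labels Cap (outdeg n x)) u t \<subseteq> {..<n} \<and>
      setrep (view M (mem s) j) u t (sets (halfs j) x (labels Cap (outdeg n x)) u t)"
    by (rule represents_scale[OF assms]) blast
  have g: "graph_on n E" using assms by (simp add: represents_def)
  show ?thesis
    unfolding slots_ok_def
  proof (intro allI impI conjI)
    fix p assume p: "p < n"
    note h = heavy_setrep[OF sets p]
    have c: "view M (mem s) j (2, p, Suc 0, 0) = card {v. halfs j < x p v}" by (rule setrep_card[OF h(1)])
    show "view M (mem s) j (2, p, Suc 0, 0) \<le> n" unfolding c using card_mono[OF _ h(2)] by simp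
    fix i assume "i < view M (mem s) j (2, p, Suc 0, 0)"
    then have "view M (mem s) j (0, p, Suc 0, i) \<in> {v. halfs j < x p v}" using setrep_nth[OF h(1)] c by simp
    then show "view M (mem s) j (0, p, Suc 0, i) < n" "view M (mem s) j (0, p, Suc 0, i) \<noteq> p"
      using h(2) balanced_loop[OF g bal, of p] by auto
  qed
qed

text \<open>A vertex at the cap certifies that the arboricity is large. The query can thus compare
  its scale with the current arboricity without ever computing the latter.\<close>

lemma represents_crowded:
  assumes "represents s E" "crowded (mem s) j"
  shows "2 ^ j < arboricity E"
proof (rule ccontr)
  assume "\<not> ?thesis"
  then have le: "arboricity E \<le> 2 ^ j" by simp
  from assms have j: "2 ^ j \<le> L" and b: "view M (mem s) j (5, 0, 0, 0) \<noteq> 0" by (auto simp: crowded_def)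
  obtain x where bal: "balanced n x (labels Cap (outdeg n x)) (edge_weight E (copies j))"
    and v: "view M (mem s) j (5, 0, 0, 0) = count_full n Cap (outdeg n x)"
    by (rule represents_scale[OF assms(1) j]) blast
  have g: "graph_on n E" using assms by (simp add: represents_def)
  \<comment> \<open>The origin of the constant \<open>7\<close>:
    \<open>copies j * 2 ^ j \<le> 2 * L + 2 ^ j \<le> 3 * L\<close>, twice this is
    \<open>6 * L\<close>, and the remaining \<open>L\<close> is the slack of the doubling
    argument.\<close>
  have "copies j * arboricity E \<le> copies j * 2 ^ j" using le by (rule mult_le_mono2)
  also have "\<dots> = 2 * (halfs j * 2 ^ j) + 2 ^ j" by (simp add: algebra_simps)
  also have "\<dots> \<le> 3 * L" using div_times_less_eq_dividend[of L "2 ^ j"] j by linarith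
  finally have cap: "2 * copies j * arboricity E + L \<le> Cap" by (simp add: Cap_def mult.assoc)
  have Cpos: "0 < Cap" using Lpos by (simp add: Cap_def)
  have lab: "labels Cap (outdeg n x) = (\<lambda>u. min (outdeg n x u) Cap)" by (simp add: labels_def fun_eq_iff)
  have "outdeg n x u < Cap" if "u < n" for u
    by (rule balanced_outdeg_lt[OF bal[unfolded lab] g cap nL that Cpos])
  then have "{u. u < n \<and> Cap \<le> outdeg n x u} = {}" using not_less by blast
  then have "count_full n Cap (outdeg n x) = 0" unfolding count_full_def by (simp only: card.empty)
  then show False using b v by simp
qed

text \<open>Without full vertices the outdegree is below \<open>7 * L\<close>, while every majority
  edge uses more than \<open>L / 2 ^ j\<close> copies; this leaves fewer than
  \<open>7 * 2 ^ j\<close> edges. Since the preceding scale is crowded, \<open>2 ^ j\<close> is less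
  than twice the arboricity.\<close>

lemma represents_slots_bound:
  assumes represents: "represents s E" and j: "2 ^ level (mem s) \<le> L" and p: "p < n"
  shows "view M (mem s) (level (mem s)) (2, p, Suc 0, 0) \<le> 14 * arboricity E"
    "view M (mem s) (level (mem s)) (2, p, Suc 0, 0) \<le> 7 * L"
proof -
  let ?j = "level (mem s)"
  obtain x where bal: "balanced n x (labels Cap (outdeg n x)) (edge_weight E (copies ?j))"
    and sets: "\<And>u t. u < n \<Longrightarrow> t < M \<Longrightarrow> sets (halfs ?j) x (labels Cap (outdeg n x)) u t \<subseteq> {..<n} \<and>
      setrep (view M (mem s) ?j) u t (sets (halfs ?j) x (labels Cap (outdeg n x)) u t)"
    and v: "view M (mem s) ?j (5, 0, 0, 0) = count_full n Cap (outdeg n x)"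
    by (rule represents_scale[OF represents j]) blast
  have g: "graph_on n E" using represents by (simp add: represents_def)
  let ?S = "{v. halfs ?j < x p v}"
  have c: "view M (mem s) ?j (2, p, Suc 0, 0) = card ?S" by (rule setrep_card[OF heavy_setrep(1)[OF sets p]])
  have "count_full n Cap (outdeg n x) = 0" using not_crowded_level[of "mem s"] j v by (simp add: crowded_def)
  then have "{u. u < n \<and> Cap \<le> outdeg n x u} = {}" unfolding count_full_def by simp
  then have d: "outdeg n x p < 7 * L" using p unfolding Cap_def by (metis (mono_tags, lifting) empty_Collect_eq not_le)
  have lt: "card ?S < 7 * 2 ^ ?j"
  proof (rule ccontr)
    assume "\<not> ?thesis"
    then have "7 * 2 ^ ?j * Suc (halfs ?j) \<le> card ?S * Suc (halfs ?j)" by (intro mult_le_mono1) simp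
    also have "\<dots> < 7 * L" using card_heavy[OF bal] d by (rule le_less_trans)
    finally have "2 ^ ?j * Suc (halfs ?j) < L" by simp
    moreover have "L < 2 ^ ?j * Suc (halfs ?j)" using dividend_less_times_div[of "2 ^ ?j" L] by simp
    ultimately show False by simp
  qed
  show "view M (mem s) ?j (2, p, Suc 0, 0) \<le> 7 * L" using lt j c by simp
  show "view M (mem s) ?j (2, p, Suc 0, 0) \<le> 14 * arboricity E"
  proof (cases "?j")
    case (Suc i)
    then have "2 ^ i < arboricity E" using represents_crowded[OF represents crowded_below_level[of i]] by simp
    then show ?thesis using lt c Suc by simp
  next
    \<comment> \<open>There is no preceding scale to compare with. Fewer than seven slots are fine
      as soon as there is an edge, and without edges all lists are empty.\<close>
    case 0
    show ?thesis
    proof (cases "E = {}")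
      case True
      then have "edge_weight E B u v = 0" for B u v by (simp add: edge_weight_def)
      then have "x p v = 0" for v using balanced_sum[OF bal, of p v] by simp
      then show ?thesis using c by simp
    next
      case False
      then have "0 < arboricity E" using arboricity_pos[OF graph_on_finite[OF g]] by blast
      then show ?thesis using lt 0 c by simp
    qed
  qed
qed

text \<open>At most \<open>14 * arboricity E\<close> digits of three bits each give the exponent
  \<open>42 * arboricity E\<close>. When vertex names are used, the last maintained scale is
  crowded, so \<open>L\<close> is less than twice the arboricity and names below
  \<open>2 ^ L\<close> also fit.\<close>

lemma query_color_range:
  assumes represents: "represents s E" and v: "v < n"
  shows "query_color (mem s) v \<in> {1..2 ^ (42 * arboricity E)}"
proof (cases "L < 2 ^ level (mem s)")
  case True
  then obtain i where i: "level (mem s) = Suc i" using Lpos by (cases "level (mem s)") auto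
  then have "2 ^ i < arboricity E" using represents_crowded[OF represents crowded_below_level[of i]] by simp
  then have "L \<le> 42 * arboricity E" using True i by simp
  then have "(2::nat) ^ L \<le> 2 ^ (42 * arboricity E)" by (rule power_increasing) simp
  then have "v + 1 \<le> 2 ^ (42 * arboricity E)" using v nL by linarith
  then show ?thesis using True by (simp add: query_color_def)
next
  case False
  let ?H = "view M (mem s) (level (mem s))"
  have j: "2 ^ level (mem s) \<le> L" using False by simp
  have "slot_color ?H v < 8 ^ ?H (2, v, Suc 0, 0)"
    unfolding slot_color_def by (rule digit_sum_less) (rule codeH_less[OF represents_slots_ok[OF represents j]])
  also have "\<dots> \<le> 8 ^ (14 * arboricity E)" by (rule power_increasing[OF represents_slots_bound(1)[OF represents j v]]) simp
  also have "\<dots> = (2 ^ 3) ^ (14 * arboricity E)" by simp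
  also have "\<dots> = 2 ^ (3 * (14 * arboricity E))" by (simp only: power_mult)
  finally show ?thesis using False by (simp add: query_color_def)
qed

text \<open>Beyond its own list a vertex is a root and has the digit \<open>0\<close>. The colours
  of two vertices can therefore be written with a common number of digits.\<close>

lemma slot_color_extend:
  assumes "slots_ok H" "H (2, v, Suc 0, 0) \<le> N"
  shows "slot_color H v = (\<Sum>i<N. codeH H i v * 8 ^ i)"
  unfolding slot_color_def
  by (rule sum.mono_neutral_left) (use assms codeH_root[OF assms(1)] in auto)

text \<open>The number of copies is odd, so one end sends a majority of them to the other and lists
  it in some slot \<open>i\<close>. There the two vertices are joined in a functional graph, and the
  digits at position \<open>i\<close> differ.\<close>

lemma query_color_proper:
  assumes represents: "represents s E" and e: "{u, v} \<in> E"
  shows "query_color (mem s) u \<noteq> query_color (mem s) v"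
proof (cases "L < 2 ^ level (mem s)")
  case True
  have "u \<noteq> v" using graph_onD[OF _ e, of n] represents by (auto simp: represents_def doubleton_eq_iff)
  then show ?thesis using True by (simp add: query_color_def)
next
  case False
  let ?j = "level (mem s)"
  let ?H = "view M (mem s) ?j"
  have j: "2 ^ ?j \<le> L" using False by simp
  note ok = represents_slots_ok[OF represents j]
  obtain x where bal: "balanced n x (labels Cap (outdeg n x)) (edge_weight E (copies ?j))"
    and sets: "\<And>u t. u < n \<Longrightarrow> t < M \<Longrightarrow> sets (halfs ?j) x (labels Cap (outdeg n x)) u t \<subseteq> {..<n} \<and>
      setrep ?H u t (sets (halfs ?j) x (labels Cap (outdeg n x)) u t)"
    by (rule represents_scale[OF represents j]) blast
  have main: "slot_color ?H a \<noteq> slot_color ?H b" if h: "halfs ?j < x a b" for a b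
  proof
    assume eq: "slot_color ?H a = slot_color ?H b"
    have a: "a < n" using balancedD(1)[OF bal, of a b] h by simp
    note hs = heavy_setrep(1)[OF sets a]
    define i where "i = ?H (1, a, Suc 0, b)"
    have b: "b \<in> {v. halfs ?j < x a v}" using h by simp
    have i: "i < ?H (2, a, Suc 0, 0)" "?H (0, a, Suc 0, i) = b"
      using hs b unfolding setrep_def i_def by blast+
    define N where "N = ?H (2, a, Suc 0, 0) + ?H (2, b, Suc 0, 0)"
    have "(\<Sum>i<N. codeH ?H i a * 8 ^ i) = (\<Sum>i<N. codeH ?H i b * 8 ^ i)"
      using eq slot_color_extend[OF ok, of a N] slot_color_extend[OF ok, of b N] by (simp add: N_def)
    then have "codeH ?H i a = codeH ?H i b"
      by (rule digit_sum_eq[rotated 2]) (use codeH_less[OF ok] i in \<open>auto simp: N_def\<close>)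
    moreover have "codeH ?H i a \<noteq> codeH ?H i (succH ?H i a)"
      by (rule functional_graph.code_neq[OF functional_graphI[OF ok] a]) (use i in simp)
    ultimately show False using i(2) by simp
  qed
  have "x u v + x v u = copies ?j" using balanced_sum[OF bal, of u v] e by (simp add: edge_weight_def)
  then have "halfs ?j < x u v \<or> halfs ?j < x v u" by linarith
  then have "slot_color ?H u \<noteq> slot_color ?H v" using main[of u v] main[of v u] by metis
  then show ?thesis using False by (simp add: query_color_def)
qed

lemma wp_query_represents:
  assumes "represents s E" "v < n"
  shows "wp w query_code (pass_vertex v s) (\<lambda>T s'. T \<le> 30000 * (max 1 (arboricity E)) * (L + 1) \<and> represents s' E \<and> mem s' = mem s \<and>
    regs s' 0 = query_color (mem s) v)"
proof -
  let ?N = "min (14 * arboricity E) (7 * L)"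
  have wf_state: "wf_state (pass_vertex v s)" using assms nM M_W by (simp add: represents_def wf_state_def pass_vertex_def)
  have m: "mem (pass_vertex v s) = mem s" "regs (pass_vertex v s) 0 = v" by (simp_all add: pass_vertex_def)
  show ?thesis
  proof (rule wp_mono[OF wp_query[OF wf_state m assms(2), of ?N]])
    assume j: "2 ^ level (mem s) \<le> L"
    show "slots_ok (view M (mem s) (level (mem s))) \<and> view M (mem s) (level (mem s)) (2, v, Suc 0, 0) \<le> ?N \<and> ?N \<le> 7 * L"
      using represents_slots_ok[OF assms(1) j] represents_slots_bound[OF assms(1) j assms(2)] by simp
  next
    fix T s' assume *: "T \<le> 2000 * (L + 1) * ?N + 500 * (L + 1) \<and> wf_state s' \<and> mem s' = mem s \<and> regs s' 0 = query_color (mem s) v"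
    have "2000 * (L + 1) * ?N \<le> 2000 * (L + 1) * (14 * max 1 (arboricity E))" by (intro mult_le_mono2) simp
    \<comment> \<open>In a graph without edges no slot is evaluated, yet the search for the scale
      still takes time of order \<open>L\<close>; this is covered by \<open>max 1\<close>.\<close>
    moreover have "500 * (L + 1) * 1 \<le> 500 * (L + 1) * max 1 (arboricity E)" by (intro mult_le_mono2) simp
    ultimately have "T \<le> 28500 * (max 1 (arboricity E) * (L + 1))" using * by (simp add: algebra_simps)
    then have "T \<le> 30000 * (max 1 (arboricity E)) * (L + 1)" by (simp add: mult.assoc)
    moreover have "represents s' E" using * assms(1) good_at_cong unfolding represents_def by metis
    ultimately show "T \<le> 30000 * (max 1 (arboricity E)) * (L + 1) \<and> represents s' E \<and> mem s' = mem s \<and>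
        regs s' 0 = query_color (mem s) v" using * by simp
  qed
qed

text \<open>All-zero memory already encodes empty sets, zero copies, zero degrees and zero counters.
  Hence initialization only has to compute the parameters.\<close>

lemma represents_init:
  assumes "wf_state s" "mem s = (\<lambda>_. 0)"
  shows "represents s {}"
  unfolding represents_def
proof (intro conjI allI impI assms(1))
  show "graph_on n {}" by (simp add: graph_on_def)
  fix j assume "2 ^ j \<le> L"
  then have jM: "j < M" using pow_Suc_le[of j] LM by linarith
  let ?s = "s\<lparr>regs := (regs s)(5 := j, 7 := halfs j)\<rparr>" and ?x = "\<lambda>_ _. 0 :: nat"
  have v: "view M (mem s) j = (\<lambda>_. 0)" using assms(2) by (auto simp: view_def fun_eq_iff)
  have hM: "halfs j < M" using halfs_le[of j] LM by linarith
  have wf_state: "wf_state ?s" using assms(1) jM hM M_W by (simp add: wf_state_def)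
  have d: "outdeg n ?x = (\<lambda>_. 0)" by (simp add: outdeg_def fun_eq_iff)
  have "sets (halfs j) ?x l u t = {}" for l u t by (simp add: sets_def)
  moreover have "setrep (\<lambda>_. 0) u t {}" for u t by (simp add: setrep_def)
  moreover have "count_full n Cap (\<lambda>_. 0) = 0" using Lpos by (simp add: count_full_def Cap_def)
  ultimately have "scale ?s j (sets (halfs j) ?x (labels Cap (outdeg n ?x))) ?x (outdeg n ?x) (count_full n Cap (outdeg n ?x))"
    using wf_state jM v d by (simp add: scale_def)
  moreover have "balanced n ?x l (edge_weight {} (copies j))" for l
    by (rule balancedI) (auto simp: edge_weight_def)
  ultimately have "chain ?s j (halfs j) ?x (outdeg n ?x) (edge_weight {} (copies j))"
    using hM by (simp add: chain_def edge_weight_def)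
  then show "good_at s j (edge_weight {} (copies j))" unfolding good_at_def good_def by blast
qed

lemma wp_init:
  assumes L_min: "\<And>l. l < L \<Longrightarrow> 2 ^ l \<le> n"
  shows "wp w init_code (start_state n) (\<lambda>T s'. T \<le> 100 * (L + 1) \<and> represents s' {})"
proof -
  define I where "I s \<longleftrightarrow> bdd W (regs s) \<and> mem s = (\<lambda>_. 0) \<and> regs s 0 = n \<and> regs s 2 = M \<and> regs s 3 \<le> L \<and>
    regs s 6 = 2 ^ regs s 3" for s :: ram
  let ?e = "Bin Less (Reg 6) (Bin Add (Reg 0) (Num 1))"
  let ?c = "Seq (Assign 6 (Bin Mul (Num 2) (Reg 6))) (Assign 3 (Bin Add (Reg 3) (Num 1)))"
  let ?s = "\<lparr>regs = (\<lambda>_. 0)(0 := n, 2 := M, 6 := 1), mem = (\<lambda>_. 0)\<rparr>"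
  have W: "M < W" "n + 1 < W" "2 * n < W" "1 < W" "L + 1 < W" "7 * L < W" "0 < W"
    using M_W nM LM n MCap Cap_def by linarith+
  have cond: "exp_val w ?e s = of_bool (regs s 3 < L)" if "I s" for s
  proof -
    have "exp_val w ?e s = of_bool (regs s 6 < n + 1)" using that W by (simp add: I_def)
    moreover have "regs s 6 < n + 1 \<longleftrightarrow> regs s 3 < L"
    proof
      assume "regs s 6 < n + 1"
      then have "(2::nat) ^ regs s 3 \<le> n" using that by (simp add: I_def)
      then have "(2::nat) ^ regs s 3 < 2 ^ L" using nL by (rule le_less_trans)
      then show "regs s 3 < L" by simp
    next
      assume "regs s 3 < L"
      then show "regs s 6 < n + 1" using L_min that by (simp add: I_def less_Suc_eq_le)
    qed
    ultimately show ?thesis by simp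
  qed
  have "wp w (While ?e ?c) ?s (\<lambda>T s'. I s' \<and> exp_val w ?e s' = 0 \<and> T \<le> 30 * (L - regs ?s 3) + 1 + exp_cost ?e)"
  proof (rule wp_For[where I = I and \<mu> = "\<lambda>s. L - regs s 3"])
    show "I ?s" using W by (simp add: I_def bdd_def)
    fix s assume I: "I s" and "exp_val w ?e s \<noteq> 0"
    then have lt: "regs s 3 < L" by (simp only: cond) simp
    have p: "2 * 2 ^ regs s 3 < W" using L_min[OF lt] W by linarith
    have e1: "exp_val w (Bin Mul (Num 2) (Reg 6)) s = 2 ^ Suc (regs s 3)"
      using I p by (simp add: I_def val_Mul)
    have e2: "exp_val w (Bin Add (Reg 3) (Num 1)) (s\<lparr>regs := (regs s)(6 := 2 ^ Suc (regs s 3))\<rparr>) = Suc (regs s 3)"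
      using I p lt W by (simp add: I_def)
    show "wp w ?c s (\<lambda>t s'. I s' \<and> L - regs s' 3 < L - regs s 3 \<and> 1 + exp_cost ?e + t \<le> 30)"
      unfolding wp_Seq wp_Assign e1 e2 using I p lt W by (auto simp: I_def)
  qed
  then have "wp w (Seq (While ?e ?c) (Assign 4 (Bin Mul (Num 7) (Reg 3)))) ?s (\<lambda>T s'. T \<le> 90 * (L + 1) \<and> represents s' {})"
  proof (rule wp_SeqI)
    fix T s' assume *: "I s' \<and> exp_val w ?e s' = 0 \<and> T \<le> 30 * (L - regs ?s 3) + 1 + exp_cost ?e"
    then have I: "I s'" by blast
    have "of_bool (regs s' 3 < L) = (0::nat)" using * by (simp only: cond[OF I, symmetric])
    then have r3: "regs s' 3 = L" using I by (simp add: I_def)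
    have e: "exp_val w (Bin Mul (Num 7) (Reg 3)) s' = Cap" using I r3 W by (simp add: I_def val_Mul Cap_def)
    have "bdd W (\<lambda>_. 0)" "Cap < W" using W by (simp_all add: bdd_def Cap_def)
    then have "wf_state (s'\<lparr>regs := (regs s')(4 := Cap)\<rparr>)" using I r3 by (simp add: I_def wf_state_def)
    then have "represents (s'\<lparr>regs := (regs s')(4 := Cap)\<rparr>) {}" by (rule represents_init) (use I in \<open>simp add: I_def\<close>)
    then show "wp w (Assign 4 (Bin Mul (Num 7) (Reg 3))) s' (\<lambda>t' s''. T + t' \<le> 90 * (L + 1) \<and> represents s'' {})"
      unfolding wp_Assign e using * by simp
  qed
  note main = this
  let ?s1 = "(start_state n)\<lparr>regs := (regs (start_state n))(2 := M)\<rparr>"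
  have e1: "exp_val w (Bin Mul (Num 16) (Reg 0)) (start_state n) = M"
  proof -
    have "16 < W" using M_W M32 by linarith
    then show ?thesis using W M_def by (simp add: start_state_def exp_val.simps)
  qed
  have e2: "exp_val w (Num 1) ?s1 = 1" by simp
  have s1: "?s1\<lparr>regs := (regs ?s1)(6 := 1)\<rparr> = ?s" by (simp add: start_state_def)
  show ?thesis
    unfolding init_code_def wp_Seq[of w "Assign 2 (Bin Mul (Num 16) (Reg 0))"] wp_Seq[of w "Assign 6 (Num 1)"]
      wp_Assign e1 e2 s1
    by (rule wp_mono[OF main]) auto
qed

section \<open>Reachable states and the final bounds\<close>

lemma reachable_represents:
  assumes L_min: "\<And>l. l < L \<Longrightarrow> 2 ^ l \<le> n"
  shows "reachable coloring_structure w n E s qs \<Longrightarrow>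
    represents s E \<and> (\<forall>q\<in>set qs. fst q < n \<and> snd q = query_color (mem s) (fst q))"
proof (induction rule: reachable.induct)
  case (init t s)
  then show ?case using wp_init[OF L_min] wp_exec by (force simp: coloring_structure_def)
next
  case (insert E s qs u v t s')
  then show ?case using wp_insert_edge[of s E u v] wp_exec[of w "update insert_copy" "pass_edge u v s" t s']
    by (simp add: coloring_structure_def)
next
  case (delete E s qs u v t s')
  then show ?case using wp_delete_edge[of s E u v] wp_exec[of w "update delete_copy" "pass_edge u v s" t s']
    by (simp add: coloring_structure_def)
next
  case (query E s qs v t s')
  \<comment> \<open>A query leaves the memory unchanged, so the answers collected earlier remain the
    values of \<open>query_color\<close> for the present memory.\<close>
  then show ?case using wp_query_represents[of s E v] wp_exec[of w query_code "pass_vertex v s" t s']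
    by (auto simp: coloring_structure_def)
qed

lemma halts_withinI: "wp w c s (\<lambda>t s'. t \<le> K \<and> P t s') \<Longrightarrow> real K \<le> T \<Longrightarrow> halts_within w c s T"
  unfolding wp_def halts_within_def by (meson of_nat_mono order_trans)

lemma coloring_structure_correct:
  assumes L_min: "\<And>l. l < L \<Longrightarrow> 2 ^ l \<le> n"
  shows "has_initialization_time coloring_structure w n (real n ^ 9)"
    "maintains_adaptive_implicit_coloring coloring_structure w n (\<lambda>\<alpha>. 2 ^ (42 * \<alpha>))"
    "has_update_time coloring_structure w n (24000000 * log 2 (real n) ^ 3)"
    "has_query_time coloring_structure w n (\<lambda>\<alpha>. 120000 * real (max 1 \<alpha>) * log 2 (real n))"
proof -
  have r: "represents s E \<and> (\<forall>q\<in>set qs. fst q < n \<and> snd q = query_color (mem s) (fst q))"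
    if "reachable coloring_structure w n E s qs" for E s qs
    by (rule reachable_represents[OF _ that]) (rule L_min)
  have Llog: "real L \<le> 2 * log 2 (real n)"
  proof -
    \<comment> \<open>Minimality of \<open>L\<close> gives \<open>L \<le> log 2 n + 1\<close>, and
      the summand \<open>1\<close> is absorbed because \<open>n\<close> is at least two.\<close>
    have "2 ^ (L - 1) \<le> n" using L_min[of "L - 1"] Lpos by simp
    then have "real (2 ^ (L - 1)) \<le> real n" by (rule of_nat_mono)
    then have "real (L - 1) \<le> log 2 (real n)" by (intro le_log_of_power) simp_all
    moreover have "1 \<le> log 2 (real n)" using n by simp
    ultimately show ?thesis using Lpos by (simp add: of_nat_diff)
  qed
  \<comment> \<open>The exponent \<open>9\<close> is chosen to swallow the constant factor even for
    \<open>n = 2\<close>, where \<open>2 ^ 8\<close> exceeds \<open>200\<close>.\<close>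
  have "100 * (L + 1) \<le> n ^ 9"
  proof -
    have "(2::nat) ^ 8 \<le> n ^ 8" using n by (intro power_mono) auto
    then have "256 * n \<le> n ^ 8 * n" by (intro mult_le_mono1) simp
    moreover have "100 * (L + 1) \<le> 100 * (2 * n)" by (rule mult_le_mono2) (use Ln n in simp)
    moreover have "n ^ 8 * n = n ^ 9" by (simp add: numeral_eq_Suc)
    ultimately show ?thesis by linarith
  qed
  then have "real (100 * (L + 1)) \<le> real n ^ 9" by (metis of_nat_mono of_nat_power)
  from halts_withinI[OF wp_init[OF L_min] this]
  show "has_initialization_time coloring_structure w n (real n ^ 9)"
    by (simp add: has_initialization_time_def coloring_structure_def)
  have upd: "real (6 * (unit_cost + 100) * L + 50) \<le> 24000000 * log 2 (real n) ^ 3"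
  proof -
    have "Suc Cap \<le> 8 * L" using Lpos by (simp add: Cap_def)
    then have "Suc Cap * Suc Cap \<le> (8 * L) * (8 * L)" by (intro mult_le_mono) auto
    moreover have LL: "1 \<le> L * L" "1 \<le> L * L * L" using Lpos by simp_all
    ultimately have "unit_cost + 100 \<le> 400000 * (L * L)" unfolding unit_cost_def by linarith
    then have "6 * ((unit_cost + 100) * L) \<le> 6 * (400000 * (L * L) * L)" by (intro mult_le_mono) auto
    then have "6 * (unit_cost + 100) * L + 50 \<le> 3000000 * (L * L * L)"
      using LL by (simp only: mult.assoc)
    then have "real (6 * (unit_cost + 100) * L + 50) \<le> real (3000000 * (L * L * L))" by (rule of_nat_mono)
    also have "\<dots> = 3000000 * real L ^ 3" by (simp add: power3_eq_cube)
    also have "\<dots> \<le> 3000000 * (2 * log 2 (real n)) ^ 3"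
      using power_mono[OF Llog, of 3] by simp
    also have "\<dots> = 24000000 * log 2 (real n) ^ 3" by (simp add: power_mult_distrib)
    finally show ?thesis .
  qed
  show "has_update_time coloring_structure w n (24000000 * log 2 (real n) ^ 3)"
    unfolding has_update_time_def
  proof (intro allI impI)
    fix E s qs u v
    assume "reachable coloring_structure w n E s qs" and uv: "u < n" "v < n" "u \<noteq> v"
    then have i: "represents s E" using r by blast
    show "if {u, v} \<in> E then halts_within w (delete_edge coloring_structure) (pass_edge u v s) (24000000 * log 2 (real n) ^ 3)
      else halts_within w (insert_edge coloring_structure) (pass_edge u v s) (24000000 * log 2 (real n) ^ 3)"
      using halts_withinI[OF wp_delete_edge[OF i, of u v] upd] halts_withinI[OF wp_insert_edge[OF i uv] upd]
      by (simp add: coloring_structure_def)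
  qed
  show "has_query_time coloring_structure w n (\<lambda>\<alpha>. 120000 * real (max 1 \<alpha>) * log 2 (real n))"
    unfolding has_query_time_def
  proof (intro allI impI)
    fix E s qs v
    assume "reachable coloring_structure w n E s qs" and v: "v < n"
    then have i: "represents s E" using r by blast
    have "real (30000 * max 1 (arboricity E) * (L + 1)) = 30000 * real (max 1 (arboricity E)) * (real L + 1)"
      by (simp add: algebra_simps)
    also have "\<dots> \<le> 30000 * real (max 1 (arboricity E)) * (4 * log 2 (real n))"
      using Llog Lpos by (intro mult_left_mono) auto
    finally have "real (30000 * max 1 (arboricity E) * (L + 1)) \<le> 120000 * real (max 1 (arboricity E)) * log 2 (real n)"
      by simp
    then show "halts_within w (query coloring_structure) (pass_vertex v s) (120000 * real (max 1 (arboricity E)) * log 2 (real n))"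
      using halts_withinI[OF wp_query_represents[OF i v]] by (simp add: coloring_structure_def)
  qed
  show "maintains_adaptive_implicit_coloring coloring_structure w n (\<lambda>\<alpha>. 2 ^ (42 * \<alpha>))"
    unfolding maintains_adaptive_implicit_coloring_def
  proof (intro allI impI)
    fix E s qs assume "reachable coloring_structure w n E s qs"
    from r[OF this] have i: "represents s E" and qs: "\<And>q. q \<in> set qs \<Longrightarrow> fst q < n \<and> snd q = query_color (mem s) (fst q)" by auto
    have "consistent E qs"
      unfolding consistent_def using query_color_proper[OF i] qs nth_mem by metis
    moreover have "snd ` set qs \<subseteq> {1..2 ^ (42 * arboricity E)}"
      using query_color_range[OF i] qs by (metis (no_types, lifting) image_subsetI)
    ultimately show "consistent E qs \<and> snd ` set qs \<subseteq> {1..2 ^ (42 * arboricity E)}" ..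
  qed
qed

end

theorem theorem2:
  shows "\<exists>(D :: data_structure) (b :: nat) (d :: nat) (a :: nat) (c\<^sub>u :: real) (c\<^sub>q :: real). b \<ge> 1 \<and>
    (\<forall>n \<ge> 2. let w = word_length b n in
       has_initialization_time D w n (real n ^ d) \<and>
       maintains_adaptive_implicit_coloring D w n (\<lambda>\<alpha>. 2 ^ (a * \<alpha>)) \<and>
       has_update_time D w n (c\<^sub>u * log 2 (real n) ^ 3) \<and>
       has_query_time D w n (\<lambda>\<alpha>. c\<^sub>q * real (max 1 \<alpha>) * log 2 (real n)))"
proof (intro exI conjI allI impI)
  show "(1::nat) \<le> 40" by simp
  fix n :: nat assume n: "2 \<le> n"
  \<comment> \<open>This is the least \<open>L\<close> with \<open>n < 2 ^ L\<close>, so the word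
    length with factor \<open>40\<close> is exactly \<open>40 * L\<close>, as the locale
    requires.\<close>
  define L where "L = ceillog2 (n + 1)"
  have L: "L \<le> l \<longleftrightarrow> n + 1 \<le> 2 ^ l" for l using ceillog2_le_iff[of "n + 1" l] by (simp add: L_def)
  have L_min: "2 ^ l \<le> n" if "l < L" for l using L[of l] that by linarith
  interpret machine "40 * L" n L "16 * n" "7 * L"
  proof
    show "n < 2 ^ L" using L[of L] by simp
    show "L \<le> n" using L[of n] less_exp[of n] by simp
    show "0 < L" using L[of 0] n by simp
  qed (use n in simp_all)
  show "let w = word_length 40 n in
     has_initialization_time coloring_structure w n (real n ^ 9) \<and>
     maintains_adaptive_implicit_coloring coloring_structure w n (\<lambda>\<alpha>. 2 ^ (42 * \<alpha>)) \<and>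
     has_update_time coloring_structure w n (24000000 * log 2 (real n) ^ 3) \<and>
     has_query_time coloring_structure w n (\<lambda>\<alpha>. 120000 * real (max 1 \<alpha>) * log 2 (real n))"
    using coloring_structure_correct[OF L_min] by (simp add: word_length_def L_def)
qed

end
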